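(* Let $n\ge1$ and let the functions $\gamma_1(t),\ldots,\gamma_n(t)$ be analytic or meromorphic on the interval $[\alpha,\beta]$. Denote by $\{t_i\}_{i=1}^N\subset[\alpha,\beta]$ the set of points where at least one of them has a pole. These functions are invariants for some linear control system $\dot x=A(t)x+b(t)u$ ($x\in\mathbb{R}^n$, $u\in\mathbb{R}$) with analytic matrices on $[\alpha,\beta]$ if and only if they satisfy the following conditions at any $t_i$, $i=1,\ldots,N$: (i) each function $\gamma_s(t)$ is analytic in a neighborhood of $t=t_i$ or meromorphic with a pole at $t=t_i$ of order no greater than $n-s+1$, i.e., $\gamma_s(t)$ are expanded into convergent series $$\gamma_s(t)=\sum_{j=-n+s-1}^\infty\gamma_{s,j}(t-t_i)^j,\quad s=1,\ldots,n;$$ (ii) the polynomial equation in $k$ $$k^{\underline{n}}-\sum_{s=1}^n k^{\underline{n-s}}\gamma_{n-s+1,-s}=0$$ has $n$ different nonnegative integer solutions $0\le k_1<\cdots<k_n$; (iii) the following equality holds: $$\mathrm{rank}\begin{pmatrix} V_{k_1+1,k_1}&V_{k_1+1,k_1+1}&0&\cdots&0\\ \cdots&\cdots&\cdots&\cdots&\cdots\\ V_{k_n-1,k_1}&V_{k_n-1,k_1+1}&\cdots&\cdots&V_{k_n-1,k_n-1}\\ V_{k_n,k_1}&V_{k_n,k_1+1}&\cdots&\cdots&V_{k_n,k_n-1} \end{pmatrix}=k_n-k_1-n+1,$$ where $$V_{k,k}=k^{\underline{n}}-\sum_{s=1}^n k^{\underline{n-s}}\gamma_{n-s+1,-s}\quad\text{for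 } k_1+1\le k\le k_n-1,$$ $$V_{k,j}=-\sum_{s=1}^n j^{\underline{n-s}}\gamma_{n-s+1,k-j-s}\quad\text{for } k_1\le j\le k-1\le k_n-1.$$
   Context: Analytic means real analytic. "Meromorphic on $[\alpha,\beta]$" means real analytic on $[\alpha,\beta]$ except for finitely many points, which are poles. Falling factorial: for integers $k,q\ge0$, $k^{\underline{0}}=1$ and $k^{\underline{q}}=k(k-1)\cdots(k-q+1)$ for $q\ge1$ (so $k^{\underline{q}}=0$ if $q>k$). In a polynomial equation in $k$, $k^{\underline{q}}$ is understood as this polynomial. Linear systems and invariants: a linear control system $\dot x=A(t)x+b(t)u$ has analytic matrices on $[\alpha,\beta]$ if the $n\times n$ matrix $A(t)$ and the vector $b(t)\in\mathbb{R}^n$ are real analytic on $[\alpha,\beta]$. Throughout, such systems are assumed controllable on $[\alpha,\beta]$. Put $\Delta^k(t)=(-A(t)+\frac{d}{dt})^kb(t)$, $k\ge0$, and $K(t)=(\Delta^0(t),\Delta^1(t),\ldots,\Delta^{n-1}(t))$. Controllability implies that $K(t)$ is invertible on $[\alpha,\beta]$ except possibly at finitely many points. The invariants of the system are the components $\gamma_1(t),\ldots,\gamma_n(t)$ of $\gamma(t)=K^{-1}(t)\Delta^n(t)$, which are meromorphic functions on $[\alpha,\beta]$. The matrix in (iii) is the $(k_n-k_1)\times(k_n-k_1)$ matrix with rows indexed by $k=k_1+1,\ldots,k_n$ and columns indexed by $j=k_1,\ldots,k_n-1$, whose $(k,j)$ entry is $V_{k,j}$ if $j\le k$ and $0$ if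 $j>k$. The coefficients $\gamma_{s,j}$, the roots $k_1,\ldots,k_n$ and the numbers $V_{k,j}$ depend on the point $t_i$ under consideration. For $n=1$ condition (iii) is not required. *)

theory Defs
  imports "HOL-Analysis.Derivative" "Jordan_Normal_Form.DL_Rank"
begin

text \<open>
  Functions are total, but only their values on \<open>S\<close> matter below; at an endpoint of
  \<open>S = {\<alpha>..\<beta>}\<close> the expansions are required on the inner side only. This is the same as
  analyticity (meromorphy) of a suitable extension to a neighbourhood of \<open>S\<close>.
\<close>

definition real_analytic_at :: "real set \<Rightarrow> (real \<Rightarrow> real) \<Rightarrow> real \<Rightarrow> bool" where
  "real_analytic_at S f t \<longleftrightarrow>
     (\<exists>c :: nat \<Rightarrow> real. \<exists>r>0. \<forall>x\<in>S. \<bar>x - t\<bar> < r \<longrightarrow> (\<lambda>j. c j * (x - t) ^ j) sums f x)"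

definition real_analytic_on :: "real set \<Rightarrow> (real \<Rightarrow> real) \<Rightarrow> bool" where
  "real_analytic_on S f \<longleftrightarrow> (\<forall>t\<in>S. real_analytic_at S f t)"

text \<open>
  \<open>laurent_expansion S f t m c\<close>: near \<open>t\<close>, but not at \<open>t\<close>, the function \<open>f\<close> is the sum of the
  convergent series of the \<open>c j * (x - t)\<^sup>j\<close> over all integers \<open>j \<ge> - m\<close>. The value \<open>f t\<close> is
  irrelevant, and so are the \<open>c j\<close> with \<open>j < - m\<close>.
\<close>

definition laurent_expansion ::
    "real set \<Rightarrow> (real \<Rightarrow> real) \<Rightarrow> real \<Rightarrow> nat \<Rightarrow> (int \<Rightarrow> real) \<Rightarrow> bool" where
  "laurent_expansion S f t m c \<longleftrightarrow>
     (\<exists>r>0. \<forall>x\<in>S. 0 < \<bar>x - t\<bar> \<and> \<bar>x - t\<bar> < r \<longrightarrow>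
        (\<lambda>i::nat. c (int i - int m) * (x - t) powi (int i - int m)) sums f x)"

definition real_pole_at :: "real set \<Rightarrow> (real \<Rightarrow> real) \<Rightarrow> real \<Rightarrow> bool" where
  "real_pole_at S f t \<longleftrightarrow> (\<exists>m>0. \<exists>c. c (- int m) \<noteq> 0 \<and> laurent_expansion S f t m c)"

definition real_meromorphic_on :: "real set \<Rightarrow> (real \<Rightarrow> real) \<Rightarrow> bool" where
  "real_meromorphic_on S f \<longleftrightarrow>
     (\<exists>P\<subseteq>S. finite P \<and> (\<forall>t\<in>P. real_pole_at S f t) \<and> (\<forall>t\<in>S - P. real_analytic_at S f t))"

definition analytic_system ::
    "nat \<Rightarrow> real \<Rightarrow> real \<Rightarrow> (real \<Rightarrow> real mat) \<Rightarrow> (real \<Rightarrow> real vec) \<Rightarrow> bool" where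
  "analytic_system n \<alpha> \<beta> A b \<longleftrightarrow>
     (\<forall>t\<in>{\<alpha>..\<beta>}. A t \<in> carrier_mat n n \<and> b t \<in> carrier_vec n) \<and>
     (\<forall>i<n. \<forall>j<n. real_analytic_on {\<alpha>..\<beta>} (\<lambda>t. A t $$ (i, j))) \<and>
     (\<forall>i<n. real_analytic_on {\<alpha>..\<beta>} (\<lambda>t. b t $ i))"

definition trajectory ::
    "nat \<Rightarrow> real \<Rightarrow> real \<Rightarrow> (real \<Rightarrow> real mat) \<Rightarrow> (real \<Rightarrow> real vec) \<Rightarrow>
     (real \<Rightarrow> real) \<Rightarrow> (real \<Rightarrow> real vec) \<Rightarrow> bool" where
  "trajectory n \<alpha> \<beta> A b u x \<longleftrightarrow>
     (\<forall>t\<in>{\<alpha>..\<beta>}. x t \<in> carrier_vec n \<and>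
        (\<forall>i<n. ((\<lambda>\<tau>. x \<tau> $ i) has_real_derivative (A t *\<^sub>v x t + u t \<cdot>\<^sub>v b t) $ i)
                  (at t within {\<alpha>..\<beta>})))"

text \<open>
  Controls are continuous; for linear systems with continuous coefficients, bounded measurable or
  square integrable controls give the same notion.
\<close>

definition controllable ::
    "nat \<Rightarrow> real \<Rightarrow> real \<Rightarrow> (real \<Rightarrow> real mat) \<Rightarrow> (real \<Rightarrow> real vec) \<Rightarrow> bool" where
  "controllable n \<alpha> \<beta> A b \<longleftrightarrow>
     (\<forall>x\<^sub>0\<in>carrier_vec n. \<forall>x\<^sub>1\<in>carrier_vec n. \<exists>u x.
        continuous_on {\<alpha>..\<beta>} u \<and> trajectory n \<alpha> \<beta> A b u x \<and> x \<alpha> = x\<^sub>0 \<and> x \<beta> = x\<^sub>1)"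

text \<open>
  \<open>Delta n \<alpha> \<beta> A b k = (- A + d/dt)\<^sup>k b\<close> on \<open>{\<alpha>..\<beta>}\<close>; the derivative is one-sided at the endpoints.
\<close>

primrec Delta ::
    "nat \<Rightarrow> real \<Rightarrow> real \<Rightarrow> (real \<Rightarrow> real mat) \<Rightarrow> (real \<Rightarrow> real vec) \<Rightarrow> nat \<Rightarrow> real \<Rightarrow> real vec" where
  "Delta n \<alpha> \<beta> A b 0 = b"
| "Delta n \<alpha> \<beta> A b (Suc k) =
     (\<lambda>t. - (A t *\<^sub>v Delta n \<alpha> \<beta> A b k t) +
        vec n (\<lambda>i. vector_derivative (\<lambda>\<tau>. Delta n \<alpha> \<beta> A b k \<tau> $ i) (at t within {\<alpha>..\<beta>})))"

definition Kmat ::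
    "nat \<Rightarrow> real \<Rightarrow> real \<Rightarrow> (real \<Rightarrow> real mat) \<Rightarrow> (real \<Rightarrow> real vec) \<Rightarrow> real \<Rightarrow> real mat" where
  "Kmat n \<alpha> \<beta> A b t = mat_of_cols n (map (\<lambda>k. Delta n \<alpha> \<beta> A b k t) [0..<n])"

text \<open>
  \<open>\<gamma> 1, \<dots>, \<gamma> n\<close> are the components of \<open>K\<inverse> \<Delta>\<^sup>n\<close>. The equality is imposed at every point where \<open>K\<close>
  is invertible; at the finitely many others (for a controllable system) the functions are
  determined, up to their values at poles, by being meromorphic on \<open>{\<alpha>..\<beta>}\<close>.
\<close>

definition invariants ::
    "nat \<Rightarrow> real \<Rightarrow> real \<Rightarrow> (real \<Rightarrow> real mat) \<Rightarrow> (real \<Rightarrow> real vec) \<Rightarrow> (nat \<Rightarrow> real \<Rightarrow> real) \<Rightarrow> bool"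
where
  "invariants n \<alpha> \<beta> A b \<gamma> \<longleftrightarrow>
     (\<forall>s\<in>{1..n}. real_meromorphic_on {\<alpha>..\<beta>} (\<gamma> s)) \<and>
     (\<forall>t\<in>{\<alpha>..\<beta>}. \<forall>Kinv\<in>carrier_mat n n.
        inverts_mat (Kmat n \<alpha> \<beta> A b t) Kinv \<and> inverts_mat Kinv (Kmat n \<alpha> \<beta> A b t) \<longrightarrow>
        vec n (\<lambda>i. \<gamma> (i + 1) t) = Kinv *\<^sub>v Delta n \<alpha> \<beta> A b n t)"

definition falling_factorial :: "nat \<Rightarrow> nat \<Rightarrow> real" where
  "falling_factorial k q = (\<Prod>i<q. real k - real i)"

text \<open>
  \<open>c s j\<close> stands for the coefficient of \<open>(x - t)\<^sup>j\<close> in the expansion of \<open>\<gamma>\<^sub>s\<close> at a pole \<open>t\<close>.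
  \<open>Vcoeff n c k k\<close> is the indicial polynomial at \<open>k\<close>.
\<close>

definition Vcoeff :: "nat \<Rightarrow> (nat \<Rightarrow> int \<Rightarrow> real) \<Rightarrow> nat \<Rightarrow> nat \<Rightarrow> real" where
  "Vcoeff n c k j =
     (if j = k then
        falling_factorial k n
          - (\<Sum>s=1..n. falling_factorial k (n - s) * c (n - s + 1) (- int s))
      else if j < k then
        - (\<Sum>s=1..n. falling_factorial j (n - s) * c (n - s + 1) (int k - int j - int s))
      else 0)"

text \<open>Rows \<open>p + 1, \<dots>, q\<close> and columns \<open>p, \<dots>, q - 1\<close> are shifted to start at \<open>0\<close>.\<close>

definition Vmatrix :: "nat \<Rightarrow> (nat \<Rightarrow> int \<Rightarrow> real) \<Rightarrow> nat \<Rightarrow> nat \<Rightarrow> real mat" where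
  "Vmatrix n c p q = mat (q - p) (q - p) (\<lambda>(i, j). Vcoeff n c (p + 1 + i) (p + j))"

definition real_mat_rank :: "real mat \<Rightarrow> nat" where
  "real_mat_rank M = vec_space.rank (dim_row M) M"

end

theory Submission
  imports Defs "HOL-Complex_Analysis.Cauchy_Integral_Formula"
begin

unbundle no vec_syntax

text \<open>
  Let \<open>\<Psi>\<close> solve \<open>\<Psi>' = - \<Psi> A\<close> and put \<open>g = \<Psi> b\<close>. Then the \<open>k\<close>-th derivative of \<open>g\<close> is \<open>\<Psi> \<Delta>\<^sup>k\<close>, so the
  components of \<open>g\<close> are analytic solutions of the scalar equation
  \<open>y\<^sup>(\<^sup>n\<^sup>) = \<gamma>\<^sub>1 y + \<dots> + \<gamma>\<^sub>n y\<^sup>(\<^sup>n\<^sup>-\<^sup>1\<^sup>)\<close>, and controllability says that they are linearly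
  independent. Conversely \<open>n\<close> independent analytic solutions \<open>y\<close> give the system \<open>A = 0\<close>, \<open>b = y\<close>.
  Hence \<open>\<gamma>\<close> is realizable iff the equation has \<open>n\<close> independent analytic solutions on the whole
  interval. By continuation this is a local condition at the poles: there must be \<open>n\<close> power series
  solutions, and these have \<open>n\<close> different orders. Comparing lowest coefficients, the orders force the
  bound on the poles and are the roots of the indicial polynomial. The coefficients satisfy the
  recurrence given by \<open>V\<close>, which is uniquely solvable beyond the largest root, and the rank
  condition says that a solution starts at each root. Such series converge by a majorant argument.
\<close>

section \<open>Expansions at a point of a set of reals\<close>

text \<open>The value of a \<gamma> at a pole carries no information, and an endpoint of the
  interval has one side only. Local arguments therefore use expansions on punctured neighbourhoods
  within S, and poles are removed by multiplying with a power of x - t, which leaves formal power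
  series. How large a power is needed is not known beforehand; the bound in (i) comes from a count
  of zeros, since the lowest coefficients of a relation between the x^j y^(j), for n solutions of
  different orders, form a polynomial of degree below n with n zeros. The same count makes
  Wronskians nonzero. Initial values cannot be prescribed freely at a pole, so continuation works
  with solution spaces that attain all initial values off a finite set. The invariants are
  prescribed wherever K is invertible; as \<gamma> is arbitrary at a pole, a realization must be
  shown to have a singular K there. For a given system, invertibility of K near a point is read off
  from the Wronskian of the functions \<Psi> b, whose independence is where controllability
  enters.\<close>

definition expands_at :: "real set \<Rightarrow> (real \<Rightarrow> real) \<Rightarrow> real \<Rightarrow> real fps \<Rightarrow> bool" where
  "expands_at S f t F \<longleftrightarrow>
     fps_conv_radius F > 0 \<and> (\<forall>\<^sub>F x in at t within S. f x = eval_fps F (x - t))"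

lemma eventually_in_conv_radius:
  fixes F :: "real fps"
  assumes "fps_conv_radius F > 0"
  shows "\<forall>\<^sub>F x in at t within S. ereal (norm (x - t)) < fps_conv_radius F"
proof -
  obtain r where r: "0 < ereal r" "ereal r < fps_conv_radius F"
    using ereal_dense2[OF assms] by auto
  then have "\<forall>\<^sub>F x in at t within S. dist x t < r"
    unfolding eventually_at by (intro exI[of _ r]) auto
  then show ?thesis
    by eventually_elim (use r in \<open>auto simp: dist_norm intro: less_trans[of _ "ereal r"]\<close>)
qed

lemma expands_atI:
  assumes "fps_conv_radius F > 0" "\<forall>\<^sub>F x in at t within S. f x = eval_fps F (x - t)"
  shows "expands_at S f t F"
  using assms by (simp add: expands_at_def)

lemma expands_at_cong:
  assumes "expands_at S f t F" "\<forall>\<^sub>F x in at t within S. f x = g x"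
  shows "expands_at S g t F"
proof -
  have "\<forall>\<^sub>F x in at t within S. g x = eval_fps F (x - t)"
    using assms(2) assms(1)[unfolded expands_at_def, THEN conjunct2]
    by eventually_elim simp
  then show ?thesis using assms(1) by (simp add: expands_at_def)
qed

lemma expands_at_const: "expands_at S (\<lambda>_. c) t (fps_const c)"
  by (simp add: expands_at_def)

lemma expands_at_power: "expands_at S (\<lambda>x. (x - t) ^ m) t (fps_X ^ m)"
  by (simp add: expands_at_def)

lemma expands_at_add:
  assumes "expands_at S f t F" "expands_at S g t G"
  shows "expands_at S (\<lambda>x. f x + g x) t (F + G)"
proof (rule expands_atI)
  have pos: "fps_conv_radius F > 0" "fps_conv_radius G > 0"
    using assms by (auto simp: expands_at_def)
  show "fps_conv_radius (F + G) > 0"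
    using fps_conv_radius_add[of F G] pos by (metis less_le_trans min_less_iff_conj)
  show "\<forall>\<^sub>F x in at t within S. f x + g x = eval_fps (F + G) (x - t)"
    using eventually_in_conv_radius[OF pos(1)] eventually_in_conv_radius[OF pos(2)]
      assms(1)[unfolded expands_at_def, THEN conjunct2]
      assms(2)[unfolded expands_at_def, THEN conjunct2]
    by eventually_elim (simp add: eval_fps_add)
qed

lemma expands_at_mult:
  assumes "expands_at S f t F" "expands_at S g t G"
  shows "expands_at S (\<lambda>x. f x * g x) t (F * G)"
proof (rule expands_atI)
  have pos: "fps_conv_radius F > 0" "fps_conv_radius G > 0"
    using assms by (auto simp: expands_at_def)
  show "fps_conv_radius (F * G) > 0"
    using fps_conv_radius_mult[of F G] pos by (metis less_le_trans min_less_iff_conj)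
  show "\<forall>\<^sub>F x in at t within S. f x * g x = eval_fps (F * G) (x - t)"
    using eventually_in_conv_radius[OF pos(1)] eventually_in_conv_radius[OF pos(2)]
      assms(1)[unfolded expands_at_def, THEN conjunct2]
      assms(2)[unfolded expands_at_def, THEN conjunct2]
    by eventually_elim (simp add: eval_fps_mult)
qed

lemma expands_at_minus:
  assumes "expands_at S f t F"
  shows "expands_at S (\<lambda>x. - f x) t (- F)"
  using expands_at_mult[OF expands_at_const[of S "-1" t] assms]
  by (simp flip: fps_const_neg)

lemma expands_at_diff:
  assumes "expands_at S f t F" "expands_at S g t G"
  shows "expands_at S (\<lambda>x. f x - g x) t (F - G)"
  using expands_at_add[OF assms(1) expands_at_minus[OF assms(2)]] by simp

lemma expands_at_sum:
  assumes "\<And>i. i \<in> I \<Longrightarrow> expands_at S (f i) t (F i)"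
  shows "expands_at S (\<lambda>x. \<Sum>i\<in>I. f i x) t (\<Sum>i\<in>I. F i)"
  using assms
proof (induction I rule: infinite_finite_induct)
  case (insert i I)
  then show ?case using expands_at_add[of S "f i" t "F i"] by simp
qed (use expands_at_const[of S 0 t] in simp_all)

lemma expands_at_prod:
  assumes "\<And>i. i \<in> I \<Longrightarrow> expands_at S (f i) t (F i)"
  shows "expands_at S (\<lambda>x. \<Prod>i\<in>I. f i x) t (\<Prod>i\<in>I. F i)"
  using assms
proof (induction I rule: infinite_finite_induct)
  case (insert i I)
  then show ?case using expands_at_mult[of S "f i" t "F i"] by simp
qed (use expands_at_const[of S 1 t] in simp_all)

text \<open>By the Leibniz formula the determinant is a polynomial in its entries, so closure under
  sums and products is enough. Nonvanishing of a determinant of power series thereby gives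
  nonvanishing of numerical determinants near t.\<close>

lemma expands_at_det:
  assumes "\<And>i j. i < n \<Longrightarrow> j < n \<Longrightarrow> expands_at S (f i j) t (F i j)"
  shows "expands_at S (\<lambda>x. Determinant.det (Matrix.mat n n (\<lambda>(i, j). f i j x))) t
           (Determinant.det (Matrix.mat n n (\<lambda>(i, j). F i j)))"
proof -
  have det_expand: "Determinant.det (Matrix.mat n n (\<lambda>(i, j). a i j)) =
      (\<Sum>p\<in>{p. p permutes {0..<n}}. signof p * (\<Prod>i\<in>{0..<n}. a i (p i)))"
    for a :: "nat \<Rightarrow> nat \<Rightarrow> 'a :: comm_ring_1"
  proof -
    have "(\<Prod>i\<in>{0..<n}. Matrix.mat n n (\<lambda>(i, j). a i j) $$ (i, p i)) = (\<Prod>i\<in>{0..<n}. a i (p i))"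
      if "p permutes {0..<n}" for p
      by (rule prod.cong) (use permutes_in_image[OF that] in \<open>auto\<close>)
    then show ?thesis
      by (auto simp: Determinant.det_def intro!: sum.cong)
  qed
  have sgn: "(signof p :: real fps) = fps_const (signof p)" for p :: "nat \<Rightarrow> nat"
    by (simp add: sign_def)
  show ?thesis
    unfolding det_expand sgn
    by (intro expands_at_sum expands_at_mult expands_at_const expands_at_prod assms)
      (auto dest: permutes_in_image)
qed

text \<open>Zeros are isolated: dividing by the power of x - t given by the subdegree leaves a
  series with nonzero constant term, which stays nonzero near 0 by continuity.\<close>

lemma eventually_eval_fps_nonzero:
  fixes F :: "real fps"
  assumes "F \<noteq> 0" "fps_conv_radius F > 0"
  shows "\<forall>\<^sub>F x in at t within S. eval_fps F (x - t) \<noteq> 0"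
proof -
  define d where "d = subdegree F"
  define G where "G = fps_shift d F"
  have r: "fps_conv_radius G > 0" using assms by (simp add: G_def)
  have G0: "eval_fps G 0 \<noteq> 0"
    using assms by (simp add: G_def d_def eval_fps_at_0)
  have cont: "isCont (eval_fps G) 0"
    using r by (intro continuous_eval_fps) (auto simp: zero_ereal_def)
  then have "\<forall>\<^sub>F y in nhds 0. eval_fps G y \<noteq> 0"
    using G0 continuous_at_avoid[OF cont G0]
    by (auto simp: eventually_nhds_metric dist_commute)
  then have "\<forall>\<^sub>F x in at t within S. eval_fps G (x - t) \<noteq> 0"
    by (rule eventually_compose_filterlim) (auto intro!: tendsto_eq_intros)
  moreover have "\<forall>\<^sub>F x in at t within S. x \<noteq> t"
    by (auto simp: eventually_at_filter)
  ultimately show ?thesis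
    using eventually_in_conv_radius[OF assms(2)]
  proof eventually_elim
    case (elim x)
    have "eval_fps G (x - t) = eval_fps F (x - t) / (x - t) ^ d"
      using elim by (simp add: G_def d_def eval_fps_shift)
    then show ?case using elim by auto
  qed
qed

lemma expands_at_0D:
  assumes "expands_at S f t F" "\<exists>\<^sub>F x in at t within S. f x = 0"
  shows "F = 0"
proof (rule ccontr)
  assume "F \<noteq> 0"
  then have "\<forall>\<^sub>F x in at t within S. eval_fps F (x - t) \<noteq> 0"
    using assms by (intro eventually_eval_fps_nonzero) (auto simp: expands_at_def)
  then have "\<forall>\<^sub>F x in at t within S. f x \<noteq> 0"
    using assms(1)[unfolded expands_at_def, THEN conjunct2] by eventually_elim simp
  then show False using assms(2) by (simp add: frequently_def)
qed

lemma expands_at_nonzero: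
  assumes "expands_at S f t F" "F \<noteq> 0"
  shows "\<forall>\<^sub>F x in at t within S. f x \<noteq> 0"
  using expands_at_0D[OF assms(1)] assms(2) by (auto simp: frequently_def)

lemma expands_at_unique:
  assumes "expands_at S f t F" "expands_at S f t G" "at t within S \<noteq> bot"
  shows "F = G"
  using expands_at_0D[OF expands_at_diff[OF assms(1,2)]] assms(3)
  by (simp add: eventually_frequently)

section \<open>Differentiation of expansions\<close>

lemma expands_at_has_derivative_center:
  assumes "expands_at S f t F" "f t = fps_nth F 0" "t \<in> S"
  shows "(f has_real_derivative fps_nth (fps_deriv F) 0) (at t within S)"
proof -
  obtain d where d: "d > 0" "\<And>x. x \<in> S \<Longrightarrow> x \<noteq> t \<Longrightarrow> dist x t < d \<Longrightarrow> f x = eval_fps F (x - t)"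
    using assms(1) unfolding expands_at_def eventually_at by auto
  have "((\<lambda>x. eval_fps F (x - t)) has_real_derivative eval_fps (fps_deriv F) (t - t) * 1) (at t within S)"
    using assms(1) unfolding expands_at_def
    by (intro DERIV_chain2[where f = "eval_fps F"] has_field_derivative_eval_fps)
      (auto simp: zero_ereal_def intro!: derivative_eq_intros)
  then have "((\<lambda>x. eval_fps F (x - t)) has_real_derivative fps_nth (fps_deriv F) 0) (at t within S)"
    by (simp add: eval_fps_at_0)
  then show ?thesis
    by (rule has_field_derivative_transform_within[OF _ d(1) assms(3)])
      (use d(2) assms(2) in \<open>force simp: eval_fps_at_0\<close>)
qed

lemma expands_at_has_derivative:
  assumes "expands_at S f t F"
  shows "\<forall>\<^sub>F x in at t within S.
    (f has_real_derivative eval_fps (fps_deriv F) (x - t)) (at x within S)"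
proof -
  obtain d where d: "d > 0" "\<And>x. x \<in> S \<Longrightarrow> x \<noteq> t \<Longrightarrow> dist x t < d \<Longrightarrow>
      f x = eval_fps F (x - t) \<and> ereal (norm (x - t)) < fps_conv_radius F"
    using eventually_conj[OF assms[unfolded expands_at_def, THEN conjunct2]
        eventually_in_conv_radius[OF assms[unfolded expands_at_def, THEN conjunct1]]]
    unfolding eventually_at by auto
  show ?thesis unfolding eventually_at
  proof (intro exI[of _ d] conjI d(1) ballI impI)
    fix x assume x: "x \<in> S" "x \<noteq> t \<and> dist x t < d"
    have "((\<lambda>x. eval_fps F (x - t)) has_real_derivative eval_fps (fps_deriv F) (x - t) * 1) (at x within S)"
      using d(2)[of x] x
      by (intro DERIV_chain2[where f = "eval_fps F"] has_field_derivative_eval_fps)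
        (auto intro!: derivative_eq_intros)
    then have D: "((\<lambda>x. eval_fps F (x - t)) has_real_derivative eval_fps (fps_deriv F) (x - t)) (at x within S)"
      by simp
    show "(f has_real_derivative eval_fps (fps_deriv F) (x - t)) (at x within S)"
    proof (rule has_field_derivative_transform_within[OF D _ x(1)])
      \<comment> \<open>The ball around x has to stay inside the disc around t and to avoid t, where
        the value of f is unrestricted.\<close>
      show "0 < min (dist x t) (d - dist x t)" using x by auto
      fix y assume "y \<in> S" "dist y x < min (dist x t) (d - dist x t)"
      then show "eval_fps F (y - t) = f y"
        using d(2)[of y] dist_triangle[of y t x] by (cases "y = t") (auto simp: dist_commute)
    qed
  qed
qed

text \<open>Derivatives within S are unique at points where S accumulates, so g agrees near t with
  the derivative of the sum of F.\<close>

lemma expands_at_deriv: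
  assumes "expands_at S f t F"
    and "\<forall>\<^sub>F x in at t within S. (f has_real_derivative g x) (at x within S)"
    and nontriv: "\<And>x. x \<in> S \<Longrightarrow> at x within S \<noteq> bot"
  shows "expands_at S g t (fps_deriv F)"
proof (rule expands_atI)
  show "fps_conv_radius (fps_deriv F) > 0"
    using assms(1) fps_conv_radius_deriv[of F] by (auto simp: expands_at_def intro: less_le_trans)
  have "\<forall>\<^sub>F x in at t within S. x \<in> S" by (auto simp: eventually_at_filter)
  with expands_at_has_derivative[OF assms(1)] assms(2)
  show "\<forall>\<^sub>F x in at t within S. g x = eval_fps (fps_deriv F) (x - t)"
  proof eventually_elim
    case (elim x)
    then show ?case
      using has_real_derivative_iff_has_vector_derivative
        vector_derivative_unique_within[OF nontriv] by metis
  qed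
qed

lemma at_within_Icc_nontrivial:
  fixes \<alpha> \<beta> t :: real
  assumes "\<alpha> < \<beta>" "t \<in> {\<alpha>..\<beta>}"
  shows "at t within {\<alpha>..\<beta>} \<noteq> bot"
  using assms by (simp add: trivial_limit_within islimpt_Icc)

section \<open>Expansions and pointwise real analyticity\<close>

lemma real_analytic_atI:
  assumes "expands_at S f t F" "f t = fps_nth F 0"
  shows "real_analytic_at S f t"
proof -
  obtain d where d: "d > 0" "\<And>x. x \<in> S \<Longrightarrow> x \<noteq> t \<Longrightarrow> dist x t < d \<Longrightarrow>
      f x = eval_fps F (x - t) \<and> ereal (norm (x - t)) < fps_conv_radius F"
    using eventually_conj[OF assms(1)[unfolded expands_at_def, THEN conjunct2]
        eventually_in_conv_radius[OF assms(1)[unfolded expands_at_def, THEN conjunct1]]]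
    unfolding eventually_at by auto
  have "(\<lambda>j. fps_nth F j * (x - t) ^ j) sums f x" if "x \<in> S" "\<bar>x - t\<bar> < d" for x
  proof (cases "x = t")
    case True
    then show ?thesis using powser_sums_zero[of "fps_nth F"] assms(2) by simp
  next
    case False
    then show ?thesis using d(2)[OF that(1) False] that(2) sums_eval_fps[of "x - t" F]
      by (simp add: dist_real_def)
  qed
  then show ?thesis unfolding real_analytic_at_def using d(1) by blast
qed

text \<open>As t is a limit point of S, the series converges at some x other than t, and the
  distance of x from t is a lower bound for the radius of convergence.\<close>

lemma expands_at_power_series:
  fixes c :: "nat \<Rightarrow> real"
  assumes "r > 0" "\<And>x. x \<in> S \<Longrightarrow> x \<noteq> t \<Longrightarrow> \<bar>x - t\<bar> < r \<Longrightarrow> (\<lambda>j. c j * (x - t) ^ j) sums f x"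
    and "at t within S \<noteq> bot"
  shows "expands_at S f t (Abs_fps c)"
proof (rule expands_atI)
  have "\<forall>\<^sub>F x in at t within S. x \<in> S \<and> x \<noteq> t \<and> \<bar>x - t\<bar> < r"
    unfolding eventually_at using assms(1) by (auto simp: dist_real_def)
  then obtain x where x: "x \<in> S" "x \<noteq> t" "\<bar>x - t\<bar> < r"
    using eventually_happens'[OF assms(3)] by blast
  have "summable (\<lambda>j. c j * (x - t) ^ j)"
    using assms(2)[OF x] by (simp add: sums_iff)
  then have "conv_radius c \<ge> norm (x - t)"
    by (rule conv_radius_geI)
  moreover have "0 < ereal (norm (x - t))" using x by auto
  ultimately show "fps_conv_radius (Abs_fps c) > 0"
    unfolding fps_conv_radius_def fps_nth_Abs_fps by (rule less_le_trans[rotated])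
  show "\<forall>\<^sub>F x in at t within S. f x = eval_fps (Abs_fps c) (x - t)"
    unfolding eventually_at
    by (intro exI[of _ r]) (use assms(1,2) in \<open>auto simp: dist_real_def eval_fps_def sums_iff\<close>)
qed

lemma real_analytic_atE:
  assumes "real_analytic_at S f t" "t \<in> S" "at t within S \<noteq> bot"
  obtains F where "expands_at S f t F" "f t = fps_nth F 0"
proof -
  obtain c r where c: "r > 0" "\<And>x. x \<in> S \<Longrightarrow> \<bar>x - t\<bar> < r \<Longrightarrow> (\<lambda>j. c j * (x - t) ^ j) sums f x"
    using assms(1) unfolding real_analytic_at_def by blast
  have "expands_at S f t (Abs_fps c)"
    by (rule expands_at_power_series[OF c(1) _ assms(3)]) (use c(2) in auto)
  moreover have "f t = c 0"
    using c(2)[OF assms(2)] c(1) powser_sums_zero[of c] by (auto simp: sums_iff)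
  ultimately show thesis using that[of "Abs_fps c"] by simp
qed

lemma real_analytic_at_expansion:
  assumes "real_analytic_at S f t" "t \<in> S" "at t within S \<noteq> bot"
  shows "\<exists>F. expands_at S f t F \<and> f t = fps_nth F 0"
  using real_analytic_atE[OF assms] by blast

lemma real_analytic_at_const: "real_analytic_at S (\<lambda>_. c) t"
  by (rule real_analytic_atI[OF expands_at_const]) simp

lemma real_analytic_at_add:
  assumes "real_analytic_at S f t" "real_analytic_at S g t" "t \<in> S" "at t within S \<noteq> bot"
  shows "real_analytic_at S (\<lambda>x. f x + g x) t"
proof -
  obtain F G where "expands_at S f t F" "f t = fps_nth F 0" "expands_at S g t G" "g t = fps_nth G 0"
    using real_analytic_at_expansion assms by blast
  then show ?thesis by (intro real_analytic_atI[of S _ t "F + G"] expands_at_add) auto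
qed

lemma real_analytic_at_mult:
  assumes "real_analytic_at S f t" "real_analytic_at S g t" "t \<in> S" "at t within S \<noteq> bot"
  shows "real_analytic_at S (\<lambda>x. f x * g x) t"
proof -
  obtain F G where "expands_at S f t F" "f t = fps_nth F 0" "expands_at S g t G" "g t = fps_nth G 0"
    using real_analytic_at_expansion assms by blast
  then show ?thesis by (intro real_analytic_atI[of S _ t "F * G"] expands_at_mult) auto
qed

lemma real_analytic_at_minus:
  assumes "real_analytic_at S f t" "t \<in> S" "at t within S \<noteq> bot"
  shows "real_analytic_at S (\<lambda>x. - f x) t"
  using real_analytic_at_mult[OF real_analytic_at_const[of S "-1"] assms] by simp

lemma real_analytic_at_sum:
  assumes "\<And>i. i \<in> I \<Longrightarrow> real_analytic_at S (f i) t" "t \<in> S" "at t within S \<noteq> bot"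
  shows "real_analytic_at S (\<lambda>x. \<Sum>i\<in>I. f i x) t"
  using assms(1)
proof (induction I rule: infinite_finite_induct)
  case (insert i I)
  then show ?case using real_analytic_at_add[of S "f i" t "\<lambda>x. \<Sum>i\<in>I. f i x"] assms(2,3) by simp
qed (simp_all add: real_analytic_at_const)

lemma real_analytic_at_cong:
  assumes "real_analytic_at S f t" "\<And>x. x \<in> S \<Longrightarrow> g x = f x"
  shows "real_analytic_at S g t"
  using assms by (simp add: real_analytic_at_def)

lemma real_analytic_continuous_on:
  assumes "\<And>t. t \<in> S \<Longrightarrow> real_analytic_at S f t" "\<And>t. t \<in> S \<Longrightarrow> at t within S \<noteq> bot"
  shows "continuous_on S f"
  unfolding continuous_on_eq_continuous_within
proof
  fix t assume t: "t \<in> S"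
  obtain F where "expands_at S f t F" "f t = fps_nth F 0"
    using real_analytic_atE[OF assms(1)[OF t] t assms(2)[OF t]] by metis
  then show "continuous (at t within S) f"
    using DERIV_continuous[OF expands_at_has_derivative_center[OF _ _ t]] by blast
qed

section \<open>Wronskians of power series\<close>

text \<open>Stated over integral domains because it is applied both to real matrices and to matrices
  of formal power series.\<close>

lemma det_eq_0_iff_kernel:
  fixes a :: "nat \<Rightarrow> nat \<Rightarrow> 'a :: idom"
  shows "Determinant.det (Matrix.mat n n (\<lambda>(i, j). a i j)) = 0 \<longleftrightarrow>
    (\<exists>c. (\<exists>j<n. c j \<noteq> 0) \<and> (\<forall>i<n. (\<Sum>j<n. a i j * c j) = 0))" (is "?L \<longleftrightarrow> ?R")
proof -
  let ?A = "Matrix.mat n n (\<lambda>(i, j). a i j)"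
  have A: "?A \<in> carrier_mat n n" by simp
  have entry: "(?A *\<^sub>v v) $ i = (\<Sum>j<n. a i j * v $ j)" if "v \<in> carrier_vec n" "i < n" for v i
    using that by (simp add: scalar_prod_def atLeast0LessThan)
  show ?thesis
  proof
    assume ?L
    then obtain v where v: "v \<in> carrier_vec n" "v \<noteq> 0\<^sub>v n" "?A *\<^sub>v v = 0\<^sub>v n"
      using det_0_iff_vec_prod_zero[OF A] by blast
    have "\<exists>j<n. v $ j \<noteq> 0" using v(1,2) by (auto intro!: eq_vecI)
    moreover have "(\<Sum>j<n. a i j * v $ j) = 0" if "i < n" for i
      using v(3) entry[OF v(1) that] that by simp
    ultimately show ?R by (intro exI[of _ "\<lambda>j. v $ j"]) blast
  next
    assume ?R
    then obtain c where c: "\<exists>j<n. c j \<noteq> 0" "\<And>i. i < n \<Longrightarrow> (\<Sum>j<n. a i j * c j) = 0" by blast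
    have "Matrix.vec n c \<noteq> 0\<^sub>v n" using c(1) by (metis index_vec index_zero_vec(1))
    moreover have "?A *\<^sub>v Matrix.vec n c = 0\<^sub>v n"
      by (rule eq_vecI) (use entry[of "Matrix.vec n c"] c(2) in auto)
    ultimately show ?L
      unfolding det_0_iff_vec_prod_zero[OF A] by (intro exI[of _ "Matrix.vec n c"]) simp
  qed
qed

lemma det_nonzero_solve:
  fixes a :: "nat \<Rightarrow> nat \<Rightarrow> 'a :: field"
  assumes "Determinant.det (Matrix.mat n n (\<lambda>(i, j). a i j)) \<noteq> 0"
  obtains c where "\<And>j. j < n \<Longrightarrow> (\<Sum>i<n. c i * a i j) = v j"
proof -
  let ?A = "Matrix.mat n n (\<lambda>(i, j). a i j)"
  have A: "?A \<in> carrier_mat n n" by simp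
  obtain B where B: "B \<in> carrier_mat n n" "B * ?A = 1\<^sub>m n"
    using det_non_zero_imp_unit[OF A assms] by (auto simp: Units_def ring_mat_def)
  define c where "c i = (\<Sum>k<n. v k * B $$ (k, i))" for i
  have "(\<Sum>i<n. c i * a i j) = v j" if "j < n" for j
  proof -
    have "(\<Sum>i<n. c i * a i j) = (\<Sum>k<n. v k * (\<Sum>i<n. B $$ (k, i) * a i j))"
      unfolding c_def sum_distrib_left sum_distrib_right
      by (subst sum.swap) (simp add: mult.assoc)
    also have "\<dots> = (\<Sum>k<n. v k * (1\<^sub>m n :: 'a mat) $$ (k, j))"
      using that B(1) by (intro sum.cong refl)
        (simp flip: B(2) add: scalar_prod_def atLeast0LessThan)
    also have "\<dots> = v j" using that by (simp add: if_distrib sum.delta cong: if_cong)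
    finally show ?thesis .
  qed
  then show thesis by (rule that)
qed

text \<open>Padding the equations with zero rows makes the system square; expansion along the zero
  row \<open>card U\<close> shows that it is singular.\<close>

lemma underdetermined_system:
  fixes a :: "'b \<Rightarrow> nat \<Rightarrow> real"
  assumes "finite U" "card U < n"
  obtains c where "\<exists>i<n. c i \<noteq> 0" "\<And>k. k \<in> U \<Longrightarrow> (\<Sum>i<n. a k i * c i) = 0"
proof -
  obtain f where f: "bij_betw f {..<card U} U"
    using ex_bij_betw_nat_finite[OF assms(1)] by (auto simp: atLeast0LessThan)
  let ?a = "\<lambda>r i. if r < card U then a (f r) i else 0"
  have "Determinant.det (Matrix.mat n n (\<lambda>(r, i). ?a r i)) = 0"
    by (subst laplace_expansion_row[of _ n "card U"]) (use assms(2) in auto)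
  then obtain c where c: "\<exists>i<n. c i \<noteq> 0" "\<And>r. r < n \<Longrightarrow> (\<Sum>i<n. ?a r i * c i) = 0"
    unfolding det_eq_0_iff_kernel by blast
  have "(\<Sum>i<n. a k i * c i) = 0" if k: "k \<in> U" for k
  proof -
    obtain r where "r < card U" "k = f r" using f k by (auto simp: bij_betw_def)
    then show ?thesis using c(2)[of r] assms(2) by simp
  qed
  with c(1) show thesis by (rule that)
qed

text \<open>Falling factorials of order q are values of monic polynomials of degree q. A nontrivial
  combination of those with q < n is a nonzero polynomial of degree below n and cannot vanish at n
  points.\<close>

lemma falling_factorial_independent:
  fixes e :: "nat \<Rightarrow> real"
  assumes "finite K" "card K \<ge> n"
    and zero: "\<And>k. k \<in> K \<Longrightarrow> (\<Sum>q<n. e q * falling_factorial k q) = 0"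
    and "q < n"
  shows "e q = 0"
proof (rule ccontr)
  assume "e q \<noteq> 0"
  define p :: "nat \<Rightarrow> real poly" where "p q = (\<Prod>i<q. [:- real i, 1:])" for q
  have deg: "degree (p q) = q" for q
    unfolding p_def by (subst degree_prod_eq_sum_degree) auto
  have lead: "coeff (p q) q = 1" for q
  proof -
    have "lead_coeff (p q) = 1" unfolding p_def by (subst lead_coeff_prod) simp
    then show ?thesis by (simp add: deg)
  qed
  define Q where "Q = Max {q. q < n \<and> e q \<noteq> 0}"
  have "Q \<in> {q. q < n \<and> e q \<noteq> 0}"
    unfolding Q_def by (rule Max_in) (use \<open>q < n\<close> \<open>e q \<noteq> 0\<close> in auto)
  then have Q: "Q < n" "e Q \<noteq> 0" by auto
  have max: "e r = 0" if "Q < r" "r < n" for r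
    using Max_ge[of "{q. q < n \<and> e q \<noteq> 0}" r] that unfolding Q_def by fastforce
  define P where "P = (\<Sum>r<n. smult (e r) (p r))"
  have le: "r \<le> Q" if "e r \<noteq> 0" "r < n" for r
    using max[of r] that by (meson not_le)
  have degP: "degree P \<le> Q"
    unfolding P_def by (intro degree_sum_le) (use le in \<open>auto simp: deg\<close>)
  have "coeff P Q = (\<Sum>r<n. if r = Q then e Q else 0)"
    unfolding P_def coeff_sum
    by (intro sum.cong) (use max lead coeff_eq_0[of "p _" Q] in \<open>auto simp: deg linorder_neq_iff\<close>)
  then have P0: "P \<noteq> 0" using Q by auto
  have "poly (p q) (real k) = falling_factorial k q" for q k
    by (simp add: p_def falling_factorial_def poly_prod)
  then have "poly P (real k) = 0" if "k \<in> K" for k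
    using zero[OF that] by (simp add: P_def poly_sum)
  then have "real ` K \<subseteq> {x. poly P x = 0}" by auto
  then have "card (real ` K) \<le> card {x. poly P x = 0}"
    by (intro card_mono poly_roots_finite[OF P0])
  then have "card K \<le> card {x. poly P x = 0}"
    by (simp add: card_image)
  also have "\<dots> \<le> degree P" using P0 by (rule card_poly_roots_bound)
  finally show False using degP Q(1) assms(2) by simp
qed

section \<open>Euler operators and relations between solutions\<close>

lemma falling_factorial_Suc:
  "falling_factorial k (Suc q) = falling_factorial k q * (real k - real q)"
  by (simp add: falling_factorial_def)

text \<open>The operators X^j D^j act diagonally on coefficients. The induction rests on X^(j+1)
  D^(j+1) = (X D - j) X^j D^j, where X D multiplies the coefficient at k by k.\<close>

lemma fps_X_power_higher_deriv_nth:
  fixes Y :: "real fps"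
  shows "fps_nth (fps_X ^ j * (fps_deriv ^^ j) Y) k = falling_factorial k j * fps_nth Y k"
proof (induction j arbitrary: k)
  case 0
  then show ?case by (simp add: falling_factorial_def)
next
  case (Suc j)
  let ?D = "(fps_deriv ^^ j) Y"
  have "fps_X * fps_deriv (fps_X ^ j) = fps_const (real j) * (fps_X :: real fps) ^ j"
    by (rule fps_ext) (auto simp: fps_X_power_nth fps_deriv_nth)
  then have "fps_X * fps_deriv (fps_X ^ j * ?D)
      = fps_X ^ Suc j * fps_deriv ?D + fps_const (real j) * (fps_X ^ j * ?D)"
    by (simp add: algebra_simps)
  then have "fps_X ^ Suc j * (fps_deriv ^^ Suc j) Y
      = fps_X * fps_deriv (fps_X ^ j * ?D) - fps_const (real j) * (fps_X ^ j * ?D)"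
    by simp
  then have "fps_nth (fps_X ^ Suc j * (fps_deriv ^^ Suc j) Y) k
      = fps_nth (fps_X * fps_deriv (fps_X ^ j * ?D)) k - fps_nth (fps_const (real j) * (fps_X ^ j * ?D)) k"
    by (simp only: fps_sub_nth)
  also have "fps_nth (fps_X * fps_deriv (fps_X ^ j * ?D)) k = real k * fps_nth (fps_X ^ j * ?D) k"
    by (cases k) (simp_all del: fps_deriv_mult)
  also have "fps_nth (fps_const (real j) * (fps_X ^ j * ?D)) k = real j * fps_nth (fps_X ^ j * ?D) k"
    by simp
  finally show ?case by (simp only: Suc.IH falling_factorial_Suc) (simp add: algebra_simps)
qed

lemma higher_deriv_linear_combination:
  fixes G :: "'b \<Rightarrow> real fps"
  shows "(fps_deriv ^^ j) (\<Sum>l\<in>L. fps_const (c l) * G l) = (\<Sum>l\<in>L. fps_const (c l) * (fps_deriv ^^ j) (G l))"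
  by (induction j) (simp_all add: fps_deriv_sum)

text \<open>
  Comparing the coefficients at \<open>k + \<kappa> i\<close>, only the leading term of \<open>Y i\<close> contributes, and
  the values \<open>u j $ k\<close> become the coefficients of a polynomial of degree less than \<open>n\<close> with
  the \<open>n\<close> roots \<open>\<kappa> i\<close>.
\<close>

lemma euler_relation_coeffs:
  fixes Y :: "nat \<Rightarrow> real fps" and u :: "nat \<Rightarrow> real fps"
  assumes inj: "inj_on \<kappa> {..<n}"
    and low: "\<And>i l. i < n \<Longrightarrow> l < \<kappa> i \<Longrightarrow> fps_nth (Y i) l = 0"
    and lead: "\<And>i. i < n \<Longrightarrow> fps_nth (Y i) (\<kappa> i) \<noteq> 0"
    and rel: "\<And>i k. i < n \<Longrightarrow> k < m + \<kappa> i \<Longrightarrow>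
      fps_nth (\<Sum>j<n. u j * (fps_X ^ j * (fps_deriv ^^ j) (Y i))) k = 0"
    and "k < m" "j < n"
  shows "fps_nth (u j) k = 0"
  using assms(5,6)
proof (induction k arbitrary: j rule: less_induct)
  case (less k)
  have "(\<Sum>q<n. fps_nth (u q) k * falling_factorial l q) = 0" if l: "l \<in> \<kappa> ` {..<n}" for l
  proof -
    obtain i where i: "i < n" "l = \<kappa> i" using l by auto
    have "fps_nth (u q * (fps_X ^ q * (fps_deriv ^^ q) (Y i))) (k + l)
        = fps_nth (u q) k * falling_factorial l q * fps_nth (Y i) l" if q: "q < n" for q
    proof -
      have "fps_nth (u q * (fps_X ^ q * (fps_deriv ^^ q) (Y i))) (k + l)
        = (\<Sum>s=0..k + l. if s = k then fps_nth (u q) k * falling_factorial l q * fps_nth (Y i) l else 0)"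
        unfolding fps_mult_nth[of "u q"] fps_X_power_higher_deriv_nth
      proof (intro sum.cong refl)
        fix s assume "s \<in> {0..k + l}"
        consider "s < k" | "s = k" | "s > k" by linarith
        then show "fps_nth (u q) s * (falling_factorial (k + l - s) q * fps_nth (Y i) (k + l - s)) =
            (if s = k then fps_nth (u q) k * falling_factorial l q * fps_nth (Y i) l else 0)"
        proof cases
          case 1
          then show ?thesis using less.IH[of s q] less.prems q by simp
        next
          case 3
          then have "k + l - s < \<kappa> i" using \<open>s \<in> {0..k + l}\<close> i by auto
          then show ?thesis using 3 low[OF i(1)] by simp
        qed simp
      qed
      then show ?thesis by simp
    qed
    then have "(\<Sum>q<n. fps_nth (u q) k * falling_factorial l q) * fps_nth (Y i) l
        = fps_nth (\<Sum>j<n. u j * (fps_X ^ j * (fps_deriv ^^ j) (Y i))) (k + l)"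
      by (simp add: fps_sum_nth sum_distrib_right)
    also have "\<dots> = 0" using rel[OF i(1)] less.prems i by simp
    finally show ?thesis using lead i by simp
  qed
  then show ?case
    using falling_factorial_independent[of "\<kappa> ` {..<n}" n "\<lambda>q. fps_nth (u q) k" j] less.prems inj
    by (simp add: card_image)
qed

text \<open>Multiplying a kernel vector v by X^n turns it into a relation between the X^j D^j Y i
  with coefficients v j X^(n-j), to which \<open>euler_relation_coeffs\<close> applies.\<close>

lemma wronskian_nonzero_distinct_orders:
  fixes Y :: "nat \<Rightarrow> real fps"
  assumes inj: "inj_on \<kappa> {..<n}"
    and low: "\<And>i l. i < n \<Longrightarrow> l < \<kappa> i \<Longrightarrow> fps_nth (Y i) l = 0"
    and lead: "\<And>i. i < n \<Longrightarrow> fps_nth (Y i) (\<kappa> i) \<noteq> 0"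
  shows "Determinant.det (Matrix.mat n n (\<lambda>(i, j). (fps_deriv ^^ j) (Y i))) \<noteq> 0"
proof
  assume "Determinant.det (Matrix.mat n n (\<lambda>(i, j). (fps_deriv ^^ j) (Y i))) = 0"
  then obtain v where v: "\<exists>j<n. v j \<noteq> 0" "\<And>i. i < n \<Longrightarrow> (\<Sum>j<n. (fps_deriv ^^ j) (Y i) * v j) = 0"
    unfolding det_eq_0_iff_kernel by blast
  have rel: "(\<Sum>j<n. (v j * fps_X ^ (n - j)) * (fps_X ^ j * (fps_deriv ^^ j) (Y i))) = 0" if "i < n" for i
  proof -
    have "(\<Sum>j<n. (v j * fps_X ^ (n - j)) * (fps_X ^ j * (fps_deriv ^^ j) (Y i)))
        = (\<Sum>j<n. fps_X ^ n * ((fps_deriv ^^ j) (Y i) * v j))"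
    proof (intro sum.cong refl)
      fix j assume "j \<in> {..<n}"
      then have "(fps_X :: real fps) ^ n = fps_X ^ (n - j) * fps_X ^ j" by (simp flip: power_add)
      then show "(v j * fps_X ^ (n - j)) * (fps_X ^ j * (fps_deriv ^^ j) (Y i))
          = fps_X ^ n * ((fps_deriv ^^ j) (Y i) * v j)" by (simp only: ac_simps)
    qed
    also have "\<dots> = 0" using v(2)[OF that] by (simp flip: sum_distrib_left)
    finally show ?thesis .
  qed
  have "v j = 0" if "j < n" for j
  proof -
    \<comment> \<open>The relation is exact, so it may be used with an arbitrarily large m;
      \<open>Suc k\<close> reaches the coefficient at k.\<close>
    have "fps_nth (v j * fps_X ^ (n - j)) k = 0" for k
      by (rule euler_relation_coeffs[of \<kappa> n Y "Suc k" "\<lambda>j. v j * fps_X ^ (n - j)" k j])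
        (use inj low lead that in \<open>simp_all add: rel\<close>)
    then have "v j * fps_X ^ (n - j) = 0" by (simp add: fps_eq_iff)
    then show ?thesis by simp
  qed
  then show False using v(1) by blast
qed

text \<open>Let U be the set of orders of nonzero constant combinations of the G. With fewer than n
  orders, some nontrivial combination would have coefficient zero at every element of U, although
  its own order belongs to U.\<close>

lemma independent_distinct_orders:
  fixes G :: "nat \<Rightarrow> real fps"
  assumes indep: "\<forall>c. (\<Sum>l<n. fps_const (c l) * G l) = 0 \<longrightarrow> (\<forall>i<n. c i = 0)"
  shows "\<exists>\<kappa> C. strict_mono_on {..<n} \<kappa> \<and>
    (\<forall>i<n. fps_nth (\<Sum>l<n. fps_const (C i l) * G l) (\<kappa> i) \<noteq> 0 \<and>
      (\<forall>j<\<kappa> i. fps_nth (\<Sum>l<n. fps_const (C i l) * G l) j = 0))"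
proof -
  define U where "U = {k. \<exists>c. fps_nth (\<Sum>l<n. fps_const (c l) * G l) k \<noteq> 0 \<and>
     (\<forall>j<k. fps_nth (\<Sum>l<n. fps_const (c l) * G l) j = 0)}"
  have "\<not> (finite U \<and> card U < n)"
  proof
    assume fin: "finite U \<and> card U < n"
    then obtain c where c: "\<exists>i<n. c i \<noteq> 0" "\<And>k. k \<in> U \<Longrightarrow> (\<Sum>i<n. fps_nth (G i) k * c i) = 0"
      using underdetermined_system[of U n "\<lambda>k i. fps_nth (G i) k"] by blast
    let ?Y = "\<Sum>l<n. fps_const (c l) * G l"
    have "?Y \<noteq> 0" using indep c(1) by blast
    then have nz: "fps_nth ?Y (subdegree ?Y) \<noteq> 0" by simp
    then have "subdegree ?Y \<in> U" unfolding U_def using nth_less_subdegree_zero by blast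
    then show False using c(2) nz by (simp add: fps_sum_nth mult.commute)
  qed
  then obtain T where T: "T \<subseteq> U" "finite T" "card T = n"
    by (metis infinite_arbitrarily_large not_less obtain_subset_with_card_n)
  define \<kappa> where "\<kappa> i = sorted_list_of_set T ! i" for i
  have mono: "strict_mono_on {..<n} \<kappa>"
    unfolding \<kappa>_def strict_mono_on_def
    using strict_sorted_list_of_set[of T] T by (auto simp: sorted_wrt_iff_nth_less)
  have "\<kappa> i \<in> U" if "i < n" for i
    using T nth_mem[of i "sorted_list_of_set T"] that by (auto simp: \<kappa>_def)
  then have "\<forall>i\<in>{..<n}. \<exists>c. fps_nth (\<Sum>l<n. fps_const (c l) * G l) (\<kappa> i) \<noteq> 0 \<and>
     (\<forall>j<\<kappa> i. fps_nth (\<Sum>l<n. fps_const (c l) * G l) j = 0)"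
    unfolding U_def by blast
  from bchoice[OF this] obtain C where "\<forall>i\<in>{..<n}. fps_nth (\<Sum>l<n. fps_const (C i l) * G l) (\<kappa> i) \<noteq> 0 \<and>
     (\<forall>j<\<kappa> i. fps_nth (\<Sum>l<n. fps_const (C i l) * G l) j = 0)" ..
  with mono show ?thesis by (intro exI[of _ \<kappa>] exI[of _ C]) simp
qed

text \<open>A kernel vector of the Wronskian matrix of G is also one for every family of constant
  combinations of G, hence for a family with n different orders.\<close>

lemma wronskian_nonzero:
  fixes G :: "nat \<Rightarrow> real fps"
  assumes indep: "\<forall>c. (\<Sum>l<n. fps_const (c l) * G l) = 0 \<longrightarrow> (\<forall>i<n. c i = 0)"
  shows "Determinant.det (Matrix.mat n n (\<lambda>(i, j). (fps_deriv ^^ j) (G i))) \<noteq> 0"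
proof
  assume "Determinant.det (Matrix.mat n n (\<lambda>(i, j). (fps_deriv ^^ j) (G i))) = 0"
  then obtain v where v: "\<exists>j<n. v j \<noteq> 0" "\<And>i. i < n \<Longrightarrow> (\<Sum>j<n. (fps_deriv ^^ j) (G i) * v j) = 0"
    unfolding det_eq_0_iff_kernel by blast
  obtain \<kappa> C where K: "strict_mono_on {..<n} \<kappa>"
    "\<forall>i<n. fps_nth (\<Sum>l<n. fps_const (C i l) * G l) (\<kappa> i) \<noteq> 0 \<and>
      (\<forall>j<\<kappa> i. fps_nth (\<Sum>l<n. fps_const (C i l) * G l) j = 0)"
    using independent_distinct_orders[where n = n and G = G, OF indep] by (elim exE conjE)
  define Y where "Y i = (\<Sum>l<n. fps_const (C i l) * G l)" for i
  have "Determinant.det (Matrix.mat n n (\<lambda>(i, j). (fps_deriv ^^ j) (Y i))) \<noteq> 0"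
    by (rule wronskian_nonzero_distinct_orders[of \<kappa>])
      (use K in \<open>auto simp: Y_def strict_mono_on_imp_inj_on\<close>)
  moreover have "(\<Sum>j<n. (fps_deriv ^^ j) (Y i) * v j) = 0" if "i < n" for i
  proof -
    have "(\<Sum>j<n. (fps_deriv ^^ j) (Y i) * v j)
        = (\<Sum>l<n. fps_const (C i l) * (\<Sum>j<n. (fps_deriv ^^ j) (G l) * v j))"
      unfolding Y_def higher_deriv_linear_combination sum_distrib_left sum_distrib_right
      by (subst sum.swap) (simp add: mult.assoc)
    then show ?thesis using v(2) by simp
  qed
  ultimately show False using v(1) unfolding det_eq_0_iff_kernel by blast
qed

section \<open>Growth of coefficients and the identity theorem\<close>

text \<open>Re-expansion about a point x other than the centre. The complexified series is
  holomorphic on a disc around x - t, and the real parts of its Taylor coefficients there are the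
  required real coefficients.\<close>

lemma eval_fps_real_analytic_at:
  fixes F :: "real fps"
  assumes "ereal (norm (x - t)) < fps_conv_radius F"
  shows "real_analytic_at S (\<lambda>y. eval_fps F (y - t)) x"
proof -
  define C :: "complex fps" where "C = Abs_fps (\<lambda>k. of_real (fps_nth F k))"
  have rad: "fps_conv_radius C = fps_conv_radius F"
    unfolding fps_conv_radius_def conv_radius_def C_def by simp
  have eval: "eval_fps C (of_real z) = of_real (eval_fps F z)" if "ereal (norm z) < fps_conv_radius F" for z :: real
  proof -
    have "(\<lambda>n. complex_of_real (fps_nth F n * z ^ n)) sums of_real (eval_fps F z)"
      using sums_eval_fps[OF that] by (simp only: sums_of_real_iff)
    then show ?thesis by (simp add: C_def eval_fps_def sums_iff)
  qed
  obtain R where R: "norm (x - t) < R" "ereal R < fps_conv_radius F"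
    using ereal_dense2[OF assms] by auto
  define d where "d = R - norm (x - t)"
  define z where "z = complex_of_real (x - t)"
  have hol: "eval_fps C holomorphic_on ball z d"
  proof (rule holomorphic_on_eval_fps)
    show "ball z d \<subseteq> eball 0 (fps_conv_radius C)"
    proof
      fix w assume "w \<in> ball z d"
      moreover have "norm z = norm (x - t)" unfolding z_def norm_of_real by simp
      ultimately have "norm w < R"
        using norm_triangle_ineq[of "w - z" z] by (simp add: d_def dist_norm norm_minus_commute)
      then show "w \<in> eball 0 (fps_conv_radius C)"
        using R(2) by (auto simp: rad intro: less_trans[of _ "ereal R"])
    qed
  qed
  show ?thesis unfolding real_analytic_at_def
  proof (intro exI[of _ "\<lambda>n. Re ((deriv ^^ n) (eval_fps C) z / fact n)"] exI[of _ d] conjI ballI impI)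
    show "0 < d" using R by (simp add: d_def)
    fix y assume "y \<in> S" "\<bar>y - x\<bar> < d"
    then have mem: "complex_of_real (y - t) \<in> ball z d"
      by (simp add: z_def dist_norm norm_minus_commute flip: of_real_diff)
    have "(\<lambda>n. (deriv ^^ n) (eval_fps C) z / fact n * (of_real (y - t) - z) ^ n) sums eval_fps C (of_real (y - t))"
      by (rule holomorphic_power_series[OF hol mem])
    moreover have "complex_of_real (y - t) - z = of_real (y - x)" by (simp add: z_def)
    ultimately have "(\<lambda>n. (deriv ^^ n) (eval_fps C) z / fact n * of_real ((y - x) ^ n)) sums eval_fps C (of_real (y - t))"
      by (simp only: of_real_power)
    then have "(\<lambda>n. Re ((deriv ^^ n) (eval_fps C) z / fact n * of_real ((y - x) ^ n))) sums Re (eval_fps C (of_real (y - t)))"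
      by (rule sums_Re)
    moreover have "\<bar>y - t\<bar> < R" using \<open>\<bar>y - x\<bar> < d\<close> by (simp add: d_def)
    then have "eval_fps C (of_real (y - t)) = of_real (eval_fps F (y - t))"
      by (intro eval) (use R(2) in \<open>auto intro: less_trans[of _ "ereal R"]\<close>)
    ultimately show "(\<lambda>n. Re ((deriv ^^ n) (eval_fps C) z / fact n) * (y - x) ^ n) sums eval_fps F (y - t)"
      by (simp only: times_complex.sel Re_complex_of_real Im_complex_of_real mult_zero_right diff_zero)
  qed
qed

lemma fps_conv_radius_pos_bound:
  fixes F :: "real fps"
  assumes "fps_conv_radius F > 0"
  obtains B R where "B > 0" "R \<ge> 1" "\<And>i. \<bar>fps_nth F i\<bar> \<le> B * R ^ i"
proof -
  obtain r where r: "0 < ereal r" "ereal r < fps_conv_radius F"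
    using ereal_dense2[OF assms] by auto
  then have "summable (\<lambda>i. fps_nth F i * r ^ i)" by (intro summable_fps) auto
  then have "Bseq (\<lambda>i. fps_nth F i * r ^ i)" by (intro convergent_imp_Bseq summable_imp_convergent)
  then obtain B where B: "B > 0" "\<And>i. \<bar>fps_nth F i * r ^ i\<bar> \<le> B" by (auto simp: Bseq_def)
  \<comment> \<open>The terms at radius r are bounded, which gives the rate 1 / r; the maximum with
    1 makes the majorant nondecreasing in the exponent.\<close>
  have "\<bar>fps_nth F i\<bar> \<le> B * (max 1 (1 / r)) ^ i" for i
  proof -
    have "\<bar>fps_nth F i\<bar> \<le> B * (1 / r) ^ i"
      using B(2)[of i] r by (simp add: abs_mult field_simps)
    also have "\<dots> \<le> B * (max 1 (1 / r)) ^ i"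
      using B(1) r by (intro mult_left_mono power_mono) auto
    finally show ?thesis .
  qed
  with B(1) show thesis by (intro that[of B "max 1 (1 / r)"]) auto
qed

lemma fps_conv_radius_pos_bound_family:
  fixes F :: "'b \<Rightarrow> real fps"
  assumes "finite I" "\<And>s. s \<in> I \<Longrightarrow> fps_conv_radius (F s) > 0"
  obtains B R where "B > 0" "R \<ge> 1" "\<And>s i. s \<in> I \<Longrightarrow> \<bar>fps_nth (F s) i\<bar> \<le> B * R ^ i"
  using assms
proof (induction I arbitrary: thesis rule: finite_induct)
  case empty
  show ?case by (rule empty(1)[of 1 1]) auto
next
  case (insert s I)
  obtain B R where BR: "B > 0" "R \<ge> 1" "\<And>s i. s \<in> I \<Longrightarrow> \<bar>fps_nth (F s) i\<bar> \<le> B * R ^ i"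
    using insert.IH insert.prems(2) by (metis insertCI)
  obtain B' R' where BR': "B' > 0" "R' \<ge> 1" "\<And>i. \<bar>fps_nth (F s) i\<bar> \<le> B' * R' ^ i"
    using fps_conv_radius_pos_bound insert.prems(2) by (metis insertCI)
  have *: "B * R ^ i \<le> (B + B') * (R + R') ^ i" "B' * R' ^ i \<le> (B + B') * (R + R') ^ i" for i
    using BR BR' by (intro mult_mono power_mono; simp)+
  show ?case
  proof (rule insert.prems(1)[of "B + B'" "R + R'"])
    fix s' i assume "s' \<in> insert s I"
    then show "\<bar>fps_nth (F s') i\<bar> \<le> (B + B') * (R + R') ^ i"
      using BR(3)[of s' i] BR'(3)[of i] *[of i] by (auto intro: order_trans)
  qed (use BR BR' in auto)
qed

lemma fps_conv_radius_posI:
  fixes F :: "real fps"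
  assumes "Q > 0" "\<And>i. \<bar>fps_nth F i\<bar> \<le> D * Q ^ i"
  shows "fps_conv_radius F > 0"
proof -
  have "summable (\<lambda>i. fps_nth F i * (1 / (2 * Q)) ^ i)"
  proof (rule summable_comparison_test')
    show "summable (\<lambda>i. D * (1 / 2 :: real) ^ i)" by (intro summable_mult summable_geometric) simp
    fix i
    have "norm (fps_nth F i * (1 / (2 * Q)) ^ i) \<le> D * Q ^ i * (1 / (2 * Q)) ^ i"
      using assms(1) assms(2)[of i] by (auto simp: abs_mult intro!: mult_right_mono)
    also have "\<dots> = D * (1 / 2) ^ i" using assms(1) by (simp add: power_divide power_mult_distrib)
    finally show "norm (fps_nth F i * (1 / (2 * Q)) ^ i) \<le> D * (1 / 2) ^ i" .
  qed
  then have "conv_radius (fps_nth F) \<ge> norm (1 / (2 * Q))" by (rule conv_radius_geI)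
  moreover have "0 < ereal (norm (1 / (2 * Q)))" using assms(1) by simp
  ultimately show ?thesis
    unfolding fps_conv_radius_def by (rule less_le_trans[rotated])
qed

text \<open>The majorant is D (2 R)^k. Inserting it for j < k leaves a geometric sum with ratio 2,
  at most D (2 R)^k again, while the term j = k is absorbed by the left side once k is at least 2
  M.\<close>

lemma recurrence_geometric_bound:
  fixes a :: "nat \<Rightarrow> real"
  assumes nonneg: "\<And>k. a k \<ge> 0" and "R \<ge> 1" "M > 0"
    and rec: "\<And>k. k \<ge> k0 \<Longrightarrow> real k * a k \<le> M * (\<Sum>j\<le>k. R ^ (k - j) * a j)"
  shows "\<exists>D Q. Q > 0 \<and> (\<forall>k. a k \<le> D * Q ^ k)"
proof -
  \<comment> \<open>Beyond K the recurrence is available and M a(k) is at most half of k a(k). Up to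
    K the bound holds because D is the sum of all these values.\<close>
  define K where "K = max k0 (nat \<lceil>2 * M\<rceil>)"
  define D where "D = (\<Sum>j\<le>K. a j)"
  have D0: "D \<ge> 0" unfolding D_def by (intro sum_nonneg nonneg)
  have "a k \<le> D * (2 * R) ^ k" for k
  proof (induction k rule: less_induct)
    case (less k)
    show ?case
    proof (cases "k \<le> K")
      case True
      then have "a k \<le> D" unfolding D_def by (intro member_le_sum nonneg) auto
      also have "\<dots> \<le> D * (2 * R) ^ k"
        using D0 assms(2) one_le_power[of "2 * R" k] mult_left_mono[of 1 "(2 * R) ^ k" D] by simp
      finally show ?thesis .
    next
      case False
      then have k: "k \<ge> k0" "real k \<ge> 2 * M" unfolding K_def by linarith+
      have "real k * a k \<le> M * (\<Sum>j\<le>k. R ^ (k - j) * a j)" by (rule rec[OF k(1)])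
      also have "(\<Sum>j\<le>k. R ^ (k - j) * a j) = (\<Sum>j<k. R ^ (k - j) * a j) + a k"
        by (simp flip: lessThan_Suc_atMost)
      also have "(\<Sum>j<k. R ^ (k - j) * a j) \<le> (\<Sum>j<k. D * R ^ k * 2 ^ j)"
      proof (rule sum_mono)
        fix j assume j: "j \<in> {..<k}"
        have "R ^ (k - j) * a j \<le> R ^ (k - j) * (D * (2 * R) ^ j)"
          using less[of j] j assms(2) by (intro mult_left_mono) auto
        also have "\<dots> = D * (R ^ (k - j) * R ^ j) * 2 ^ j" by (simp add: power_mult_distrib)
        also have "R ^ (k - j) * R ^ j = R ^ k" using j by (simp flip: power_add)
        finally show "R ^ (k - j) * a j \<le> D * R ^ k * 2 ^ j" .
      qed
      also have "(\<Sum>j<k. D * R ^ k * 2 ^ j) = D * R ^ k * (2 ^ k - 1)"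
        using geometric_sum[of "2 :: real" k] by (simp flip: sum_distrib_left)
      also have "\<dots> \<le> D * (2 * R) ^ k"
        using D0 assms(2) by (simp add: power_mult_distrib algebra_simps)
      finally have "real k * a k \<le> M * (D * (2 * R) ^ k + a k)" using assms(3) by simp
      moreover have "2 * M * a k \<le> real k * a k" using k(2) nonneg by (intro mult_right_mono)
      ultimately have "M * a k \<le> M * (D * (2 * R) ^ k)" by (simp add: algebra_simps)
      then show ?thesis using assms(3) by simp
    qed
  qed
  with assms(2) show ?thesis by (intro exI[of _ D] exI[of _ "2 * R"]) auto
qed

section \<open>The identity theorem\<close>

lemma eventually_at_within_realD:
  fixes t :: real
  assumes "\<forall>\<^sub>F x in at t within S. Q x"
  shows "\<exists>d>0. \<forall>x\<in>S. x \<noteq> t \<longrightarrow> \<bar>x - t\<bar> < d \<longrightarrow> Q x"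
  using assms unfolding eventually_at by (auto simp: dist_real_def)

lemma eventually_at_within_nearby:
  fixes t :: real
  assumes "\<forall>\<^sub>F x in at t within S. Q x"
  shows "\<exists>d>0. \<forall>x\<in>S. \<bar>x - t\<bar> < d \<longrightarrow> (\<forall>\<^sub>F y in at x within S. Q y)"
proof -
  from eventually_at_within_realD[OF assms] obtain d where
    d: "d > 0" "\<forall>x\<in>S. x \<noteq> t \<longrightarrow> \<bar>x - t\<bar> < d \<longrightarrow> Q x" by blast
  have "\<forall>\<^sub>F y in at x within S. Q y" if x: "x \<in> S" "\<bar>x - t\<bar> < d" for x
  proof (cases "x = t")
    case False
    show ?thesis unfolding eventually_at
    proof (intro exI[of _ "min (dist x t) (d - dist x t)"] conjI ballI impI)
      show "0 < min (dist x t) (d - dist x t)" using x False by (auto simp: dist_real_def)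
      fix y assume "y \<in> S" "y \<noteq> x \<and> dist y x < min (dist x t) (d - dist x t)"
      then show "Q y" using d(2) by (auto simp: dist_real_def)
    qed
  qed (use assms in simp)
  with d(1) show ?thesis by blast
qed

text \<open>Vanishing near a point and its failure are both open conditions: a zero expansion gives
  zeros at all nearby points, a nonzero one excludes them on a punctured neighbourhood.
  Connectedness then carries the property from p to x; working relative to S covers the
  endpoints.\<close>

lemma analytic_identity:
  fixes S :: "real set"
  assumes nontriv: "\<And>x. x \<in> S \<Longrightarrow> at x within S \<noteq> bot"
    and conn: "connected U" and open_in: "openin (top_of_set S) U"
    and ana: "\<And>x. x \<in> U \<Longrightarrow> real_analytic_at S f x"
    and p: "p \<in> U" "\<forall>\<^sub>F y in at p within S. f y = 0"
    and "x \<in> U"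
  shows "f x = 0"
proof -
  have US: "U \<subseteq> S" using openin_imp_subset[OF open_in] .
  have "\<forall>\<^sub>F y in at x within S. f y = 0"
  proof (rule connected_induction_simple[OF conn p(1) \<open>x \<in> U\<close>])
    show "\<forall>\<^sub>F y in at p within S. f y = 0" by (rule p(2))
    fix a assume a: "a \<in> U"
    then have aS: "a \<in> S" using US by auto
    obtain F where F: "expands_at S f a F" using real_analytic_atE[OF ana[OF a] aS nontriv[OF aS]] .
    have op: "openin (top_of_set U) (U \<inter> ball a d)" for d
      by (intro openin_open_Int open_ball)
    show "\<exists>T. openin (top_of_set U) T \<and> a \<in> T \<and> (\<forall>x\<in>T. \<forall>y\<in>T.
        (\<forall>\<^sub>F y in at x within S. f y = 0) \<longrightarrow> (\<forall>\<^sub>F z in at y within S. f z = 0))"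
    proof (cases "F = 0")
      case True
      then have "\<forall>\<^sub>F y in at a within S. f y = 0" using F by (simp add: expands_at_def)
      from eventually_at_within_nearby[OF this] obtain d where
        "d > 0" "\<forall>x\<in>S. \<bar>x - a\<bar> < d \<longrightarrow> (\<forall>\<^sub>F y in at x within S. f y = 0)" by blast
      then show ?thesis using op[of d] a US
        by (intro exI[of _ "U \<inter> ball a d"]) (auto simp: dist_real_def abs_minus_commute)
    next
      case False
      from eventually_at_within_nearby[OF expands_at_nonzero[OF F False]] obtain d where
        d: "d > 0" "\<forall>x\<in>S. \<bar>x - a\<bar> < d \<longrightarrow> (\<forall>\<^sub>F y in at x within S. f y \<noteq> 0)" by blast
      have "\<not> (\<forall>\<^sub>F y in at x within S. f y = 0)" if "x \<in> S" "\<bar>x - a\<bar> < d" for x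
      proof
        assume "\<forall>\<^sub>F y in at x within S. f y = 0"
        with d(2)[rule_format, OF that] have "\<forall>\<^sub>F y in at x within S. False" by eventually_elim simp
        then show False using nontriv[OF that(1)] by simp
      qed
      then show ?thesis using op[of d] a US d(1)
        by (intro exI[of _ "U \<inter> ball a d"]) (auto simp: dist_real_def abs_minus_commute)
    qed
  qed
  moreover have xS: "x \<in> S" using \<open>x \<in> U\<close> US by auto
  obtain F where F: "expands_at S f x F" "f x = fps_nth F 0"
    using real_analytic_atE[OF ana[OF \<open>x \<in> U\<close>] xS nontriv[OF xS]] .
  ultimately have "F = 0"
    using expands_at_0D[OF F(1) eventually_frequently[OF nontriv[OF xS]]] by blast
  then show ?thesis using F by simp
qed

section \<open>Linear systems with meromorphic coefficients\<close>

text \<open>The counterpart of \<open>euler_relation_coeffs\<close> for a matrix that is invertible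
  at the centre, which is what \<open>ker\<close> says: at order k the lower coefficients of u have
  already vanished, so only the constant terms of F contribute.\<close>

lemma regular_relation_coeffs:
  fixes F :: "nat \<Rightarrow> nat \<Rightarrow> real fps" and u :: "nat \<Rightarrow> real fps"
  assumes ker: "\<And>c j. (\<And>i. i < n \<Longrightarrow> (\<Sum>j<n. c j * fps_nth (F i j) 0) = 0) \<Longrightarrow> j < n \<Longrightarrow> c j = 0"
    and rel: "\<And>i k. i < n \<Longrightarrow> k < m \<Longrightarrow> fps_nth (\<Sum>j<n. u j * F i j) k = 0"
    and "k < m" "j < n"
  shows "fps_nth (u j) k = 0"
  using assms(3,4)
proof (induction k arbitrary: j rule: less_induct)
  case (less k)
  show ?case
  proof (rule ker[OF _ less.prems(2)])
    fix i assume i: "i < n"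
    have "fps_nth (u q * F i q) k = fps_nth (u q) k * fps_nth (F i q) 0" if q: "q < n" for q
    proof -
      have "fps_nth (u q * F i q) k
          = (\<Sum>s=0..k. if s = k then fps_nth (u q) k * fps_nth (F i q) 0 else 0)"
        unfolding fps_mult_nth using less.IH less.prems q by (intro sum.cong) auto
      then show ?thesis by simp
    qed
    then show "(\<Sum>q<n. fps_nth (u q) k * fps_nth (F i q) 0) = 0"
      using rel[OF i less.prems(1)] by (simp add: fps_sum_nth)
  qed
qed

text \<open>Comparing coefficients determines x a(x) from the a(l) with l < x. The sum of the
  absolute values of a(x) over the components satisfies the hypothesis of
  \<open>recurrence_geometric_bound\<close>, so the formal solution converges.\<close>

lemma regular_formal_solution:
  fixes G :: "nat \<Rightarrow> nat \<Rightarrow> real fps" and v :: "nat \<Rightarrow> real"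
  assumes "\<And>k j. k < n \<Longrightarrow> j < n \<Longrightarrow> fps_conv_radius (G k j) > 0"
  obtains F where "\<And>j. j < n \<Longrightarrow> fps_nth (F j) 0 = v j" "\<And>j. j < n \<Longrightarrow> fps_conv_radius (F j) > 0"
    "\<And>j. j < n \<Longrightarrow> fps_deriv (F j) = (\<Sum>k<n. F k * G k j)"
proof -
  \<comment> \<open>This is the coefficient at x - 1 of the right-hand side; it reads f only at l <
    x, so the recursion is well-founded.\<close>
  let ?step = "\<lambda>(f :: nat \<Rightarrow> nat \<Rightarrow> real) x j.
    \<Sum>k<n. \<Sum>l<x. f l k * fps_nth (G k j) (x - 1 - l)"
  have "\<exists>f. \<forall>x. f x = (\<lambda>j. if x = 0 then v j else ?step f x j / real x)"
    by (rule dependent_wellorder_choice) (auto intro!: sum.cong)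
  then obtain a where a: "\<And>x. a x = (\<lambda>j. if x = 0 then v j else ?step a x j / real x)"
    by blast
  obtain B R where BR: "B > 0" "R \<ge> 1"
    "\<And>s i. s \<in> {..<n} \<times> {..<n} \<Longrightarrow> \<bar>fps_nth (G (fst s) (snd s)) i\<bar> \<le> B * R ^ i"
    by (rule fps_conv_radius_pos_bound_family[of "{..<n} \<times> {..<n}" "\<lambda>s. G (fst s) (snd s)"])
      (use assms in auto)
  define A where "A x = (\<Sum>j<n. \<bar>a x j\<bar>)" for x
  have A0: "A x \<ge> 0" for x unfolding A_def by (intro sum_nonneg) auto
  \<comment> \<open>The summand 1 keeps the constant positive when \<open>n = 0\<close>.\<close>
  have "real x * A x \<le> (real n * B + 1) * (\<Sum>l\<le>x. R ^ (x - l) * A l)" for x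
  proof (cases "x = 0")
    case True
    then show ?thesis using BR A0 by simp
  next
    case False
    have "real x * A x = (\<Sum>j<n. \<bar>?step a x j\<bar>)"
      using False unfolding A_def sum_distrib_left by (intro sum.cong refl) (subst a, simp)
    also have "\<dots> \<le> (\<Sum>j<n. \<Sum>k<n. \<Sum>l<x. \<bar>a l k\<bar> * (B * R ^ (x - l)))"
    proof (intro sum_mono order_trans[OF sum_abs])
      fix j k l assume j: "j \<in> {..<n}" and k: "k \<in> {..<n}" and l: "l \<in> {..<x}"
      have "\<bar>fps_nth (G k j) (x - 1 - l)\<bar> \<le> B * R ^ (x - 1 - l)"
        using BR(3)[of "(k, j)"] j k by simp
      also have "\<dots> \<le> B * R ^ (x - l)" using BR by (intro mult_left_mono power_increasing) auto
      finally show "\<bar>a l k * fps_nth (G k j) (x - 1 - l)\<bar> \<le> \<bar>a l k\<bar> * (B * R ^ (x - l))"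
        by (simp add: abs_mult mult_left_mono)
    qed
    also have "\<dots> = real n * B * (\<Sum>l<x. R ^ (x - l) * A l)"
      unfolding A_def sum_distrib_left
      by (subst sum.swap) (simp add: sum_distrib_left ac_simps)
    also have "\<dots> \<le> (real n * B + 1) * (\<Sum>l\<le>x. R ^ (x - l) * A l)"
      using BR A0 by (intro mult_mono sum_mono2 sum_nonneg) auto
    finally show ?thesis .
  qed
  moreover have "real n * B + 1 > 0" using BR by (simp add: add_nonneg_pos)
  ultimately have "\<exists>D Q. Q > 0 \<and> (\<forall>x. A x \<le> D * Q ^ x)"
    using recurrence_geometric_bound[of A R "real n * B + 1" 0] A0 BR(2) by simp
  then obtain D Q where DQ: "Q > 0" "\<forall>x. A x \<le> D * Q ^ x" by (elim exE conjE)
  define F where "F j = Abs_fps (\<lambda>x. a x j)" for j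
  show thesis
  proof (rule that[of F])
    fix j assume j: "j < n"
    show "fps_nth (F j) 0 = v j" by (simp add: F_def, subst a, simp)
    have "\<bar>a x j\<bar> \<le> A x" for x
      unfolding A_def using j by (intro member_le_sum) auto
    then show "fps_conv_radius (F j) > 0"
      by (intro fps_conv_radius_posI[of Q _ D]) (use DQ in \<open>auto simp: F_def intro: order_trans\<close>)
    show "fps_deriv (F j) = (\<Sum>k<n. F k * G k j)"
    proof (rule fps_ext)
      fix m
      have "fps_nth (fps_deriv (F j)) m = real (Suc m) * a (Suc m) j" by (simp add: F_def)
      also have "\<dots> = ?step a (Suc m) j" by (subst a) simp
      also have "\<dots> = fps_nth (\<Sum>k<n. F k * G k j) m"
        by (simp add: fps_sum_nth fps_mult_nth F_def lessThan_Suc_atMost atMost_atLeast0)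
      finally show "fps_nth (fps_deriv (F j)) m = fps_nth (\<Sum>k<n. F k * G k j) m" .
    qed
  qed
qed

text \<open>Used for both directions: for the companion system of the scalar equation, with P the
  set of poles, and for the adjoint of a control system, with P empty.\<close>

locale linear_system =
  fixes n :: nat and M :: "nat \<Rightarrow> nat \<Rightarrow> real \<Rightarrow> real" and \<alpha> \<beta> :: real and P :: "real set"
  assumes ends: "\<alpha> < \<beta>" and finite_P: "finite P"
    and M_analytic: "\<And>t k j. t \<in> {\<alpha>..\<beta>} \<Longrightarrow> t \<notin> P \<Longrightarrow> k < n \<Longrightarrow> j < n \<Longrightarrow>
      real_analytic_at {\<alpha>..\<beta>} (M k j) t"
begin

abbreviation S :: "real set" where "S \<equiv> {\<alpha>..\<beta>}"

text \<open>
  Solutions are row vectors: \<open>y' = y M\<close>. At the points of \<open>P\<close> only analyticity of \<open>y\<close> is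
  required. A set is full when the analytic solutions on it form a space of dimension \<open>n\<close>.
\<close>

definition solves :: "real set \<Rightarrow> (nat \<Rightarrow> real \<Rightarrow> real) \<Rightarrow> bool" where
  "solves U y \<longleftrightarrow> (\<forall>j<n. \<forall>x\<in>U. real_analytic_at S (y j) x) \<and>
     (\<forall>j<n. \<forall>x\<in>U - P. (y j has_real_derivative (\<Sum>k<n. y k x * M k j x)) (at x within S))"

definition full :: "real set \<Rightarrow> bool" where
  "full U \<longleftrightarrow> (\<exists>Q. finite Q \<and> (\<forall>p\<in>U - Q. \<forall>v. \<exists>y. solves U y \<and> (\<forall>j<n. y j p = v j)))"

lemma nontriv: "t \<in> S \<Longrightarrow> at t within S \<noteq> bot"
  using at_within_Icc_nontrivial[OF ends] .

lemma eventually_in_interval: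
  assumes "p \<in> S \<inter> {a<..<b}" "finite Q"
  shows "\<forall>\<^sub>F x in at p within S. x \<in> S \<inter> {a<..<b} - Q"
proof -
  have "open ({a<..<b} - (Q - {p}))" using assms(2) by (intro open_Diff finite_imp_closed) auto
  then have "\<forall>\<^sub>F x in at p within S. x \<in> {a<..<b} - (Q - {p})"
    using assms(1) by (intro eventually_at_topological[THEN iffD2]) blast
  moreover have "\<forall>\<^sub>F x in at p within S. x \<in> S \<and> x \<noteq> p" by (auto simp: eventually_at_filter)
  ultimately show ?thesis by eventually_elim auto
qed

lemma solves_subset: "solves U y \<Longrightarrow> V \<subseteq> U \<Longrightarrow> solves V y"
  unfolding solves_def by blast

lemma analytic_expansions:
  assumes "t \<in> S" "\<And>i. i \<in> I \<Longrightarrow> real_analytic_at S (f i) t"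
  obtains F where "\<And>i. i \<in> I \<Longrightarrow> expands_at S (f i) t (F i)"
    "\<And>i. i \<in> I \<Longrightarrow> f i t = fps_nth (F i) 0"
proof -
  have "\<forall>i\<in>I. \<exists>F. expands_at S (f i) t F \<and> f i t = fps_nth F 0"
    using real_analytic_atE[OF assms(2) assms(1) nontriv[OF assms(1)]] by blast
  from bchoice[OF this] show thesis using that by blast
qed

lemma system_expansions:
  assumes "t \<in> S" "t \<notin> P"
  shows "\<exists>G. \<forall>k<n. \<forall>j<n. expands_at S (M k j) t (G k j) \<and> M k j t = fps_nth (G k j) 0"
proof -
  show ?thesis
  proof (rule analytic_expansions[OF assms(1), of "{..<n} \<times> {..<n}" "\<lambda>s. M (fst s) (snd s)"])
    show "real_analytic_at S (M (fst s) (snd s)) t" if "s \<in> {..<n} \<times> {..<n}" for s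
      using M_analytic[OF assms] that by auto
    fix G assume "\<And>s. s \<in> {..<n} \<times> {..<n} \<Longrightarrow> expands_at S (M (fst s) (snd s)) t (G s)"
      "\<And>s. s \<in> {..<n} \<times> {..<n} \<Longrightarrow> M (fst s) (snd s) t = fps_nth (G s) 0"
    then show ?thesis by (intro exI[of _ "\<lambda>k j. G (k, j)"]) force
  qed
qed

section \<open>Linear structure, uniqueness and continuation of solutions\<close>

lemma solves_sum:
  assumes "\<And>i. i \<in> I \<Longrightarrow> solves U (y i)" "U \<subseteq> S"
  shows "solves U (\<lambda>j x. \<Sum>i\<in>I. c i * y i j x)"
  unfolding solves_def
proof (intro conjI allI impI ballI)
  fix j x assume j: "j < n"
  show "real_analytic_at S (\<lambda>x. \<Sum>i\<in>I. c i * y i j x) x" if "x \<in> U"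
    using assms that j nontriv
    by (intro real_analytic_at_sum real_analytic_at_mult real_analytic_at_const) (auto simp: solves_def)
  assume x: "x \<in> U - P"
  have "((\<lambda>x. \<Sum>i\<in>I. c i * y i j x) has_real_derivative
      (\<Sum>i\<in>I. c i * (\<Sum>k<n. y i k x * M k j x))) (at x within S)"
    using assms(1) x j by (intro DERIV_sum DERIV_cmult) (auto simp: solves_def)
  moreover have "(\<Sum>i\<in>I. c i * (\<Sum>k<n. y i k x * M k j x)) = (\<Sum>k<n. (\<Sum>i\<in>I. c i * y i k x) * M k j x)"
    unfolding sum_distrib_left sum_distrib_right by (subst sum.swap) (simp add: mult.assoc)
  ultimately show "((\<lambda>x. \<Sum>i\<in>I. c i * y i j x) has_real_derivative
      (\<Sum>k<n. (\<Sum>i\<in>I. c i * y i k x) * M k j x)) (at x within S)" by simp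
qed

lemma solves_diff:
  assumes "solves U y" "solves U z" "U \<subseteq> S"
  shows "solves U (\<lambda>j x. y j x - z j x)"
proof -
  have "solves U (\<lambda>j x. \<Sum>i\<in>{True, False}. (if i then 1 else -1) * (if i then y else z) j x)"
    by (intro solves_sum) (use assms in \<open>simp_all split: if_split\<close>)
  moreover have "(\<lambda>j x. \<Sum>i\<in>{True, False}. (if i then 1 else -1) * (if i then y else z) j x)
      = (\<lambda>j x. y j x - z j x)"
    by (intro ext) simp
  ultimately show ?thesis by simp
qed

text \<open>The set is open in S, so analyticity and derivatives at its points depend on values
  inside it only. This allows a solution to be redefined elsewhere when two of them are
  glued.\<close>

lemma solves_cong:
  assumes "solves (S \<inter> {a<..<b}) y" "\<And>j x. j < n \<Longrightarrow> x \<in> S \<inter> {a<..<b} \<Longrightarrow> z j x = y j x"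
  shows "solves (S \<inter> {a<..<b}) z"
  unfolding solves_def
proof (intro conjI allI impI ballI)
  fix j x assume j: "j < n"
  { assume x: "x \<in> S \<inter> {a<..<b}"
    have ev: "\<forall>\<^sub>F w in at x within S. y j w = z j w"
      using eventually_in_interval[OF x finite.emptyI] by eventually_elim (simp add: assms(2) j)
    obtain F where F: "expands_at S (y j) x F" "y j x = fps_nth F 0"
      using real_analytic_atE[of S "y j" x] assms(1) x j nontriv by (auto simp: solves_def)
    show "real_analytic_at S (z j) x"
      using expands_at_cong[OF F(1) ev] F(2) assms(2)[OF j x] by (intro real_analytic_atI) auto }
  assume "x \<in> S \<inter> {a<..<b} - P"
  then have x: "x \<in> S \<inter> {a<..<b}" and D: "(y j has_real_derivative (\<Sum>k<n. y k x * M k j x)) (at x within S)"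
    using assms(1) j by (auto simp: solves_def)
  show "(z j has_real_derivative (\<Sum>k<n. z k x * M k j x)) (at x within S)"
  proof (rule has_field_derivative_transform_within)
    show "(y j has_real_derivative (\<Sum>k<n. z k x * M k j x)) (at x within S)"
      using D assms(2)[OF _ x] by simp
    show "0 < min (x - a) (b - x)" using x by auto
    show "y j w = z j w" if "w \<in> S" "dist w x < min (x - a) (b - x)" for w
      using assms(2)[OF j, of w] that by (simp add: dist_real_def abs_less_iff)
  qed (use x in auto)
qed

lemma solves_formal:
  assumes "solves (S \<inter> {a<..<b}) y" "p \<in> S \<inter> {a<..<b}"
    and F: "\<And>j. j < n \<Longrightarrow> expands_at S (y j) p (F j)"
    and G: "\<And>k j. k < n \<Longrightarrow> j < n \<Longrightarrow> expands_at S (M k j) p (G k j)"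
    and j: "j < n"
  shows "fps_deriv (F j) = (\<Sum>k<n. F k * G k j)"
proof (rule expands_at_unique)
  have "\<forall>\<^sub>F x in at p within S. (y j has_real_derivative (\<Sum>k<n. y k x * M k j x)) (at x within S)"
    using eventually_in_interval[OF assms(2) finite_P] assms(1) j
    by (auto simp: solves_def elim!: eventually_mono)
  from expands_at_deriv[OF F[OF j] this nontriv]
  show "expands_at S (\<lambda>x. \<Sum>k<n. y k x * M k j x) p (fps_deriv (F j))" .
  show "expands_at S (\<lambda>x. \<Sum>k<n. y k x * M k j x) p (\<Sum>k<n. F k * G k j)"
    using F G j by (intro expands_at_sum expands_at_mult) auto
qed (use nontriv assms(2) in auto)

text \<open>At a point off P the equation determines every coefficient from the constant terms, so
  zero values give zero expansions. The identity theorem extends this over the interval, across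
  points of P too, since solutions are analytic there.\<close>

lemma solves_unique:
  assumes sol: "solves (S \<inter> {a<..<b}) y" and p: "p \<in> S \<inter> {a<..<b}" "p \<notin> P"
    and y0: "\<And>j. j < n \<Longrightarrow> y j p = 0"
    and "x \<in> S \<inter> {a<..<b}" "j < n"
  shows "y j x = 0"
proof -
  have pS: "p \<in> S" using p(1) by simp
  obtain F where F: "\<And>j. j < n \<Longrightarrow> expands_at S (y j) p (F j)"
    "\<And>j. j < n \<Longrightarrow> y j p = fps_nth (F j) 0"
    using analytic_expansions[OF pS, of "{..<n}" y] sol p(1) unfolding solves_def by auto
  from system_expansions[OF pS p(2)]
  obtain G where G: "\<And>k j. k < n \<Longrightarrow> j < n \<Longrightarrow> expands_at S (M k j) p (G k j)"
    by (elim exE) auto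
  have ode: "fps_deriv (F j) = (\<Sum>k<n. F k * G k j)" if "j < n" for j
    by (rule solves_formal[OF sol p(1) F(1) G(1) that])
  have "fps_nth (F j) m = 0" if "j < n" for j m
    using that
  proof (induction m arbitrary: j rule: less_induct)
    case (less m)
    show ?case
    proof (cases m)
      case 0
      then show ?thesis using F y0 less.prems by auto
    next
      case (Suc m')
      have "real m * fps_nth (F j) m = fps_nth (fps_deriv (F j)) m'" by (simp add: Suc)
      also have "\<dots> = 0"
        unfolding ode[OF less.prems] fps_sum_nth fps_mult_nth
        using less.IH Suc by (intro sum.neutral ballI) auto
      finally show ?thesis using Suc by simp
    qed
  qed
  then have "F j = 0" using \<open>j < n\<close> by (intro fps_ext) simp
  then have "\<forall>\<^sub>F x in at p within S. y j x = 0" using F(1)[OF \<open>j < n\<close>] by (simp add: expands_at_def)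
  then show ?thesis
    using analytic_identity[of S "S \<inter> {a<..<b}" "y j" p x] nontriv p assms(5,6) sol
    by (auto simp: solves_def openin_open_Int convex_connected convex_Int)
qed

lemma solves_glue:
  assumes y: "solves (S \<inter> {a<..<b}) y" and z: "solves (S \<inter> {c<..<d}) z"
    and q: "q \<in> S \<inter> {a<..<b}" "q \<in> S \<inter> {c<..<d}" "q \<notin> P"
    and eq: "\<And>j. j < n \<Longrightarrow> y j q = z j q"
  obtains w where "solves (S \<inter> {a<..<b} \<union> S \<inter> {c<..<d}) w"
    "\<And>j x. j < n \<Longrightarrow> x \<in> S \<inter> {a<..<b} \<Longrightarrow> w j x = y j x"
    "\<And>j x. j < n \<Longrightarrow> x \<in> S \<inter> {c<..<d} \<Longrightarrow> w j x = z j x"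
proof -
  define w where "w j x = (if x \<in> {a<..<b} then y j x else z j x)" for j x
  have overlap: "S \<inter> {max a c<..<min b d} = S \<inter> {a<..<b} \<inter> {c<..<d}" by auto
  have "solves (S \<inter> {max a c<..<min b d}) (\<lambda>j x. y j x - z j x)"
    by (intro solves_diff solves_subset[OF y] solves_subset[OF z]) auto
  from solves_unique[OF this, of q] q eq
  have agree: "y j x = z j x" if "j < n" "x \<in> S" "x \<in> {a<..<b}" "x \<in> {c<..<d}" for j x
    using that by auto
  have 1: "solves (S \<inter> {a<..<b}) w" by (rule solves_cong[OF y]) (auto simp: w_def)
  have 2: "solves (S \<inter> {c<..<d}) w" by (rule solves_cong[OF z]) (use agree in \<open>auto simp: w_def\<close>)
  show thesis
    by (rule that[of w]) (use 1 2 agree in \<open>auto simp: solves_def w_def\<close>)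
qed

text \<open>The overlap is open in S and contains a point q outside both exceptional sets and P. A
  solution with given values at r on one interval is continued by the solution on the other interval
  that has the same values at q.\<close>

lemma full_union:
  assumes "full (S \<inter> {a<..<b})" "full (S \<inter> {c<..<d})" "S \<inter> {a<..<b} \<inter> {c<..<d} \<noteq> {}"
  shows "full (S \<inter> {a<..<b} \<union> S \<inter> {c<..<d})"
proof -
  obtain Q1 where Q1: "finite Q1" "\<And>p v. p \<in> S \<inter> {a<..<b} - Q1 \<Longrightarrow>
      \<exists>y. solves (S \<inter> {a<..<b}) y \<and> (\<forall>j<n. y j p = v j)"
    using assms(1) unfolding full_def by blast
  obtain Q2 where Q2: "finite Q2" "\<And>p v. p \<in> S \<inter> {c<..<d} - Q2 \<Longrightarrow>
      \<exists>y. solves (S \<inter> {c<..<d}) y \<and> (\<forall>j<n. y j p = v j)"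
    using assms(2) unfolding full_def by blast
  obtain p where p: "p \<in> S" "p \<in> {a<..<b}" "p \<in> {c<..<d}" using assms(3) by blast
  have "\<forall>\<^sub>F x in at p within S. x \<in> S \<inter> {max a c<..<min b d} - (Q1 \<union> Q2 \<union> P)"
    using p Q1(1) Q2(1) finite_P by (intro eventually_in_interval) auto
  then obtain q where q: "q \<in> S" "q \<in> {a<..<b}" "q \<in> {c<..<d}" "q \<notin> Q1" "q \<notin> Q2" "q \<notin> P"
    using eventually_happens'[OF nontriv[OF p(1)]] by fastforce
  show ?thesis unfolding full_def
  proof (intro exI[of _ "Q1 \<union> Q2"] conjI ballI allI)
    fix r v assume r: "r \<in> S \<inter> {a<..<b} \<union> S \<inter> {c<..<d} - (Q1 \<union> Q2)"
    show "\<exists>y. solves (S \<inter> {a<..<b} \<union> S \<inter> {c<..<d}) y \<and> (\<forall>j<n. y j r = v j)"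
    proof (cases "r \<in> S \<inter> {a<..<b}")
      case True
      obtain y where y: "solves (S \<inter> {a<..<b}) y" "\<forall>j<n. y j r = v j" using Q1(2)[of r v] True r by blast
      obtain z where z: "solves (S \<inter> {c<..<d}) z" "\<forall>j<n. z j q = y j q"
        using Q2(2)[of q "\<lambda>j. y j q"] q by blast
      obtain w where "solves (S \<inter> {a<..<b} \<union> S \<inter> {c<..<d}) w" "\<And>j. j < n \<Longrightarrow> w j r = y j r"
        by (rule solves_glue[OF y(1) z(1), of q]) (use q z(2) True in auto)
      then show ?thesis using y(2) by auto
    next
      case False
      then have r': "r \<in> S \<inter> {c<..<d}" using r by blast
      then obtain z where z: "solves (S \<inter> {c<..<d}) z" "\<forall>j<n. z j r = v j" using Q2(2)[of r v] r by blast
      obtain y where y: "solves (S \<inter> {a<..<b}) y" "\<forall>j<n. y j q = z j q"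
        using Q1(2)[of q "\<lambda>j. z j q"] q by blast
      obtain w where "solves (S \<inter> {a<..<b} \<union> S \<inter> {c<..<d}) w" "\<And>j. j < n \<Longrightarrow> w j r = z j r"
        by (rule solves_glue[OF y(1) z(1), of q]) (use q y(2) r' in auto)
      then show ?thesis using z(2) by auto
    qed
  qed (use Q1(1) Q2(1) in auto)
qed

lemma full_subset:
  assumes "full U" "V \<subseteq> U"
  shows "full V"
proof -
  obtain Q where Q: "finite Q" "\<forall>p\<in>U - Q. \<forall>v. \<exists>y. solves U y \<and> (\<forall>j<n. y j p = v j)"
    using assms(1) unfolding full_def by blast
  show ?thesis unfolding full_def
  proof (intro exI[of _ Q] conjI ballI allI)
    fix p v assume "p \<in> V - Q"
    then obtain y where "solves U y" "\<forall>j<n. y j p = v j" using Q(2) assms(2) by blast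
    then show "\<exists>y. solves V y \<and> (\<forall>j<n. y j p = v j)"
      using solves_subset[OF _ assms(2), of y] by (intro exI[of _ y]) simp
  qed (rule Q(1))
qed

text \<open>
  The argument is a compactness one: neighbouring full intervals overlap in a point where both
  solution spaces take all initial values.
\<close>

lemma full_global:
  assumes local: "\<And>t. t \<in> S \<Longrightarrow> \<exists>r>0. full (S \<inter> {t - r<..<t + r})"
  shows "full S"
proof -
  \<comment> \<open>The margin e makes intervals that share only an endpoint overlap in an open part
    of S, as \<open>full_union\<close> demands.\<close>
  let ?C = "\<lambda>a b. a \<in> S \<and> b \<in> S \<longrightarrow> (\<exists>e>0. full (S \<inter> {a - e<..<b + e}))"
  have "?C \<alpha> \<beta>"
  proof (rule Bolzano[where P = ?C])
    fix a b c assume trans: "?C a b" "?C b c" "a \<le> b" "b \<le> c"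
    show "?C a c"
    proof
      assume ac: "a \<in> S \<and> c \<in> S"
      then have b: "b \<in> S" using trans(3,4) by auto
      obtain e1 e2 where e: "e1 > 0" "full (S \<inter> {a - e1<..<b + e1})" "e2 > 0" "full (S \<inter> {b - e2<..<c + e2})"
        using trans(1,2) ac b by blast
      have "b \<in> S \<inter> {a - e1<..<b + e1} \<inter> {b - e2<..<c + e2}" using b e(1,3) trans(3,4) by auto
      then have "full (S \<inter> {a - e1<..<b + e1} \<union> S \<inter> {b - e2<..<c + e2})"
        by (intro full_union e) blast
      then have "full (S \<inter> {a - min e1 e2<..<c + min e1 e2})"
        by (rule full_subset) (use e(1,3) in auto)
      then show "\<exists>e>0. full (S \<inter> {a - e<..<c + e})" using e(1,3) by (intro exI[of _ "min e1 e2"]) auto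
    qed
  next
    fix t assume "\<alpha> \<le> t" "t \<le> \<beta>"
    then obtain r where r: "r > 0" "full (S \<inter> {t - r<..<t + r})" using local by auto
    show "\<exists>d>0. \<forall>a b. a \<le> t \<and> t \<le> b \<and> b - a < d \<longrightarrow> ?C a b"
    proof (rule exI[of _ "r / 2"], intro conjI allI impI)
      fix a b assume "a \<le> t \<and> t \<le> b \<and> b - a < r / 2" "a \<in> S \<and> b \<in> S"
      then have "full (S \<inter> {a - r / 2<..<b + r / 2})" by (intro full_subset[OF r(2)]) auto
      then show "\<exists>e>0. full (S \<inter> {a - e<..<b + e})" using r(1) by (intro exI[of _ "r / 2"]) auto
    qed (use r in simp)
  qed (use ends in simp)
  then obtain e where "e > 0" "full (S \<inter> {\<alpha> - e<..<\<beta> + e})" using ends by auto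
  then show ?thesis by (elim full_subset) auto
qed

text \<open>The expansion in \<open>eq\<close> says nothing about t itself. If t lies outside P, the
  equation at t must come from \<open>center\<close>; at a point of P \<open>solves\<close> asks for
  no derivative.\<close>

lemma solves_eval_fps:
  assumes t: "t \<in> S" and rad: "\<And>j. j < n \<Longrightarrow> fps_conv_radius (F j) > 0"
    and eq: "\<And>j. j < n \<Longrightarrow> expands_at S (\<lambda>x. \<Sum>k<n. eval_fps (F k) (x - t) * M k j x) t (fps_deriv (F j))"
    and center: "t \<notin> P \<Longrightarrow> (\<And>j. j < n \<Longrightarrow> fps_nth (fps_deriv (F j)) 0 = (\<Sum>k<n. fps_nth (F k) 0 * M k j t))"
  obtains r where "r > 0" "solves (S \<inter> {t - r<..<t + r}) (\<lambda>j x. eval_fps (F j) (x - t))"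
proof -
  have ex: "expands_at S (\<lambda>x. eval_fps (F j) (x - t)) t (F j)" if "j < n" for j
    using rad[OF that] by (simp add: expands_at_def)
  have "\<forall>\<^sub>F x in at t within S. \<forall>j\<in>{..<n}. ereal (norm (x - t)) < fps_conv_radius (F j) \<and>
      ((\<lambda>x. eval_fps (F j) (x - t)) has_real_derivative (\<Sum>k<n. eval_fps (F k) (x - t) * M k j x)) (at x within S)"
  proof (intro eventually_ball_finite ballI)
    fix j assume "j \<in> {..<n}"
    then have j: "j < n" by simp
    show "\<forall>\<^sub>F x in at t within S. ereal (norm (x - t)) < fps_conv_radius (F j) \<and>
      ((\<lambda>x. eval_fps (F j) (x - t)) has_real_derivative (\<Sum>k<n. eval_fps (F k) (x - t) * M k j x)) (at x within S)"
      using eventually_in_conv_radius[OF rad[OF j]] expands_at_has_derivative[OF ex[OF j]]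
        eq[OF j, unfolded expands_at_def, THEN conjunct2]
      by eventually_elim simp
  qed simp
  from eventually_at_within_realD[OF this] obtain r where r: "r > 0"
    "\<And>x j. x \<in> S \<Longrightarrow> x \<noteq> t \<Longrightarrow> \<bar>x - t\<bar> < r \<Longrightarrow> j < n \<Longrightarrow> ereal (norm (x - t)) < fps_conv_radius (F j) \<and>
      ((\<lambda>x. eval_fps (F j) (x - t)) has_real_derivative (\<Sum>k<n. eval_fps (F k) (x - t) * M k j x)) (at x within S)"
    by (elim exE) auto
  have "solves (S \<inter> {t - r<..<t + r}) (\<lambda>j x. eval_fps (F j) (x - t))"
    unfolding solves_def
  proof (intro conjI allI impI ballI)
    fix j x assume j: "j < n"
    show "real_analytic_at S (\<lambda>x. eval_fps (F j) (x - t)) x" if "x \<in> S \<inter> {t - r<..<t + r}"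
      by (rule eval_fps_real_analytic_at) (use r(2)[of x j] that j rad in \<open>cases "x = t"; force simp: zero_ereal_def\<close>)
    assume x: "x \<in> S \<inter> {t - r<..<t + r} - P"
    show "((\<lambda>x. eval_fps (F j) (x - t)) has_real_derivative
        (\<Sum>k<n. eval_fps (F k) (x - t) * M k j x)) (at x within S)"
    proof (cases "x = t")
      case True
      then show ?thesis
        using expands_at_has_derivative_center[OF ex[OF j] _ t] center[OF _ j] x
        by (simp add: eval_fps_at_0)
    next
      case False
      then show ?thesis using r(2)[of x j] x j by auto
    qed
  qed
  with r(1) show thesis by (rule that)
qed

text \<open>Where the matrix of values of n solutions is invertible, their combinations attain all
  initial values. A nonzero determinant of the expansions ensures this on a punctured neighbourhood,
  so t is the only exceptional point.\<close>

lemma local_full: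
  assumes t: "t \<in> S" and "r > 0" and sol: "\<And>i. i < n \<Longrightarrow> solves (S \<inter> {t - r<..<t + r}) (y i)"
    and ex: "\<And>i j. i < n \<Longrightarrow> j < n \<Longrightarrow> expands_at S (y i j) t (F i j)"
    and det: "Determinant.det (Matrix.mat n n (\<lambda>(i, j). F i j)) \<noteq> 0"
  shows "\<exists>r>0. full (S \<inter> {t - r<..<t + r})"
proof -
  from expands_at_nonzero[OF expands_at_det det, of S y t] ex
  have "\<forall>\<^sub>F x in at t within S. Determinant.det (Matrix.mat n n (\<lambda>(i, j). y i j x)) \<noteq> 0" by auto
  from eventually_at_within_realD[OF this] obtain d where d: "d > 0"
    "\<And>x. x \<in> S \<Longrightarrow> x \<noteq> t \<Longrightarrow> \<bar>x - t\<bar> < d \<Longrightarrow> Determinant.det (Matrix.mat n n (\<lambda>(i, j). y i j x)) \<noteq> 0"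
    by (elim exE) auto
  define e where "e = min r d"
  have "full (S \<inter> {t - e<..<t + e})" unfolding full_def
  proof (intro exI[of _ "{t}"] conjI ballI allI)
    fix p v assume "p \<in> S \<inter> {t - e<..<t + e} - {t}"
    then have "Determinant.det (Matrix.mat n n (\<lambda>(i, j). y i j p)) \<noteq> 0"
      by (intro d(2)) (auto simp: e_def)
    then obtain c where c: "\<And>j. j < n \<Longrightarrow> (\<Sum>i<n. c i * y i j p) = v j"
      using det_nonzero_solve[where v = v] by blast
    have "solves (S \<inter> {t - e<..<t + e}) (\<lambda>j x. \<Sum>i<n. c i * y i j x)"
      by (intro solves_sum solves_subset[OF sol]) (auto simp: e_def)
    then show "\<exists>y. solves (S \<inter> {t - e<..<t + e}) y \<and> (\<forall>j<n. y j p = v j)"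
      using c by (intro exI[of _ "\<lambda>j x. \<Sum>i<n. c i * y i j x"]) auto
  qed simp
  moreover have "e > 0" using d(1) \<open>r > 0\<close> by (simp add: e_def)
  ultimately show ?thesis by blast
qed

lemma local_full_fps:
  assumes t: "t \<in> S" and rad: "\<And>i j. i < n \<Longrightarrow> j < n \<Longrightarrow> fps_conv_radius (F i j) > 0"
    and eq: "\<And>i j. i < n \<Longrightarrow> j < n \<Longrightarrow>
      expands_at S (\<lambda>x. \<Sum>k<n. eval_fps (F i k) (x - t) * M k j x) t (fps_deriv (F i j))"
    and center: "t \<notin> P \<Longrightarrow> (\<And>i j. i < n \<Longrightarrow> j < n \<Longrightarrow>
      fps_nth (fps_deriv (F i j)) 0 = (\<Sum>k<n. fps_nth (F i k) 0 * M k j t))"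
    and det: "Determinant.det (Matrix.mat n n (\<lambda>(i, j). F i j)) \<noteq> 0"
  shows "\<exists>r>0. full (S \<inter> {t - r<..<t + r})"
proof -
  have "\<exists>r>0. solves (S \<inter> {t - r<..<t + r}) (\<lambda>j x. eval_fps (F i j) (x - t))" if "i < n" for i
  proof (rule solves_eval_fps[OF t rad[OF that] eq[OF that] center[OF _ that]])
    fix r assume "0 < r" "solves (S \<inter> {t - r<..<t + r}) (\<lambda>j x. eval_fps (F i j) (x - t))"
    then show ?thesis by blast
  qed
  then have "\<forall>i\<in>{..<n}. \<exists>r>0. solves (S \<inter> {t - r<..<t + r}) (\<lambda>j x. eval_fps (F i j) (x - t))"
    by blast
  from bchoice[OF this] obtain r where r: "\<And>i. i < n \<Longrightarrow> r i > 0"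
    "\<And>i. i < n \<Longrightarrow> solves (S \<inter> {t - r i<..<t + r i}) (\<lambda>j x. eval_fps (F i j) (x - t))" by auto
  \<comment> \<open>The 1 keeps the set nonempty when \<open>n = 0\<close>.\<close>
  define e where "e = Min (insert 1 (r ` {..<n}))"
  have e: "e > 0" "\<And>i. i < n \<Longrightarrow> e \<le> r i" using r(1) by (auto simp: e_def)
  show ?thesis
  proof (rule local_full[OF t e(1) _ _ det])
    show "solves (S \<inter> {t - e<..<t + e}) (\<lambda>j x. eval_fps (F i j) (x - t))" if "i < n" for i
      by (rule solves_subset[OF r(2)[OF that]]) (use e(2)[OF that] in auto)
    show "expands_at S (\<lambda>x. eval_fps (F i j) (x - t)) t (F i j)" if "i < n" "j < n" for i j
      using rad[OF that] by (simp add: expands_at_def)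
  qed
qed

text \<open>The solutions chosen have the unit vectors as values at t. Their matrix of constant
  terms is the identity, so a formal kernel vector vanishes order by order.\<close>

lemma regular_local_full:
  assumes t: "t \<in> S" "t \<notin> P"
  shows "\<exists>r>0. full (S \<inter> {t - r<..<t + r})"
proof -
  from system_expansions[OF t]
  obtain G where G: "\<And>k j. k < n \<Longrightarrow> j < n \<Longrightarrow> expands_at S (M k j) t (G k j)"
    "\<And>k j. k < n \<Longrightarrow> j < n \<Longrightarrow> M k j t = fps_nth (G k j) 0"
    by (elim exE) auto
  have rad: "fps_conv_radius (G k j) > 0" if "k < n" "j < n" for k j
    using G(1)[OF that] by (simp add: expands_at_def)
  have "\<exists>F. \<forall>j<n. fps_nth (F j) 0 = (if i = j then 1 else 0) \<and> fps_conv_radius (F j) > 0 \<and>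
      fps_deriv (F j) = (\<Sum>k<n. F k * G k j)" for i
  proof (rule regular_formal_solution[of n G "\<lambda>j. if i = j then 1 else 0", OF rad])
    fix F assume "\<And>j. j < n \<Longrightarrow> fps_nth (F j) 0 = (if i = j then 1 else 0)"
      "\<And>j. j < n \<Longrightarrow> fps_conv_radius (F j) > 0" "\<And>j. j < n \<Longrightarrow> fps_deriv (F j) = (\<Sum>k<n. F k * G k j)"
    then show ?thesis by (intro exI[of _ F]) simp
  qed
  then have "\<forall>i. \<exists>F. \<forall>j<n. fps_nth (F j) 0 = (if i = j then 1 else 0) \<and> fps_conv_radius (F j) > 0 \<and>
      fps_deriv (F j) = (\<Sum>k<n. F k * G k j)" by (rule allI)
  from choice[OF this] obtain F where F: "\<And>i j. j < n \<Longrightarrow> fps_nth (F i j) 0 = (if i = j then 1 else 0) \<and>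
      fps_conv_radius (F i j) > 0 \<and> fps_deriv (F i j) = (\<Sum>k<n. F i k * G k j)"
    by auto
  show ?thesis
  proof (rule local_full_fps[OF t(1), of F])
    fix i j assume ij: "i < n" "j < n"
    show "fps_conv_radius (F i j) > 0" using F[OF ij(2), of i] by simp
    have "expands_at S (\<lambda>x. \<Sum>k<n. eval_fps (F i k) (x - t) * M k j x) t (\<Sum>k<n. F i k * G k j)"
      using F G(1) ij by (intro expands_at_sum expands_at_mult) (auto simp: expands_at_def)
    then show "expands_at S (\<lambda>x. \<Sum>k<n. eval_fps (F i k) (x - t) * M k j x) t (fps_deriv (F i j))"
      using F[OF ij(2), of i] by simp
    show "fps_nth (fps_deriv (F i j)) 0 = (\<Sum>k<n. fps_nth (F i k) 0 * M k j t)"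
      using F[of j i] G(2) ij by (simp only: fps_sum_nth fps_mult_nth_0) simp
  next
    show "Determinant.det (Matrix.mat n n (\<lambda>(i, j). F i j)) \<noteq> 0"
    proof
      assume "Determinant.det (Matrix.mat n n (\<lambda>(i, j). F i j)) = 0"
      then obtain u where u: "\<exists>j<n. u j \<noteq> 0" "\<And>i. i < n \<Longrightarrow> (\<Sum>j<n. F i j * u j) = 0"
        unfolding det_eq_0_iff_kernel by blast
      have "fps_nth (u j) k = 0" if "j < n" for j k
      proof (rule regular_relation_coeffs[of n F "Suc k" u k j])
        fix c :: "nat \<Rightarrow> real" and j
        assume c: "\<And>i. i < n \<Longrightarrow> (\<Sum>j<n. c j * fps_nth (F i j) 0) = 0" and j: "j < n"
        have "(\<Sum>l<n. c l * fps_nth (F j l) 0) = (\<Sum>l<n. if l = j then c l else 0)"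
          by (intro sum.cong) (auto simp: F)
        then have "(\<Sum>l<n. c l * fps_nth (F j l) 0) = c j" using j by simp
        then show "c j = 0" using c[OF j] by simp
      next
        fix i m assume "i < n"
        have "(\<Sum>j<n. u j * F i j) = 0" using u(2)[OF \<open>i < n\<close>] by (simp add: mult.commute)
        then show "fps_nth (\<Sum>j<n. u j * F i j) m = 0" by simp
      qed (use that in auto)
      then show False using u(1) by (auto simp: fps_eq_iff)
    qed
  qed
qed

end

section \<open>The rank of a Hessenberg matrix\<close>

context
  fixes N :: nat and A :: "nat \<Rightarrow> nat \<Rightarrow> real"
begin

interpretation vec_space "TYPE(real)" N .

private definition col_vec :: "nat \<Rightarrow> real Matrix.vec" where
  "col_vec j = Matrix.vec N (\<lambda>r. A r j)"

text \<open>Linear dependence concerns sets of vectors, in which equal columns coincide. Choosing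
  one index per vector turns coefficients of vectors into coefficients of indices.\<close>

private lemma lin_dep_colsD:
  assumes "J \<subseteq> {..<N}" "lin_dep (col_vec ` J)"
  shows "\<exists>a. (\<exists>j\<in>J. a j \<noteq> 0) \<and> (\<forall>j. j \<notin> J \<longrightarrow> a j = 0) \<and> (\<forall>r<N. (\<Sum>j<N. A r j * a j) = 0)"
proof -
  obtain F b v where F: "finite F" "F \<subseteq> col_vec ` J" "lincomb b F = 0\<^sub>v N" "v \<in> F" "b v \<noteq> 0"
    using assms(2) unfolding lin_dep_def by (auto simp: class_ring_simps)
  obtain J' where J': "J' \<subseteq> J" "inj_on col_vec J'" "F = col_vec ` J'"
    using F(2) by (auto simp: subset_image_inj)
  define a where "a j = (if j \<in> J' then b (col_vec j) else 0)" for j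
  show ?thesis
  proof (intro exI[of _ a] conjI allI impI)
    show "\<exists>j\<in>J. a j \<noteq> 0" using F(4,5) J' by (auto simp: a_def)
    show "a j = 0" if "j \<notin> J" for j using that J'(1) by (auto simp: a_def)
    fix r assume r: "r < N"
    have "(\<Sum>j<N. A r j * a j) = (\<Sum>j\<in>J'. A r j * a j)"
      by (rule sum.mono_neutral_right) (use assms(1) J'(1) in \<open>auto simp: a_def\<close>)
    also have "\<dots> = (\<Sum>j\<in>J'. b (col_vec j) * col_vec j $ r)"
      by (intro sum.cong) (auto simp: a_def col_vec_def r)
    also have "\<dots> = (\<Sum>x\<in>F. b x * x $ r)"
      unfolding J'(3) by (simp add: sum.reindex[OF J'(2)])
    also have "\<dots> = lincomb b F $ r"
      by (rule lincomb_index[symmetric]) (use r F(2) in \<open>auto simp: col_vec_def\<close>)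
    also have "\<dots> = 0" using F(3) r by simp
    finally show "(\<Sum>j<N. A r j * a j) = 0" .
  qed
qed

private lemma lin_dep_colsI:
  assumes "J \<subseteq> {..<N}" "inj_on col_vec J" "\<exists>j\<in>J. a j \<noteq> 0" "\<And>j. j \<notin> J \<Longrightarrow> a j = 0"
    and "\<And>r. r < N \<Longrightarrow> (\<Sum>j<N. A r j * a j) = 0"
  shows "lin_dep (col_vec ` J)"
proof -
  define b where "b x = a (the_inv_into J col_vec x)" for x
  have b: "b (col_vec j) = a j" if "j \<in> J" for j
    using the_inv_into_f_f[OF assms(2) that] by (simp add: b_def)
  have carr: "col_vec ` J \<subseteq> carrier_vec N" by (auto simp: col_vec_def)
  have "lincomb b (col_vec ` J) = 0\<^sub>v N"
  proof (rule eq_vecI)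
    fix r assume "r < dim_vec (0\<^sub>v N)"
    then have r: "r < N" by simp
    have "lincomb b (col_vec ` J) $ r = (\<Sum>x\<in>col_vec ` J. b x * x $ r)"
      by (rule lincomb_index[OF r carr])
    also have "\<dots> = (\<Sum>j\<in>J. A r j * a j)"
      by (simp add: sum.reindex[OF assms(2)] b) (simp add: col_vec_def r mult.commute)
    also have "\<dots> = (\<Sum>j<N. A r j * a j)"
      by (rule sum.mono_neutral_left) (use assms(1,4) in auto)
    finally show "lincomb b (col_vec ` J) $ r = 0\<^sub>v N $ r" using assms(5) r by simp
  qed (use carr lincomb_dim finite_subset[OF assms(1)] in auto)
  moreover have "finite (col_vec ` J)" using assms(1) finite_subset by blast
  moreover obtain j where "j \<in> J" "a j \<noteq> 0" using assms(3) by blast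
  ultimately show ?thesis
    unfolding lin_dep_def using b
    by (intro exI[of _ "col_vec ` J"] exI[of _ b] exI[of _ "col_vec j"]) (auto simp: class_ring_simps)
qed

text \<open>
  In a matrix that vanishes above the first superdiagonal, the columns with a nonzero
  superdiagonal entry are independent, so the rank is minimal iff every other column is a
  combination of these.
\<close>

lemma hessenberg_rank_iff:
  assumes hess: "\<And>r j. Suc r < j \<Longrightarrow> A r j = 0"
    and R: "R = {j. j < N \<and> (j = 0 \<or> A (j - 1) j = 0)}"
  shows "vec_space.rank N (Matrix.mat N N (\<lambda>(i, j). A i j)) = N - card R \<longleftrightarrow>
    (\<forall>i\<in>R. \<exists>a. a i \<noteq> 0 \<and> (\<forall>j<i. a j = 0) \<and> (\<forall>r<N. (\<Sum>j<N. A r j * a j) = 0))"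
proof -
  let ?M = "Matrix.mat N N (\<lambda>(i, j). A i j)"
  define NR where "NR = {..<N} - R"
  have NR: "j \<noteq> 0" "A (j - 1) j \<noteq> 0" "j < N" if "j \<in> NR" for j using that by (auto simp: NR_def R)
  have cardNR: "card NR = N - card R"
    unfolding NR_def by (subst card_Diff_subset) (auto simp: R)
  have M: "?M \<in> carrier_mat N N" by simp
  have cols: "set (cols ?M) = col_vec ` {..<N}"
    by (auto simp: cols_def col_vec_def Matrix.col_def atLeast0LessThan cong: map_cong intro!: image_cong)
  \<comment> \<open>A kernel vector cannot start at an index j of NR: in row j - 1 the earlier
    entries are zero and the later columns vanish, leaving A (j - 1) j a(j) = 0.\<close>
  have least: "a j = 0"
    if ker: "\<And>r. r < N \<Longrightarrow> (\<Sum>j<N. A r j * a j) = 0" and "j \<in> NR" and low: "\<And>l. l < j \<Longrightarrow> a l = 0" for a j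
  proof -
    have "(\<Sum>l<N. A (j - 1) l * a l) = (\<Sum>l<N. if l = j then A (j - 1) j * a j else 0)"
    proof (intro sum.cong refl)
      fix l
      consider "l < j" | "l = j" | "l > j" by linarith
      then show "A (j - 1) l * a l = (if l = j then A (j - 1) j * a j else 0)"
        using low hess[of "j - 1" l] NR[OF \<open>j \<in> NR\<close>] by cases auto
    qed
    then show ?thesis using ker[of "j - 1"] NR[OF \<open>j \<in> NR\<close>] by simp
  qed
  have lead: "a i \<noteq> 0 \<and> (\<forall>j<i. a j = 0)"
    if ker: "\<And>r. r < N \<Longrightarrow> (\<Sum>j<N. A r j * a j) = 0" and nz: "\<exists>j. a j \<noteq> 0"
      and supp: "\<And>j. j \<notin> insert i NR \<Longrightarrow> a j = 0" for a i
  proof -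
    have "\<exists>j. a j \<noteq> 0 \<and> (\<forall>l<j. \<not> a l \<noteq> 0)"
      using nz by (subst (asm) exists_least_iff)
    then obtain j where j: "a j \<noteq> 0" "\<And>l. l < j \<Longrightarrow> a l = 0" by (elim exE conjE) simp
    have "a j = 0" if "j \<in> NR" by (rule least[OF ker that j(2)])
    then have "j \<notin> NR" using j(1) by blast
    then have "j = i" using supp j(1) by blast
    then show ?thesis using j by auto
  qed
  have inj: "inj_on col_vec NR"
  proof (rule linorder_inj_onI')
    fix i j assume ij: "i \<in> NR" "j \<in> NR" "i < j"
    have "col_vec i $ (i - 1) \<noteq> 0" "col_vec j $ (i - 1) = 0"
      using NR[OF ij(1)] hess[of "i - 1" j] ij(3) by (simp_all add: col_vec_def)
    then show "col_vec i \<noteq> col_vec j" by (intro notI) simp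
  qed
  have indpt: "lin_indpt (col_vec ` NR)"
  proof
    assume dep: "lin_dep (col_vec ` NR)"
    have "NR \<subseteq> {..<N}" by (auto simp: NR_def)
    from lin_dep_colsD[OF this dep] obtain a where a: "\<exists>j\<in>NR. a j \<noteq> 0" "\<forall>j. j \<notin> NR \<longrightarrow> a j = 0"
        "\<forall>r<N. (\<Sum>j<N. A r j * a j) = 0" by (elim exE conjE)
    \<comment> \<open>N is a dummy index outside the matrix: the support lies in NR, so
      \<open>lead\<close> yields a nonzero entry where a is zero.\<close>
    have "a N \<noteq> 0 \<and> (\<forall>j<N. a j = 0)" by (rule lead) (use a in auto)
    then show False using a(2) by (auto simp: NR_def)
  qed
  have subNR: "col_vec ` NR \<subseteq> set (cols ?M)" unfolding cols NR_def by auto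
  show ?thesis
  proof
    assume rank: "vec_space.rank N ?M = N - card R"
    show "\<forall>i\<in>R. \<exists>a. a i \<noteq> 0 \<and> (\<forall>j<i. a j = 0) \<and> (\<forall>r<N. (\<Sum>j<N. A r j * a j) = 0)"
    proof
      fix i assume i: "i \<in> R"
      then have iN: "i < N" "i \<notin> NR" by (auto simp: R NR_def)
      have "\<exists>a. (\<exists>j. a j \<noteq> 0) \<and> (\<forall>j. j \<notin> insert i NR \<longrightarrow> a j = 0) \<and>
          (\<forall>r<N. (\<Sum>j<N. A r j * a j) = 0)"
      proof (cases "col_vec i \<in> col_vec ` NR")
        \<comment> \<open>Column i repeats one of the independent columns, so adjoining it does not
          enlarge the set and cardinalities give nothing; the difference of the two columns is the
          relation.\<close>
        case True
        then obtain j where j: "j \<in> NR" "col_vec i = col_vec j" by blast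
        have ij: "i \<noteq> j" using j(1) iN(2) by auto
        define a where "a l = (if l = i then 1 else if l = j then - 1 else (0 :: real))" for l
        have "(\<Sum>l<N. A r l * a l) = 0" if "r < N" for r
        proof -
          have "A r i = A r j" using arg_cong[OF j(2), of "\<lambda>v. v $ r"] that by (simp add: col_vec_def)
          have "(\<Sum>l<N. A r l * a l) = (\<Sum>l\<in>{i, j}. A r l * a l)"
            by (rule sum.mono_neutral_right) (use iN NR(3)[OF j(1)] in \<open>auto simp: a_def\<close>)
          also have "\<dots> = 0" using \<open>A r i = A r j\<close> ij by (simp add: a_def)
          finally show ?thesis .
        qed
        then show ?thesis using j(1) by (intro exI[of _ a] conjI) (auto simp: a_def)
      next
        case False
        have dep: "lin_dep (col_vec ` insert i NR)"
        proof (rule ccontr)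
          assume "\<not> lin_dep (col_vec ` insert i NR)"
          moreover have "col_vec ` insert i NR \<subseteq> set (cols ?M)" using subNR iN(1) by (auto simp: cols)
          ultimately have "card (col_vec ` insert i NR) \<le> vec_space.rank N ?M"
            using rank_ge_card_indpt[OF M] by blast
          moreover have "card (col_vec ` insert i NR) = Suc (card NR)"
            using False card_image[OF inj] by (simp add: card_insert_if NR_def)
          ultimately show False using rank cardNR by simp
        qed
        have "insert i NR \<subseteq> {..<N}" using iN by (auto simp: NR_def)
        from lin_dep_colsD[OF this dep] obtain a where "\<exists>j\<in>insert i NR. a j \<noteq> 0" "\<forall>j. j \<notin> insert i NR \<longrightarrow> a j = 0"
          "\<forall>r<N. (\<Sum>j<N. A r j * a j) = 0"
          by (elim exE conjE)
        then show ?thesis by (intro exI[of _ a]) auto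
      qed
      then show "\<exists>a. a i \<noteq> 0 \<and> (\<forall>j<i. a j = 0) \<and> (\<forall>r<N. (\<Sum>j<N. A r j * a j) = 0)"
      proof (elim exE conjE)
        fix a :: "nat \<Rightarrow> real" and j
        assume a: "\<forall>j. j \<notin> insert i NR \<longrightarrow> a j = 0" "\<forall>r<N. (\<Sum>j<N. A r j * a j) = 0" "a j \<noteq> 0"
        then have "a i \<noteq> 0 \<and> (\<forall>j<i. a j = 0)" by (intro lead) auto
        then show ?thesis using a(2) by (intro exI[of _ a]) simp
      qed
    qed
  next
    assume sol: "\<forall>i\<in>R. \<exists>a. a i \<noteq> 0 \<and> (\<forall>j<i. a j = 0) \<and> (\<forall>r<N. (\<Sum>j<N. A r j * a j) = 0)"
    \<comment> \<open>Downward induction: entries at larger indices of R are eliminated with the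
      reduced vectors found there, which leaves a support in i and NR and exhibits column i as a
      combination of columns from NR.\<close>
    have red: "\<exists>a. a i \<noteq> 0 \<and> (\<forall>j. j \<notin> insert i NR \<longrightarrow> a j = 0) \<and> (\<forall>r<N. (\<Sum>j<N. A r j * a j) = 0)"
      if "i \<in> R" for i
      using that
    proof (induction "N - i" arbitrary: i rule: less_induct)
      case less
      obtain a where a: "a i \<noteq> 0" "\<And>j. j < i \<Longrightarrow> a j = 0" "\<And>r. r < N \<Longrightarrow> (\<Sum>j<N. A r j * a j) = 0"
        using sol less.prems by blast
      define R' where "R' = {i'\<in>R. i' > i}"
      have "\<forall>i'\<in>R'. \<exists>a. a i' \<noteq> 0 \<and> (\<forall>j. j \<notin> insert i' NR \<longrightarrow> a j = 0) \<and> (\<forall>r<N. (\<Sum>j<N. A r j * a j) = 0)"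
        using less.hyps by (auto simp: R'_def R)
      from bchoice[OF this] obtain c where c: "\<And>i'. i' \<in> R' \<Longrightarrow> c i' i' \<noteq> 0"
        "\<And>i' j. i' \<in> R' \<Longrightarrow> j \<noteq> i' \<Longrightarrow> j \<notin> NR \<Longrightarrow> c i' j = 0"
        "\<And>i' r. i' \<in> R' \<Longrightarrow> r < N \<Longrightarrow> (\<Sum>j<N. A r j * c i' j) = 0" by auto
      have fin: "finite R'" by (auto simp: R'_def R)
      define d where "d j = (if j < N then a j - (\<Sum>i'\<in>R'. a i' / c i' i' * c i' j) else 0)" for j
      have "d i = a i"
      proof -
        have "c i' i = 0" if "i' \<in> R'" for i'
          using c(2)[OF that, of i] that less.prems by (auto simp: R'_def NR_def)
        then show ?thesis using less.prems by (simp add: d_def R)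
      qed
      moreover have "d j = 0" if "j \<notin> insert i NR" for j
      proof (cases "j < N")
        case True
        then have jR: "j \<in> R" "j \<noteq> i" using that by (auto simp: NR_def)
        have "(\<Sum>i'\<in>R'. a i' / c i' i' * c i' j) = (\<Sum>i'\<in>R'. if i' = j then a j else 0)"
          by (intro sum.cong) (use c(1,2) that in auto)
        also have "\<dots> = (if j \<in> R' then a j else 0)" using fin by simp
        also have "\<dots> = a j" using a(2)[of j] jR by (auto simp: R'_def)
        finally show ?thesis using True by (simp add: d_def)
      qed (simp add: d_def)
      moreover have "(\<Sum>j<N. A r j * d j) = 0" if r: "r < N" for r
      proof -
        have "(\<Sum>j<N. A r j * d j)
            = (\<Sum>j<N. A r j * a j) - (\<Sum>i'\<in>R'. a i' / c i' i' * (\<Sum>j<N. A r j * c i' j))"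
          unfolding sum_distrib_left
          by (subst sum.swap) (simp add: d_def algebra_simps sum_subtractf sum_distrib_left)
        also have "\<dots> = 0" using a(3)[OF r] c(3)[OF _ r] by simp
        finally show ?thesis .
      qed
      ultimately show ?case using a(1) by (intro exI[of _ d]) auto
    qed
    have "maximal (col_vec ` NR) (\<lambda>T. T \<subseteq> set (cols ?M) \<and> lin_indpt T)"
      unfolding maximal_def
    proof (intro conjI allI impI subNR indpt)
      fix T assume T: "col_vec ` NR \<subseteq> T \<and> T \<subseteq> set (cols ?M) \<and> lin_indpt T"
      show "T = col_vec ` NR"
      proof (rule ccontr)
        assume "T \<noteq> col_vec ` NR"
        then obtain x where x: "x \<in> T" "x \<notin> col_vec ` NR" using T by blast
        then have "x \<in> col_vec ` {..<N}" using T cols by blast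
        then obtain i where i: "i < N" "col_vec i \<in> T" "col_vec i \<notin> col_vec ` NR" using x by blast
        then have "i \<in> R" by (auto simp: NR_def)
        obtain a where a: "a i \<noteq> 0" "\<And>j. j \<notin> insert i NR \<Longrightarrow> a j = 0" "\<And>r. r < N \<Longrightarrow> (\<Sum>j<N. A r j * a j) = 0"
          using red[OF \<open>i \<in> R\<close>] by blast
        have "lin_dep (col_vec ` insert i NR)"
        proof (rule lin_dep_colsI[where a = a])
          show "inj_on col_vec (insert i NR)" using inj i(3) by (auto simp: inj_on_insert)
        qed (use a i(1) in \<open>auto simp: NR_def\<close>)
        moreover have "col_vec ` insert i NR \<subseteq> T" using T i(2) by auto
        ultimately have "lin_dep T" by (rule supset_ld_is_ld)
        then show False using T by blast
      qed
    qed
    from rank_card_indpt[OF M this] show "vec_space.rank N ?M = N - card R"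
      using card_image[OF inj] cardNR by simp
  qed
qed

end

section \<open>The recurrence at a regular singular point\<close>

text \<open>The expansion of \<open>(x - t)\<^sup>n\<^sup>-\<^sup>s\<^sup>+\<^sup>1 \<gamma>\<^sub>s\<close>.\<close>

definition laurent_fps :: "nat \<Rightarrow> (nat \<Rightarrow> int \<Rightarrow> real) \<Rightarrow> nat \<Rightarrow> real fps" where
  "laurent_fps n c s = Abs_fps (\<lambda>i. c s (int i - int (n - s + 1)))"

lemma Vcoeff_le:
  assumes "j \<le> k"
  shows "Vcoeff n c k j = (if j = k then falling_factorial k n else 0) -
    (\<Sum>s=1..n. falling_factorial j (n - s) * c (n - s + 1) (int k - int j - int s))"
  using assms by (simp add: Vcoeff_def)

lemma Vcoeff_gt: "k < j \<Longrightarrow> Vcoeff n c k j = 0"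
  by (simp add: Vcoeff_def)

text \<open>V is the matrix, on coefficients, of the scalar equation multiplied by (x - t)^n. The
  substitution s = n - q translates between orders of derivatives and the indexing of V.\<close>

lemma fuchs_relation_nth:
  "fps_nth (fps_X ^ n * (fps_deriv ^^ n) Y -
      (\<Sum>q<n. laurent_fps n c (Suc q) * (fps_X ^ q * (fps_deriv ^^ q) Y))) k
    = (\<Sum>j\<le>k. Vcoeff n c k j * fps_nth Y j)"
proof -
  have "fps_nth (laurent_fps n c (Suc q) * (fps_X ^ q * (fps_deriv ^^ q) Y)) k =
      (\<Sum>j\<le>k. falling_factorial j q * c (Suc q) (int k - int j - int (n - q)) * fps_nth Y j)"
    if "q < n" for q
  proof -
    have "fps_nth (laurent_fps n c (Suc q) * (fps_X ^ q * (fps_deriv ^^ q) Y)) k =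
        fps_nth ((fps_X ^ q * (fps_deriv ^^ q) Y) * laurent_fps n c (Suc q)) k"
      by (simp only: mult.commute)
    also have "\<dots> = (\<Sum>j\<le>k. falling_factorial j q * fps_nth Y j * c (Suc q) (int (k - j) - int (n - Suc q + 1)))"
      unfolding fps_mult_nth[of _ "laurent_fps n c (Suc q)"] fps_X_power_higher_deriv_nth
      by (simp add: laurent_fps_def atMost_atLeast0)
    also have "\<dots> = (\<Sum>j\<le>k. falling_factorial j q * c (Suc q) (int k - int j - int (n - q)) * fps_nth Y j)"
      using that by (intro sum.cong refl) (simp add: of_nat_diff Suc_diff_Suc)
    finally show ?thesis .
  qed
  then have "(\<Sum>q<n. fps_nth (laurent_fps n c (Suc q) * (fps_X ^ q * (fps_deriv ^^ q) Y)) k)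
      = (\<Sum>q<n. \<Sum>j\<le>k. falling_factorial j q * c (Suc q) (int k - int j - int (n - q)) * fps_nth Y j)"
    by (intro sum.cong refl) simp
  also have "\<dots> = (\<Sum>j\<le>k. (\<Sum>q<n. falling_factorial j q * c (Suc q) (int k - int j - int (n - q))) * fps_nth Y j)"
    by (subst sum.swap) (simp add: sum_distrib_right)
  also have "\<dots> = (\<Sum>j\<le>k. (\<Sum>s=1..n. falling_factorial j (n - s) * c (n - s + 1) (int k - int j - int s)) * fps_nth Y j)"
  proof -
    have "(\<Sum>q<n. falling_factorial j q * c (Suc q) (int k - int j - int (n - q))) =
        (\<Sum>s=1..n. falling_factorial j (n - s) * c (n - s + 1) (int k - int j - int s))" for j
      by (rule sum.reindex_bij_witness[of _ "\<lambda>s. n - s" "\<lambda>q. n - q"]) auto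
    then show ?thesis by (simp only:)
  qed
  finally have 1: "(\<Sum>q<n. fps_nth (laurent_fps n c (Suc q) * (fps_X ^ q * (fps_deriv ^^ q) Y)) k) = \<dots>" .
  have "(\<Sum>j\<le>k. Vcoeff n c k j * fps_nth Y j) =
      (\<Sum>j\<le>k. (if j = k then falling_factorial k n * fps_nth Y k else 0) -
        (\<Sum>s=1..n. falling_factorial j (n - s) * c (n - s + 1) (int k - int j - int s)) * fps_nth Y j)"
    by (intro sum.cong refl) (auto simp: Vcoeff_le left_diff_distrib)
  then show ?thesis
    by (simp only: fps_sub_nth fps_sum_nth fps_X_power_higher_deriv_nth 1 sum_subtractf) simp
qed

text \<open>In the basis of falling factorials the indicial polynomial has coefficient 1 at order n;
  with n + 1 roots this coefficient would be 0.\<close>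

lemma indicial_roots:
  assumes "finite K" "\<And>k. k \<in> K \<Longrightarrow> Vcoeff n c k k = 0"
  shows "card K \<le> n"
proof (rule ccontr)
  assume "\<not> card K \<le> n"
  define e where "e q = (if q = n then 1 else - c (Suc q) (- int (n - q)))" for q
  have "(\<Sum>q<Suc n. e q * falling_factorial k q) = Vcoeff n c k k" for k
  proof -
    have "(\<Sum>q<n. e q * falling_factorial k q) = (\<Sum>q<n. - (falling_factorial k q * c (Suc q) (- int (n - q))))"
      by (intro sum.cong refl) (simp add: e_def)
    also have "\<dots> = - (\<Sum>s=1..n. falling_factorial k (n - s) * c (n - s + 1) (- int s))"
      unfolding sum_negf
      by (intro arg_cong[where f = uminus] sum.reindex_bij_witness[of _ "\<lambda>s. n - s" "\<lambda>q. n - q"]) auto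
    finally show ?thesis by (simp add: e_def Vcoeff_def)
  qed
  then have "e n = 0"
    using falling_factorial_independent[of K "Suc n" e n] assms \<open>\<not> card K \<le> n\<close> by simp
  then show False by (simp add: e_def)
qed

lemma indicial_roots_eq:
  assumes "strict_mono_on {1..n} \<kappa>" "\<forall>i\<in>{1..n}. Vcoeff n c (\<kappa> i) (\<kappa> i) = 0"
  shows "Vcoeff n c k k = 0 \<longleftrightarrow> k \<in> \<kappa> ` {1..n}"
proof
  assume k: "Vcoeff n c k k = 0"
  show "k \<in> \<kappa> ` {1..n}"
  proof (rule ccontr)
    assume "k \<notin> \<kappa> ` {1..n}"
    moreover have "card (\<kappa> ` {1..n}) = n"
      using card_image[OF strict_mono_on_imp_inj_on[OF assms(1)]] by simp
    ultimately have "card (insert k (\<kappa> ` {1..n})) = Suc n" by simp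
    moreover have "card (insert k (\<kappa> ` {1..n})) \<le> n"
      by (rule indicial_roots[of _ n c]) (use assms(2) k in auto)
    ultimately show False by simp
  qed
qed (use assms(2) in auto)

text \<open>The superdiagonal entries are the values of the indicial polynomial strictly between the
  extreme roots. With column 0, standing for the smallest root, the exceptional columns correspond
  to the n - 1 roots below the largest, and the required rank is the minimal one in
  \<open>hessenberg_rank_iff\<close>.\<close>

lemma Vmatrix_rank_iff:
  assumes n: "n \<ge> 2" and mono: "strict_mono_on {1..n} \<kappa>"
    and root: "\<forall>i\<in>{1..n}. Vcoeff n c (\<kappa> i) (\<kappa> i) = 0"
  shows "int (real_mat_rank (Vmatrix n c (\<kappa> 1) (\<kappa> n))) = int (\<kappa> n) - int (\<kappa> 1) - int n + 1 \<longleftrightarrow>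
    (\<forall>i\<in>{1..<n}. \<exists>Y :: nat \<Rightarrow> real. Y (\<kappa> i) \<noteq> 0 \<and> (\<forall>j<\<kappa> i. Y j = 0) \<and>
       (\<forall>k\<le>\<kappa> n. (\<Sum>j\<le>k. Vcoeff n c k j * Y j) = 0))"
proof -
  let ?V = "Vcoeff n c"
  define p q N where "p = \<kappa> 1" and "q = \<kappa> n" and "N = q - p"
  define A where "A r j = ?V (p + 1 + r) (p + j)" for r j
  define R where "R = {j. j < N \<and> (j = 0 \<or> A (j - 1) j = 0)}"
  have less: "\<kappa> i < \<kappa> j" if "1 \<le> i" "i < j" "j \<le> n" for i j
    using strict_mono_onD[OF mono] that by auto
  have pq: "p < q" unfolding p_def q_def using less[of 1 n] n by simp
  have Vp: "?V p p = 0" and Vq: "?V q q = 0" using root n by (auto simp: p_def q_def)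
  have R_iff: "j \<in> R \<longleftrightarrow> j < N \<and> ?V (p + j) (p + j) = 0" for j
    using Vp by (cases j) (auto simp: R_def A_def)
  have \<kappa>_bounds: "p \<le> \<kappa> i" "\<kappa> i < q" if "i \<in> {1..<n}" for i
    using that less[of 1 i] less[of i n] by (cases "i = 1"; force simp: p_def q_def)+
  have R_eq: "R = (\<lambda>i. \<kappa> i - p) ` {1..<n}"
  proof (intro equalityI subsetI)
    fix j assume "j \<in> R"
    then have j: "j < N" "?V (p + j) (p + j) = 0" by (auto simp: R_iff)
    then obtain i where i: "i \<in> {1..n}" "p + j = \<kappa> i"
      using indicial_roots_eq[OF mono root, of "p + j"] by auto
    moreover have "i \<noteq> n" using i j(1) by (auto simp: N_def q_def)
    ultimately show "j \<in> (\<lambda>i. \<kappa> i - p) ` {1..<n}" by (intro image_eqI[of _ _ i]) auto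
  next
    fix j assume "j \<in> (\<lambda>i. \<kappa> i - p) ` {1..<n}"
    then obtain i where i: "i \<in> {1..<n}" "j = \<kappa> i - p" by auto
    then show "j \<in> R" using \<kappa>_bounds[OF i(1)] root by (auto simp: R_iff N_def)
  qed
  have "inj_on (\<lambda>i. \<kappa> i - p) {1..<n}"
  proof (rule linorder_inj_onI')
    fix i j assume "i \<in> {1..<n}" "j \<in> {1..<n}" "i < j"
    then show "\<kappa> i - p \<noteq> \<kappa> j - p" using less[of i j] \<kappa>_bounds(1)[of i] by auto
  qed
  then have cardR: "card R = n - 1" by (simp add: R_eq card_image)
  have cardR_le: "card R \<le> N"
    using card_mono[of "{..<N}" R] by (auto simp: R_def)
  have rank: "real_mat_rank (Vmatrix n c p q) = vec_space.rank N (Matrix.mat N N (\<lambda>(i, j). A i j))"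
    by (simp add: real_mat_rank_def Vmatrix_def N_def A_def)
  have arith: "int r = int q - int p - int n + 1 \<longleftrightarrow> r = N - card R" for r :: nat
    using cardR cardR_le pq n unfolding N_def by arith
  have "int (real_mat_rank (Vmatrix n c p q)) = int q - int p - int n + 1 \<longleftrightarrow>
      vec_space.rank N (Matrix.mat N N (\<lambda>(i, j). A i j)) = N - card R"
    unfolding rank by (rule arith)
  also have "\<dots> \<longleftrightarrow> (\<forall>i\<in>R. \<exists>a. a i \<noteq> 0 \<and> (\<forall>j<i. a j = 0) \<and> (\<forall>r<N. (\<Sum>j<N. A r j * a j) = 0))"
    by (rule hessenberg_rank_iff) (auto simp: A_def Vcoeff_gt R_def)
  also have "\<dots> \<longleftrightarrow> (\<forall>i\<in>{1..<n}. \<exists>a. a (\<kappa> i - p) \<noteq> 0 \<and> (\<forall>j<\<kappa> i - p. a j = 0) \<and>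
      (\<forall>r<N. (\<Sum>j<N. A r j * a j) = 0))"
    unfolding R_eq by (rule ball_simps(9))
  also have "\<dots> \<longleftrightarrow> (\<forall>i\<in>{1..<n}. \<exists>Y :: nat \<Rightarrow> real. Y (\<kappa> i) \<noteq> 0 \<and> (\<forall>j<\<kappa> i. Y j = 0) \<and>
       (\<forall>k\<le>q. (\<Sum>j\<le>k. ?V k j * Y j) = 0))"
  proof (intro ball_cong refl)
    fix i assume i: "i \<in> {1..<n}"
    \<comment> \<open>Column q is absent from the matrix: among rows k \<le> q only row q reaches
      it, and its entry there is 0 because q is a root.\<close>
    have rows: "(\<Sum>j\<le>k. ?V k j * Y j) = (\<Sum>j<N. A (k - p - 1) j * Y (p + j))"
      if Y: "\<And>j. j < p \<Longrightarrow> Y j = 0" and k: "p < k" "k \<le> q" for Y k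
    proof -
      have "(\<Sum>j\<le>k. ?V k j * Y j) = (\<Sum>j\<in>{p..<q}. ?V k j * Y j)"
      proof (rule sum.mono_neutral_cong)
        show "?V k j * Y j = 0" if "j \<in> {..k} - {p..<q}" for j
          using that k Y[of j] Vq by (cases "j < p"; cases "j = q") auto
        show "?V k j * Y j = 0" if "j \<in> {p..<q} - {..k}" for j
          using that by (auto simp: Vcoeff_gt)
      qed auto
      also have "\<dots> = (\<Sum>j<N. ?V k (p + j) * Y (p + j))"
        by (rule sum.reindex_bij_witness[of _ "\<lambda>j. p + j" "\<lambda>j. j - p"]) (auto simp: N_def)
      also have "\<dots> = (\<Sum>j<N. A (k - p - 1) j * Y (p + j))"
        using k by (simp add: A_def)
      finally show ?thesis .
    qed
    show "(\<exists>a. a (\<kappa> i - p) \<noteq> 0 \<and> (\<forall>j<\<kappa> i - p. a j = 0) \<and> (\<forall>r<N. (\<Sum>j<N. A r j * a j) = 0)) \<longleftrightarrow>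
      (\<exists>Y :: nat \<Rightarrow> real. Y (\<kappa> i) \<noteq> 0 \<and> (\<forall>j<\<kappa> i. Y j = 0) \<and> (\<forall>k\<le>q. (\<Sum>j\<le>k. ?V k j * Y j) = 0))"
      (is "?L \<longleftrightarrow> ?R")
    proof
      assume ?L
      then obtain a where a: "a (\<kappa> i - p) \<noteq> 0" "\<forall>j<\<kappa> i - p. a j = 0"
        "\<forall>r<N. (\<Sum>j<N. A r j * a j) = 0" by (elim exE conjE)
      define Y where "Y j = (if j < p then 0 else a (j - p))" for j
      have "(\<Sum>j\<le>k. ?V k j * Y j) = 0" if "k \<le> q" for k
      proof (cases "p < k")
        case True
        have "(\<Sum>j\<le>k. ?V k j * Y j) = (\<Sum>j<N. A (k - p - 1) j * Y (p + j))"
          by (rule rows) (use True that in \<open>auto simp: Y_def\<close>)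
        also have "\<dots> = 0" using a(3) True that by (auto simp: Y_def N_def)
        finally show ?thesis .
      next
        case False
        then show ?thesis using Vp by (intro sum.neutral) (auto simp: Y_def not_less le_less)
      qed
      moreover have "Y (\<kappa> i) \<noteq> 0" "\<forall>j<\<kappa> i. Y j = 0"
        using a(1,2) \<kappa>_bounds[OF i] by (auto simp: Y_def)
      ultimately show ?R by (intro exI[of _ Y]) simp
    next
      assume ?R
      then obtain Y :: "nat \<Rightarrow> real" where Y: "Y (\<kappa> i) \<noteq> 0" "\<forall>j<\<kappa> i. Y j = 0"
        "\<forall>k\<le>q. (\<Sum>j\<le>k. ?V k j * Y j) = 0" by (elim exE conjE)
      have "(\<Sum>j<N. A r j * Y (p + j)) = 0" if "r < N" for r
      proof -
        have "(\<Sum>j<N. A (p + 1 + r - p - 1) j * Y (p + j)) = (\<Sum>j\<le>p + 1 + r. ?V (p + 1 + r) j * Y j)"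
          by (rule rows[symmetric]) (use that Y(2) \<kappa>_bounds[OF i] in \<open>auto simp: N_def\<close>)
        also have "\<dots> = 0" by (rule Y(3)[rule_format]) (use that in \<open>simp add: N_def\<close>)
        finally show ?thesis by simp
      qed
      then show ?L using Y(1,2) \<kappa>_bounds[OF i]
        by (intro exI[of _ "\<lambda>j. Y (p + j)"]) auto
    qed
  qed
  finally show ?thesis by (simp only: p_def q_def)
qed

lemma fuchs_extend:
  fixes Z :: "nat \<Rightarrow> real"
  assumes init: "\<And>k. k \<le> q \<Longrightarrow> (\<Sum>j\<le>k. Vcoeff n c k j * Z j) = 0"
    and nonroot: "\<And>k. q < k \<Longrightarrow> Vcoeff n c k k \<noteq> 0"
  shows "\<exists>Y. (\<forall>j\<le>q. Y j = Z j) \<and> (\<forall>k. (\<Sum>j\<le>k. Vcoeff n c k j * Y j) = 0)"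
proof -
  have "\<exists>Y. \<forall>k. Y k = (if k \<le> q then Z k else - (\<Sum>j<k. Vcoeff n c k j * Y j) / Vcoeff n c k k)"
    by (rule dependent_wellorder_choice) auto
  then obtain Y where Y: "\<And>k. Y k = (if k \<le> q then Z k else - (\<Sum>j<k. Vcoeff n c k j * Y j) / Vcoeff n c k k)"
    by blast
  have "(\<Sum>j\<le>k. Vcoeff n c k j * Y j) = 0" for k
  proof (cases "k \<le> q")
    case True
    then have "(\<Sum>j\<le>k. Vcoeff n c k j * Y j) = (\<Sum>j\<le>k. Vcoeff n c k j * Z j)"
      by (intro sum.cong refl) (subst Y, simp)
    then show ?thesis using init[OF True] by simp
  next
    case False
    then have "Vcoeff n c k k * Y k = - (\<Sum>j<k. Vcoeff n c k j * Y j)"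
      using nonroot[of k] by (subst Y) simp
    then show ?thesis by (simp flip: lessThan_Suc_atMost)
  qed
  moreover have "Y j = Z j" if "j \<le> q" for j using that by (subst Y) simp
  ultimately show ?thesis by (intro exI[of _ Y]) simp
qed

section \<open>Convergence of formal solutions at a singular point\<close>

lemma falling_factorial_nonneg: "falling_factorial k q \<ge> 0"
proof (cases "q \<le> k")
  case True
  then show ?thesis unfolding falling_factorial_def by (intro prod_nonneg) auto
next
  case False
  then have "falling_factorial k q = 0" unfolding falling_factorial_def by (auto intro!: bexI[of _ k])
  then show ?thesis by simp
qed

lemma falling_factorial_le_power: "falling_factorial k q \<le> real k ^ q"
proof (cases "q \<le> k")
  case True
  then have "falling_factorial k q \<le> (\<Prod>i<q. real k)"
    unfolding falling_factorial_def by (intro prod_mono) auto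
  then show ?thesis by simp
next
  case False
  then have "falling_factorial k q = 0" unfolding falling_factorial_def by (auto intro!: bexI[of _ k])
  then show ?thesis by simp
qed

lemma falling_factorial_ge_power:
  assumes "2 * q \<le> k"
  shows "(real k / 2) ^ q \<le> falling_factorial k q"
proof -
  have "(\<Prod>i<q. real k / 2) \<le> falling_factorial k q"
    unfolding falling_factorial_def
  proof (intro prod_mono conjI)
    fix i assume "i \<in> {..<q}"
    then have "2 * i \<le> k" using assms by simp
    then have "real (2 * i) \<le> real k" by (simp only: of_nat_le_iff)
    then show "real k / 2 \<le> real k - real i" by simp
  qed simp
  then show ?thesis by simp
qed

text \<open>For k \<ge> 2 n the leading factor is at least (k / 2)^n, while each of the n other
  terms grows at most like k^(n-1) times a convolution. Cancelling k^(n-1) leaves the hypothesis of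
  \<open>recurrence_geometric_bound\<close> with constant 2^n n B.\<close>

lemma fuchs_convergent:
  fixes Y :: "real fps"
  assumes n: "n \<ge> 1" and rad: "\<And>q. q < n \<Longrightarrow> fps_conv_radius (laurent_fps n c (Suc q)) > 0"
    and rel: "fps_X ^ n * (fps_deriv ^^ n) Y = (\<Sum>q<n. laurent_fps n c (Suc q) * (fps_X ^ q * (fps_deriv ^^ q) Y))"
  shows "fps_conv_radius Y > 0"
proof -
  obtain B R where BR: "B > 0" "R \<ge> 1"
    "\<And>q i. q \<in> {..<n} \<Longrightarrow> \<bar>fps_nth (laurent_fps n c (Suc q)) i\<bar> \<le> B * R ^ i"
    by (rule fps_conv_radius_pos_bound_family[of "{..<n}" "\<lambda>q. laurent_fps n c (Suc q)"])
      (use rad in auto)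
  define a where "a k = \<bar>fps_nth Y k\<bar>" for k
  have "real k * a k \<le> (2 ^ n * (real n * B)) * (\<Sum>j\<le>k. R ^ (k - j) * a j)" if k: "k \<ge> 2 * n" for k
  proof -
    let ?K = "real k ^ (n - 1)"
    have k1: "k \<ge> 1" using k n by linarith
    have "falling_factorial k n * fps_nth Y k =
        (\<Sum>q<n. \<Sum>j\<le>k. falling_factorial j q * fps_nth Y j * fps_nth (laurent_fps n c (Suc q)) (k - j))"
    proof -
      have "falling_factorial k n * fps_nth Y k = fps_nth (fps_X ^ n * (fps_deriv ^^ n) Y) k"
        by (rule fps_X_power_higher_deriv_nth[symmetric])
      also have "\<dots> = (\<Sum>q<n. fps_nth ((fps_X ^ q * (fps_deriv ^^ q) Y) * laurent_fps n c (Suc q)) k)"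
        unfolding rel fps_sum_nth by (simp only: mult.commute)
      also have "\<dots> = (\<Sum>q<n. \<Sum>j\<le>k. falling_factorial j q * fps_nth Y j * fps_nth (laurent_fps n c (Suc q)) (k - j))"
        unfolding fps_mult_nth[of _ "laurent_fps n c _"] fps_X_power_higher_deriv_nth
        by (simp add: atMost_atLeast0)
      finally show ?thesis .
    qed
    then have "falling_factorial k n * a k =
        \<bar>\<Sum>q<n. \<Sum>j\<le>k. falling_factorial j q * fps_nth Y j * fps_nth (laurent_fps n c (Suc q)) (k - j)\<bar>"
      unfolding a_def using falling_factorial_nonneg[of k n] by (metis abs_mult abs_of_nonneg)
    also have "\<dots> \<le> (\<Sum>q<n. \<Sum>j\<le>k. ?K * a j * (B * R ^ (k - j)))"
    proof (intro order_trans[OF sum_abs] sum_mono)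
      fix q j assume q: "q \<in> {..<n}" and j: "j \<in> {..k}"
      have "falling_factorial j q \<le> real j ^ q" by (rule falling_factorial_le_power)
      also have "\<dots> \<le> real k ^ q" using j by (intro power_mono) auto
      also have "\<dots> \<le> ?K" using q k1 by (intro power_increasing) auto
      finally show "\<bar>falling_factorial j q * fps_nth Y j * fps_nth (laurent_fps n c (Suc q)) (k - j)\<bar>
          \<le> ?K * a j * (B * R ^ (k - j))"
        unfolding abs_mult a_def using BR falling_factorial_nonneg[of j q] q
        by (intro mult_mono) auto
    qed
    also have "\<dots> = ?K * (real n * B * (\<Sum>j\<le>k. R ^ (k - j) * a j))"
      by (simp add: sum_distrib_left ac_simps)
    finally have 1: "falling_factorial k n * a k \<le> ?K * (real n * B * (\<Sum>j\<le>k. R ^ (k - j) * a j))" .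
    have "?K * (real k * a k) = 2 ^ n * ((real k / 2) ^ n * a k)"
      using n by (simp add: power_divide power_eq_if[of "real k" n])
    also have "\<dots> \<le> 2 ^ n * (falling_factorial k n * a k)"
      using falling_factorial_ge_power[OF k] by (intro mult_left_mono mult_right_mono) (auto simp: a_def)
    also have "\<dots> \<le> 2 ^ n * (?K * (real n * B * (\<Sum>j\<le>k. R ^ (k - j) * a j)))"
      using 1 by simp
    finally have "?K * (real k * a k) \<le> ?K * ((2 ^ n * (real n * B)) * (\<Sum>j\<le>k. R ^ (k - j) * a j))"
      by (simp add: ac_simps)
    then show ?thesis using k1 by (subst (asm) mult_le_cancel_left_pos) auto
  qed
  moreover have "2 ^ n * (real n * B) > 0" using BR n by simp
  moreover have "a k \<ge> 0" for k by (simp add: a_def)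
  ultimately have "\<exists>D Q. Q > 0 \<and> (\<forall>k. a k \<le> D * Q ^ k)"
    by (intro recurrence_geometric_bound[of a R "2 ^ n * (real n * B)" "2 * n"] BR(2))
  then obtain D Q where "Q > 0" "\<forall>k. a k \<le> D * Q ^ k" by (elim exE conjE)
  then show ?thesis by (intro fps_conv_radius_posI[of Q _ D]) (auto simp: a_def)
qed

section \<open>Laurent expansions as power series\<close>

lemma expands_at_cancel_power:
  assumes "expands_at S (\<lambda>x. (x - t) ^ m * f x) t (fps_X ^ m * F)" "fps_conv_radius F > 0"
  shows "expands_at S f t F"
proof -
  have F: "expands_at S (\<lambda>x. eval_fps F (x - t)) t F" using assms(2) by (simp add: expands_at_def)
  have "expands_at S (\<lambda>x. (x - t) ^ m * f x - (x - t) ^ m * eval_fps F (x - t)) t 0"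
    using expands_at_diff[OF assms(1) expands_at_mult[OF expands_at_power[of S t m] F]] by simp
  then have "\<forall>\<^sub>F x in at t within S. (x - t) ^ m * f x - (x - t) ^ m * eval_fps F (x - t) = 0"
    by (simp add: expands_at_def)
  moreover have "\<forall>\<^sub>F x in at t within S. x \<noteq> t" by (auto simp: eventually_at_filter)
  ultimately have "\<forall>\<^sub>F x in at t within S. f x = eval_fps F (x - t)"
    by eventually_elim auto
  then show ?thesis using assms(2) by (simp add: expands_at_def)
qed

lemma laurent_expansion_iff:
  assumes "at t within S \<noteq> bot"
  shows "laurent_expansion S f t m c \<longleftrightarrow>
    expands_at S (\<lambda>x. (x - t) ^ m * f x) t (Abs_fps (\<lambda>i. c (int i - int m)))"
proof
  assume "laurent_expansion S f t m c"
  then obtain r where r: "r > 0" "\<And>x. x \<in> S \<Longrightarrow> 0 < \<bar>x - t\<bar> \<Longrightarrow> \<bar>x - t\<bar> < r \<Longrightarrow>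
      (\<lambda>i::nat. c (int i - int m) * (x - t) powi (int i - int m)) sums f x"
    unfolding laurent_expansion_def by auto
  show "expands_at S (\<lambda>x. (x - t) ^ m * f x) t (Abs_fps (\<lambda>i. c (int i - int m)))"
  proof (rule expands_at_power_series[OF r(1) _ assms])
    fix x assume x: "x \<in> S" "x \<noteq> t" "\<bar>x - t\<bar> < r"
    have "(\<lambda>i. (x - t) ^ m * (c (int i - int m) * (x - t) powi (int i - int m))) sums ((x - t) ^ m * f x)"
      by (intro sums_mult r) (use x in auto)
    moreover have "(x - t) ^ m * (c (int i - int m) * (x - t) powi (int i - int m)) =
        c (int i - int m) * (x - t) ^ i" for i
      using x(2) by (simp add: power_int_diff)
    ultimately show "(\<lambda>i. c (int i - int m) * (x - t) ^ i) sums ((x - t) ^ m * f x)" by simp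
  qed
next
  assume ex: "expands_at S (\<lambda>x. (x - t) ^ m * f x) t (Abs_fps (\<lambda>i. c (int i - int m)))"
    (is "expands_at _ _ _ ?F")
  then have rad: "fps_conv_radius ?F > 0" by (simp add: expands_at_def)
  from ex have "\<forall>\<^sub>F x in at t within S. (x - t) ^ m * f x = eval_fps ?F (x - t)"
    by (simp add: expands_at_def)
  moreover have "\<forall>\<^sub>F x in at t within S. x \<noteq> t" by (auto simp: eventually_at_filter)
  ultimately have "\<forall>\<^sub>F x in at t within S. (\<lambda>i::nat. c (int i - int m) * (x - t) powi (int i - int m)) sums f x"
    using eventually_in_conv_radius[OF rad, of t S]
  proof eventually_elim
    case (elim x)
    have "(\<lambda>i. c (int i - int m) * (x - t) ^ i) sums ((x - t) ^ m * f x)"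
      using sums_eval_fps[OF elim(3)] elim(1) by simp
    then have "(\<lambda>i. c (int i - int m) * (x - t) ^ i / (x - t) ^ m) sums ((x - t) ^ m * f x / (x - t) ^ m)"
      by (rule sums_divide)
    moreover have "c (int i - int m) * (x - t) ^ i / (x - t) ^ m =
        c (int i - int m) * (x - t) powi (int i - int m)" for i
      using elim(2) by (simp add: power_int_diff)
    ultimately show ?case using elim(2) by simp
  qed
  from eventually_at_within_realD[OF this] show "laurent_expansion S f t m c"
    unfolding laurent_expansion_def by auto
qed

section \<open>The scalar equation and its companion system\<close>

text \<open>The second clause records that a pole has a nonzero principal part, which shows up as a
  nonzero coefficient below m. It is contradicted later if the Wronskian matrix is assumed
  invertible at a pole.\<close>

lemma meromorphic_local_expansion:
  assumes "real_meromorphic_on S f" "t \<in> S" "at t within S \<noteq> bot"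
  shows "\<exists>m F. expands_at S (\<lambda>x. (x - t) ^ m * f x) t F \<and>
    (real_pole_at S f t \<longrightarrow> (\<exists>k<m. fps_nth F k \<noteq> 0))"
proof (cases "real_pole_at S f t")
  case True
  then obtain m c where m: "m > 0" "c (- int m) \<noteq> 0" "laurent_expansion S f t m c"
    unfolding real_pole_at_def by blast
  then show ?thesis
    using laurent_expansion_iff[OF assms(3), of f m c]
    by (intro exI[of _ m] exI[of _ "Abs_fps (\<lambda>i. c (int i - int m))"]) (auto intro!: exI[of _ 0])
next
  case False
  then have "real_analytic_at S f t"
    using assms(1,2) unfolding real_meromorphic_on_def by blast
  then obtain F where "expands_at S f t F" by (rule real_analytic_atE[OF _ assms(2,3)])
  then show ?thesis using False by (intro exI[of _ 0] exI[of _ F]) simp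
qed

lemma meromorphic_common_order:
  assumes mero: "\<And>s. s \<in> I \<Longrightarrow> real_meromorphic_on S (f s)" and "finite I"
    and t: "t \<in> S" "at t within S \<noteq> bot"
  shows "\<exists>m F. \<forall>s\<in>I. expands_at S (\<lambda>x. (x - t) ^ m * f s x) t (F s) \<and>
    (real_pole_at S (f s) t \<longrightarrow> (\<exists>k<m. fps_nth (F s) k \<noteq> 0))"
proof -
  have "\<forall>s\<in>I. \<exists>p. expands_at S (\<lambda>x. (x - t) ^ fst p * f s x) t (snd p) \<and>
    (real_pole_at S (f s) t \<longrightarrow> (\<exists>k<fst p. fps_nth (snd p) k \<noteq> 0))"
    using meromorphic_local_expansion[OF mero t] by simp
  from bchoice[OF this] obtain p where p: "\<And>s. s \<in> I \<Longrightarrow> expands_at S (\<lambda>x. (x - t) ^ fst (p s) * f s x) t (snd (p s))"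
    "\<And>s. s \<in> I \<Longrightarrow> real_pole_at S (f s) t \<Longrightarrow> \<exists>k<fst (p s). fps_nth (snd (p s)) k \<noteq> 0" by auto
  define m where "m = (\<Sum>s\<in>I. fst (p s))"
  have le: "fst (p s) \<le> m" if "s \<in> I" for s
    unfolding m_def using that \<open>finite I\<close> by (intro member_le_sum) auto
  show ?thesis
  proof (rule exI[of _ m], rule exI[of _ "\<lambda>s. fps_X ^ (m - fst (p s)) * snd (p s)"], intro ballI conjI impI)
    fix s assume s: "s \<in> I"
    have "(x - t) ^ m = (x - t) ^ (m - fst (p s)) * (x - t) ^ fst (p s)" for x
      using le[OF s] by (simp flip: power_add)
    then show "expands_at S (\<lambda>x. (x - t) ^ m * f s x) t (fps_X ^ (m - fst (p s)) * snd (p s))"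
      using expands_at_mult[OF expands_at_power[of S t "m - fst (p s)"] p(1)[OF s]]
      by (simp add: mult.assoc)
    assume "real_pole_at S (f s) t"
    then obtain k where "k < fst (p s)" "fps_nth (snd (p s)) k \<noteq> 0" using p(2)[OF s] by blast
    then show "\<exists>k<m. fps_nth (fps_X ^ (m - fst (p s)) * snd (p s)) k \<noteq> 0"
      using le[OF s] by (intro exI[of _ "k + (m - fst (p s))"]) (auto simp: fps_X_power_mult_nth)
  qed
qed

lemma fps_conv_radius_higher_deriv:
  fixes Y :: "real fps"
  assumes "fps_conv_radius Y > 0"
  shows "fps_conv_radius ((fps_deriv ^^ j) Y) > 0"
  using assms by (induction j) (auto intro: less_le_trans[OF _ fps_conv_radius_deriv])

locale companion =
  fixes n :: nat and \<gamma> :: "nat \<Rightarrow> real \<Rightarrow> real" and \<alpha> \<beta> :: real and P :: "real set"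
  assumes n_pos: "n \<ge> 1" and less: "\<alpha> < \<beta>" and finite_poles: "finite P"
    and poles: "\<And>t. t \<in> P \<Longrightarrow> \<exists>s\<in>{1..n}. real_pole_at {\<alpha>..\<beta>} (\<gamma> s) t"
    and analytic: "\<And>t s. t \<in> {\<alpha>..\<beta>} \<Longrightarrow> t \<notin> P \<Longrightarrow> s \<in> {1..n} \<Longrightarrow> real_analytic_at {\<alpha>..\<beta>} (\<gamma> s) t"
    and meromorphic: "\<And>s. s \<in> {1..n} \<Longrightarrow> real_meromorphic_on {\<alpha>..\<beta>} (\<gamma> s)"
begin

text \<open>The system satisfied by the row \<open>(y, y', \<dots>, y\<^sup>(\<^sup>n\<^sup>-\<^sup>1\<^sup>))\<close>.\<close>

definition M :: "nat \<Rightarrow> nat \<Rightarrow> real \<Rightarrow> real" where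
  "M k j x = (if Suc j < n then (if k = Suc j then 1 else 0) else \<gamma> (Suc k) x)"

sublocale linear_system n M \<alpha> \<beta> P
proof
  fix t k j assume "t \<in> {\<alpha>..\<beta>}" "t \<notin> P" "k < n" "j < n"
  then show "real_analytic_at {\<alpha>..\<beta>} (M k j) t"
    using real_analytic_at_const[of "{\<alpha>..\<beta>}"] analytic[of t "Suc k"]
    unfolding M_def by (cases "Suc j < n"; cases "k = Suc j") auto
qed (use less finite_poles in auto)

lemma companion_sum:
  assumes "j < n"
  shows "(\<Sum>k<n. y k * M k j x) = (if Suc j < n then y (Suc j) else \<Sum>k<n. y k * \<gamma> (Suc k) x)"
proof (cases "Suc j < n")
  case True
  then have "(\<Sum>k<n. y k * M k j x) = (\<Sum>k<n. if k = Suc j then y k else 0)"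
    by (intro sum.cong) (auto simp: M_def)
  then show ?thesis using True by simp
qed (simp add: M_def)

text \<open>The rank condition supplies the coefficients up to the largest root for the solutions
  starting at smaller roots; all roots are among the \<kappa> i, so the recurrence extends them
  further.\<close>

lemma fuchs_solutions:
  assumes laurent: "\<forall>s\<in>{1..n}. laurent_expansion S (\<gamma> s) t (n - s + 1) (c s)" and t: "t \<in> S"
    and mono: "strict_mono_on {1..n} \<kappa>" and root: "\<forall>i\<in>{1..n}. Vcoeff n c (\<kappa> i) (\<kappa> i) = 0"
    and rank: "n \<ge> 2 \<longrightarrow> int (real_mat_rank (Vmatrix n c (\<kappa> 1) (\<kappa> n))) = int (\<kappa> n) - int (\<kappa> 1) - int n + 1"
    and i: "i \<in> {1..n}"
  shows "\<exists>Y. fps_nth Y (\<kappa> i) \<noteq> 0 \<and> (\<forall>j<\<kappa> i. fps_nth Y j = 0) \<and> fps_conv_radius Y > 0 \<and>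
    fps_X ^ n * (fps_deriv ^^ n) Y = (\<Sum>q<n. laurent_fps n c (Suc q) * (fps_X ^ q * (fps_deriv ^^ q) Y))"
proof -
  have below: "\<kappa> i \<le> \<kappa> n" if "i \<in> {1..n}" for i
    using strict_mono_onD[OF mono, of i n] that by (cases "i = n") auto
  have "\<exists>Z :: nat \<Rightarrow> real. Z (\<kappa> i) \<noteq> 0 \<and> (\<forall>j<\<kappa> i. Z j = 0) \<and>
      (\<forall>k\<le>\<kappa> n. (\<Sum>j\<le>k. Vcoeff n c k j * Z j) = 0)"
  proof (cases "i = n")
    case True
    \<comment> \<open>For the largest root a single entry suffices: it is met only by row \<kappa>
      n, where its coefficient V is 0.\<close>
    define Z :: "nat \<Rightarrow> real" where "Z j = (if j = \<kappa> n then 1 else 0)" for j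
    have "(\<Sum>j\<le>k. Vcoeff n c k j * Z j) = 0" if "k \<le> \<kappa> n" for k
      using that root n_pos by (intro sum.neutral) (auto simp: Z_def)
    then show ?thesis using True by (intro exI[of _ Z]) (auto simp: Z_def)
  next
    case False
    then have "n \<ge> 2" "i \<in> {1..<n}" using i by auto
    then show ?thesis using Vmatrix_rank_iff[OF \<open>n \<ge> 2\<close> mono root] rank by blast
  qed
  then obtain Z :: "nat \<Rightarrow> real" where Z: "Z (\<kappa> i) \<noteq> 0" "\<forall>j<\<kappa> i. Z j = 0"
    "\<forall>k\<le>\<kappa> n. (\<Sum>j\<le>k. Vcoeff n c k j * Z j) = 0" by (elim exE conjE)
  have nonroot: "Vcoeff n c k k \<noteq> 0" if "\<kappa> n < k" for k
    using indicial_roots_eq[OF mono root, of k] below that by force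
  have "\<exists>Y. (\<forall>j\<le>\<kappa> n. Y j = Z j) \<and> (\<forall>k. (\<Sum>j\<le>k. Vcoeff n c k j * Y j) = 0)"
    by (rule fuchs_extend) (use Z(3) nonroot in simp_all)
  then obtain Y where Y: "\<forall>j\<le>\<kappa> n. Y j = Z j" "\<forall>k. (\<Sum>j\<le>k. Vcoeff n c k j * Y j) = 0"
    by (elim exE conjE)
  have rel: "fps_X ^ n * (fps_deriv ^^ n) (Abs_fps Y) =
      (\<Sum>q<n. laurent_fps n c (Suc q) * (fps_X ^ q * (fps_deriv ^^ q) (Abs_fps Y)))"
  proof (rule fps_ext)
    fix k
    show "fps_nth (fps_X ^ n * (fps_deriv ^^ n) (Abs_fps Y)) k =
      fps_nth (\<Sum>q<n. laurent_fps n c (Suc q) * (fps_X ^ q * (fps_deriv ^^ q) (Abs_fps Y))) k"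
      using fuchs_relation_nth[of n "Abs_fps Y" c k] Y(2)[rule_format, of k] by simp
  qed
  have "fps_conv_radius (laurent_fps n c (Suc q)) > 0" if "q < n" for q
    using laurent that laurent_expansion_iff[OF nontriv[OF t], of "\<gamma> (Suc q)" "n - Suc q + 1" "c (Suc q)"]
    by (auto simp: laurent_fps_def expands_at_def)
  from fuchs_convergent[OF n_pos this rel] have "fps_conv_radius (Abs_fps Y) > 0" .
  then show ?thesis
    using rel Z(1,2) Y(1) below[OF i] by (intro exI[of _ "Abs_fps Y"]) auto
qed

lemma singular_local_full:
  assumes t: "t \<in> S" "t \<in> P"
    and laurent: "\<forall>s\<in>{1..n}. laurent_expansion S (\<gamma> s) t (n - s + 1) (c s)"
    and mono: "strict_mono_on {1..n} \<kappa>" and root: "\<forall>i\<in>{1..n}. Vcoeff n c (\<kappa> i) (\<kappa> i) = 0"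
    and rank: "n \<ge> 2 \<longrightarrow> int (real_mat_rank (Vmatrix n c (\<kappa> 1) (\<kappa> n))) = int (\<kappa> n) - int (\<kappa> 1) - int n + 1"
  shows "\<exists>r>0. full (S \<inter> {t - r<..<t + r})"
proof -
  have "\<forall>i\<in>{1..n}. \<exists>Y. fps_nth Y (\<kappa> i) \<noteq> 0 \<and> (\<forall>j<\<kappa> i. fps_nth Y j = 0) \<and> fps_conv_radius Y > 0 \<and>
    fps_X ^ n * (fps_deriv ^^ n) Y = (\<Sum>q<n. laurent_fps n c (Suc q) * (fps_X ^ q * (fps_deriv ^^ q) Y))"
    using fuchs_solutions[OF laurent t(1) mono root rank] by blast
  from bchoice[OF this] obtain Y where Y0: "\<forall>i\<in>{1..n}. fps_nth (Y i) (\<kappa> i) \<noteq> 0 \<and>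
    (\<forall>j<\<kappa> i. fps_nth (Y i) j = 0) \<and> fps_conv_radius (Y i) > 0 \<and>
    fps_X ^ n * (fps_deriv ^^ n) (Y i) =
      (\<Sum>q<n. laurent_fps n c (Suc q) * (fps_X ^ q * (fps_deriv ^^ q) (Y i)))" ..
  have Y: "\<And>i. i \<in> {1..n} \<Longrightarrow> fps_nth (Y i) (\<kappa> i) \<noteq> 0"
    "\<And>i j. i \<in> {1..n} \<Longrightarrow> j < \<kappa> i \<Longrightarrow> fps_nth (Y i) j = 0"
    "\<And>i. i \<in> {1..n} \<Longrightarrow> fps_conv_radius (Y i) > 0"
    "\<And>i. i \<in> {1..n} \<Longrightarrow> fps_X ^ n * (fps_deriv ^^ n) (Y i) =
      (\<Sum>q<n. laurent_fps n c (Suc q) * (fps_X ^ q * (fps_deriv ^^ q) (Y i)))"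
    using Y0 by simp_all
  define F where "F i j = (fps_deriv ^^ j) (Y (Suc i))" for i j
  have rad: "fps_conv_radius (F i j) > 0" if "i < n" for i j
    unfolding F_def using that by (intro fps_conv_radius_higher_deriv Y(3)) auto
  have ex: "expands_at S (\<lambda>x. eval_fps (F i j) (x - t)) t (F i j)" if "i < n" for i j
    using rad[OF that] by (simp add: expands_at_def)
  show ?thesis
  proof (rule local_full_fps[OF t(1) rad])
    fix i j assume ij: "i < n" "j < n"
    show "expands_at S (\<lambda>x. \<Sum>k<n. eval_fps (F i k) (x - t) * M k j x) t (fps_deriv (F i j))"
    proof (cases "Suc j < n")
      case True
      then show ?thesis using ex[OF ij(1), of "Suc j"] by (simp add: companion_sum ij F_def)
    next
      case False
      then have j: "n = Suc j" using ij by simp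
      \<comment> \<open>The factor (x - t)^n is split as (x - t)^k (x - t)^(n-k); the second part
        removes the pole of \<gamma> (Suc k), the first forms X^k D^k Y. The factor is cancelled at
        the end.\<close>
      have "expands_at S (\<lambda>x. \<Sum>k<n. ((x - t) ^ k * eval_fps (F i k) (x - t)) * ((x - t) ^ (n - k) * \<gamma> (Suc k) x)) t
          (\<Sum>k<n. (fps_X ^ k * F i k) * laurent_fps n c (Suc k))"
      proof (intro expands_at_sum expands_at_mult expands_at_power ex ij)
        fix k assume "k \<in> {..<n}"
        then have k: "Suc k \<in> {1..n}" "n - Suc k + 1 = n - k" by auto
        show "expands_at S (\<lambda>x. (x - t) ^ (n - k) * \<gamma> (Suc k) x) t (laurent_fps n c (Suc k))"
          using laurent k(1) laurent_expansion_iff[OF nontriv[OF t(1)], of "\<gamma> (Suc k)" "n - k" "c (Suc k)"]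
          unfolding laurent_fps_def k(2)[symmetric] by simp
      qed
      also have "(\<Sum>k<n. (fps_X ^ k * F i k) * laurent_fps n c (Suc k)) = fps_X ^ n * (fps_deriv ^^ n) (Y (Suc i))"
        using Y(4)[of "Suc i"] ij by (simp add: F_def ac_simps)
      also have "(\<lambda>x. \<Sum>k<n. ((x - t) ^ k * eval_fps (F i k) (x - t)) * ((x - t) ^ (n - k) * \<gamma> (Suc k) x))
          = (\<lambda>x. (x - t) ^ n * (\<Sum>k<n. eval_fps (F i k) (x - t) * \<gamma> (Suc k) x))"
      proof (intro ext)
        fix x
        have "((x - t) ^ k * eval_fps (F i k) (x - t)) * ((x - t) ^ (n - k) * \<gamma> (Suc k) x)
            = (x - t) ^ n * (eval_fps (F i k) (x - t) * \<gamma> (Suc k) x)" if "k < n" for k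
        proof -
          have "(x - t) ^ n = (x - t) ^ k * (x - t) ^ (n - k)" using that by (simp flip: power_add)
          then show ?thesis by simp
        qed
        then show "(\<Sum>k<n. ((x - t) ^ k * eval_fps (F i k) (x - t)) * ((x - t) ^ (n - k) * \<gamma> (Suc k) x))
          = (x - t) ^ n * (\<Sum>k<n. eval_fps (F i k) (x - t) * \<gamma> (Suc k) x)"
          unfolding sum_distrib_left by (intro sum.cong) auto
      qed
      finally have "expands_at S (\<lambda>x. \<Sum>k<n. eval_fps (F i k) (x - t) * \<gamma> (Suc k) x) t
          ((fps_deriv ^^ n) (Y (Suc i)))"
        by (rule expands_at_cancel_power) (use ij in \<open>intro fps_conv_radius_higher_deriv Y(3); simp\<close>)
      moreover have "(\<Sum>k<n. eval_fps (F i k) (x - t) * M k j x) =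
          (\<Sum>k<n. eval_fps (F i k) (x - t) * \<gamma> (Suc k) x)" for x
        using companion_sum[OF ij(2), of "\<lambda>k. eval_fps (F i k) (x - t)" x] False by simp
      moreover have "fps_deriv (F i j) = (fps_deriv ^^ n) (Y (Suc i))" by (simp add: F_def j)
      ultimately show ?thesis by simp
    qed
  next
    show "Determinant.det (Matrix.mat n n (\<lambda>(i, j). F i j)) \<noteq> 0"
      unfolding F_def
    proof (rule wronskian_nonzero_distinct_orders[where \<kappa> = "\<lambda>i. \<kappa> (Suc i)"])
      show "inj_on (\<lambda>i. \<kappa> (Suc i)) {..<n}"
      proof (rule inj_onI)
        fix i j assume "i \<in> {..<n}" "j \<in> {..<n}" "\<kappa> (Suc i) = \<kappa> (Suc j)"
        then show "i = j"
          using inj_onD[OF strict_mono_on_imp_inj_on[OF mono], of "Suc i" "Suc j"] by simp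
      qed
      show "fps_nth (Y (Suc i)) l = 0" if "i < n" "l < \<kappa> (Suc i)" for i l
        using Y(2)[of "Suc i" l] that by simp
      show "fps_nth (Y (Suc i)) (\<kappa> (Suc i)) \<noteq> 0" if "i < n" for i
        using Y(1)[of "Suc i"] that by simp
    qed
  qed (use t in auto)
qed

end

section \<open>From global solutions to a control system\<close>

context companion
begin

text \<open>At a point of P the equation is not part of \<open>solves\<close>; it follows there
  because both components are analytic and their expansions are compared on a punctured
  neighbourhood.\<close>

lemma solves_derivative:
  assumes y: "solves S y" and t: "t \<in> S" and j: "Suc j < n"
  shows "(y j has_real_derivative y (Suc j) t) (at t within S)"
proof -
  have jn: "j < n" using j by simp
  obtain F where F: "expands_at S (y j) t F" "y j t = fps_nth F 0"
    using real_analytic_atE[OF _ t nontriv[OF t], of "y j"] y t jn unfolding solves_def by blast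
  obtain G where G: "expands_at S (y (Suc j)) t G" "y (Suc j) t = fps_nth G 0"
    using real_analytic_atE[OF _ t nontriv[OF t], of "y (Suc j)"] y t j unfolding solves_def by blast
  have "\<forall>\<^sub>F x in at t within S. x \<in> S \<inter> {\<alpha> - 1<..<\<beta> + 1} - P"
    by (rule eventually_in_interval) (use t finite_P in auto)
  then have "\<forall>\<^sub>F x in at t within S. (y j has_real_derivative y (Suc j) x) (at x within S)"
  proof eventually_elim
    case (elim x)
    then have "(y j has_real_derivative (\<Sum>k<n. y k x * M k j x)) (at x within S)"
      using y jn unfolding solves_def by blast
    then show ?case using j by (simp add: companion_sum[OF jn, of "\<lambda>k. y k x"])
  qed
  from expands_at_deriv[OF F(1) this nontriv] have "fps_deriv F = G"
    by (rule expands_at_unique[OF _ G(1) nontriv[OF t]])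
  then show ?thesis using expands_at_has_derivative_center[OF F t] G(2) by simp
qed

lemma DERIV_within_unique:
  assumes "(f has_real_derivative a) (at t within S)" "(f has_real_derivative b) (at t within S)" "t \<in> S"
  shows "a = b"
  by (rule vector_derivative_unique_within[OF nontriv[OF assms(3)]])
    (use assms(1,2) in \<open>simp_all add: has_real_derivative_iff_has_vector_derivative\<close>)

lemma solves_first_component_0:
  assumes y: "solves S y" and y0: "\<And>x. x \<in> S \<Longrightarrow> y 0 x = 0" and "t \<in> S" "j < n"
  shows "y j t = 0"
  using assms(3,4)
proof (induction j arbitrary: t)
  case (Suc j)
  have "(y j has_real_derivative 0) (at t within S)"
    by (rule has_field_derivative_transform_within[where d = 1, OF DERIV_const[of 0]])
      (use Suc in auto)
  then show ?case
    using DERIV_within_unique[OF _ solves_derivative[OF y] Suc.prems(1)] Suc.prems by metis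
qed (use y0 in simp)

text \<open>The solutions have the unit vectors as values at a nonexceptional p. A combination whose
  first component vanishes on S has all its components zero, since they are successive derivatives,
  and its values at p are the coefficients.\<close>

lemma independent_solutions:
  assumes "full S"
  shows "\<exists>y. (\<forall>i. solves S (y i)) \<and>
    (\<forall>c. (\<forall>x\<in>S. (\<Sum>i<n. c i * y i 0 x) = 0) \<longrightarrow> (\<forall>j<n. c j = 0))"
proof -
  obtain Q where Q: "finite Q" "\<forall>p\<in>S - Q. \<forall>v. \<exists>y. solves S y \<and> (\<forall>j<n. y j p = v j)"
    using assms unfolding full_def by blast
  have "infinite S" using less by (simp add: infinite_Icc)
  then obtain p where p: "p \<in> S" "p \<notin> Q" using Q(1) by (meson finite_subset subsetI)
  have "\<forall>i. \<exists>y. solves S y \<and> (\<forall>j<n. y j p = (if i = j then 1 else 0))"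
  proof
    show "\<exists>y. solves S y \<and> (\<forall>j<n. y j p = (if i = j then 1 else 0))" for i
      using Q(2)[rule_format, of p "\<lambda>j. if i = j then 1 else 0"] p by simp
  qed
  from choice[OF this] obtain y where y: "\<forall>i. solves S (y i) \<and> (\<forall>j<n. y i j p = (if i = j then 1 else 0))" ..
  show ?thesis
  proof (intro exI[of _ y] conjI allI impI)
    show "solves S (y i)" for i using y by blast
    fix c :: "nat \<Rightarrow> real" and j assume c: "\<forall>x\<in>S. (\<Sum>i<n. c i * y i 0 x) = 0" and j: "j < n"
    have "solves S (\<lambda>j x. \<Sum>i<n. c i * y i j x)" by (rule solves_sum) (use y in auto)
    from solves_first_component_0[OF this c[rule_format] p(1) j] have "(\<Sum>i<n. c i * y i j p) = 0" .
    moreover have "(\<Sum>i<n. c i * y i j p) = (\<Sum>i<n. if i = j then c j else 0)"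
      using y j by (intro sum.cong) auto
    ultimately show "c j = 0" using j by simp
  qed
qed

context
  fixes b :: "real \<Rightarrow> real Matrix.vec" and y :: "nat \<Rightarrow> nat \<Rightarrow> real \<Rightarrow> real"
  assumes solves_y: "\<forall>i. solves S (y i)" and b: "b = (\<lambda>t. Matrix.vec n (\<lambda>i. y i 0 t))"
    and indep: "\<forall>c. (\<forall>x\<in>S. (\<Sum>i<n. c i * y i 0 x) = 0) \<longrightarrow> (\<forall>j<n. c j = 0)"
begin

private abbreviation A :: "real \<Rightarrow> real mat" where "A \<equiv> \<lambda>_. 0\<^sub>m n n"

private lemma y: "solves S (y i)"
  using solves_y by blast

private lemma y_analytic: "i < n \<Longrightarrow> j < n \<Longrightarrow> t \<in> S \<Longrightarrow> real_analytic_at S (y i j) t"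
  using y unfolding solves_def by blast

lemma realization_analytic: "analytic_system n \<alpha> \<beta> A b"
  unfolding analytic_system_def real_analytic_on_def
proof (intro conjI ballI allI impI)
  show "real_analytic_at S (\<lambda>t. A t $$ (i, j)) t" if "i < n" "j < n" "t \<in> S" for i j t
    using real_analytic_at_const[of S 0 t] that by simp
  show "real_analytic_at S (\<lambda>t. b t $ i) t" if "i < n" "t \<in> S" for i t
    using y_analytic[of i 0 t] that by (simp add: b)
qed (simp_all add: b)

text \<open>With A = 0 the state is the initial state plus the integral of u b. A control u in the
  span of the y i 0 reduces the transfer to a linear system with their Gram matrix; a kernel vector
  c of it would give the square of the combination with coefficients c integral zero.\<close>

lemma realization_controllable: "controllable n \<alpha> \<beta> A b"
  unfolding controllable_def
proof (intro ballI)
  fix x0 x1 :: "real Matrix.vec" assume x: "x0 \<in> carrier_vec n" "x1 \<in> carrier_vec n"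
  have cont: "continuous_on S (y i 0)" if "i < n" for i
    using real_analytic_continuous_on[of S "y i 0"] y_analytic[OF that] nontriv n_pos by auto
  define G where "G i j = integral S (\<lambda>t. y i 0 t * y j 0 t)" for i j
  have int: "(\<lambda>t. y i 0 t * y j 0 t) integrable_on S" if "i < n" "j < n" for i j
    using cont[OF that(1)] cont[OF that(2)] by (intro integrable_continuous_real continuous_on_mult)
  have "Determinant.det (Matrix.mat n n (\<lambda>(i, j). G i j)) \<noteq> 0"
  proof
    assume "Determinant.det (Matrix.mat n n (\<lambda>(i, j). G i j)) = 0"
    then obtain c where c: "\<exists>j<n. c j \<noteq> 0" "\<And>i. i < n \<Longrightarrow> (\<Sum>j<n. G i j * c j) = 0"
      unfolding det_eq_0_iff_kernel by blast
    define f where "f t = (\<Sum>i<n. c i * y i 0 t)" for t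
    have contf: "continuous_on S f" unfolding f_def
      using cont by (intro continuous_on_sum continuous_on_mult continuous_on_const) auto
    have "((\<lambda>t. \<Sum>i<n. \<Sum>j<n. (c i * c j) * (y i 0 t * y j 0 t)) has_integral
        (\<Sum>i<n. \<Sum>j<n. (c i * c j) * G i j)) S"
      unfolding G_def using int
      by (intro has_integral_sum has_integral_mult_right integrable_integral) auto
    moreover have "(\<lambda>t. \<Sum>i<n. \<Sum>j<n. (c i * c j) * (y i 0 t * y j 0 t)) = (\<lambda>t. f t * f t)"
      unfolding f_def sum_product by (intro ext sum.cong refl) simp
    moreover have "(\<Sum>i<n. \<Sum>j<n. (c i * c j) * G i j) = (\<Sum>i<n. c i * (\<Sum>j<n. G i j * c j))"
      unfolding sum_distrib_left by (intro sum.cong refl) simp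
    ultimately have "((\<lambda>t. f t * f t) has_integral 0) S" using c(2) by simp
    then have "integral S (\<lambda>t. f t * f t) = 0" by (rule integral_unique)
    then have "\<forall>t\<in>S. f t * f t = 0"
      by (subst (asm) integral_eq_0_iff) (use less contf in \<open>auto intro!: continuous_on_mult\<close>)
    then have "\<forall>t\<in>S. (\<Sum>i<n. c i * y i 0 t) = 0" by (simp add: f_def)
    with indep[rule_format, of c] show False using c(1) by blast
  qed
  then obtain v where v: "\<And>j. j < n \<Longrightarrow> (\<Sum>i<n. v i * G i j) = x1 $ j - x0 $ j"
    using det_nonzero_solve[where v = "\<lambda>j. x1 $ j - x0 $ j"] by blast
  define u where "u t = (\<Sum>i<n. v i * y i 0 t)" for t
  define X where "X t = Matrix.vec n (\<lambda>j. x0 $ j + integral {\<alpha>..t} (\<lambda>\<tau>. u \<tau> * y j 0 \<tau>))" for t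
  have contu: "continuous_on S u" unfolding u_def
    using cont by (intro continuous_on_sum continuous_on_mult continuous_on_const) auto
  have "trajectory n \<alpha> \<beta> A b u X"
    unfolding trajectory_def
  proof (intro ballI conjI allI impI)
    fix t i assume t: "t \<in> {\<alpha>..\<beta>}" and i: "i < n"
    have "((\<lambda>\<tau>. x0 $ i + integral {\<alpha>..\<tau>} (\<lambda>\<tau>. u \<tau> * y i 0 \<tau>)) has_real_derivative 0 + u t * y i 0 t)
        (at t within S)"
      by (intro DERIV_add DERIV_const integral_has_real_derivative continuous_on_mult contu cont i t)
    then show "((\<lambda>\<tau>. X \<tau> $ i) has_real_derivative (A t *\<^sub>v X t + u t \<cdot>\<^sub>v b t) $ i) (at t within {\<alpha>..\<beta>})"
      using i by (simp add: X_def b)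
  qed (simp add: X_def)
  moreover have "X \<alpha> = x0" using x by (intro eq_vecI) (auto simp: X_def)
  moreover have "X \<beta> = x1"
  proof (rule eq_vecI)
    fix j assume "j < dim_vec x1"
    then have j: "j < n" using x by simp
    have "((\<lambda>t. \<Sum>i<n. v i * (y i 0 t * y j 0 t)) has_integral (\<Sum>i<n. v i * G i j)) S"
      unfolding G_def using int j
      by (intro has_integral_sum has_integral_mult_right integrable_integral) auto
    moreover have "(\<lambda>t. \<Sum>i<n. v i * (y i 0 t * y j 0 t)) = (\<lambda>t. u t * y j 0 t)"
      by (simp add: u_def sum_distrib_right mult.assoc)
    ultimately have "integral S (\<lambda>t. u t * y j 0 t) = x1 $ j - x0 $ j"
      using v[OF j] by (simp add: integral_unique)
    then show "X \<beta> $ j = x1 $ j" using j by (simp add: X_def)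
  qed (use x in \<open>simp add: X_def\<close>)
  ultimately show "\<exists>u x. continuous_on {\<alpha>..\<beta>} u \<and> trajectory n \<alpha> \<beta> A b u x \<and> x \<alpha> = x0 \<and> x \<beta> = x1"
    using contu by blast
qed

private lemma Delta_eq:
  assumes "k < n" "t \<in> S"
  shows "Delta n \<alpha> \<beta> A b k t = Matrix.vec n (\<lambda>i. y i k t)"
  using assms
proof (induction k arbitrary: t)
  case (Suc k)
  have D: "vector_derivative (\<lambda>\<tau>. Delta n \<alpha> \<beta> A b k \<tau> $ i) (at t within S) = y i (Suc k) t" if i: "i < n" for i
  proof (rule vector_derivative_within[OF nontriv[OF Suc.prems(2)]])
    have "((\<lambda>\<tau>. Delta n \<alpha> \<beta> A b k \<tau> $ i) has_real_derivative y i (Suc k) t) (at t within S)"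
      by (rule has_field_derivative_transform_within[where d = 1, OF solves_derivative[OF y Suc.prems(2,1)]])
        (use Suc i in simp_all)
    then show "((\<lambda>\<tau>. Delta n \<alpha> \<beta> A b k \<tau> $ i) has_vector_derivative y i (Suc k) t) (at t within S)"
      by (simp add: has_real_derivative_iff_has_vector_derivative)
  qed
  have "Delta n \<alpha> \<beta> A b k t \<in> carrier_vec n" using Suc by simp
  then show ?case using D by (intro eq_vecI) auto
qed (simp add: b)

private lemma Delta_last:
  assumes t: "t \<in> S" "t \<notin> P"
  shows "Delta n \<alpha> \<beta> A b n t = Matrix.vec n (\<lambda>i. \<Sum>k<n. y i k t * \<gamma> (Suc k) t)"
proof -
  obtain n' where n': "n = Suc n'" using n_pos by (cases n) auto
  have D: "vector_derivative (\<lambda>\<tau>. Delta n \<alpha> \<beta> A b n' \<tau> $ i) (at t within S) = (\<Sum>k<n. y i k t * \<gamma> (Suc k) t)"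
    if i: "i < n" for i
  proof (rule vector_derivative_within[OF nontriv[OF t(1)]])
    have "(y i n' has_real_derivative (\<Sum>k<n. y i k t * M k n' t)) (at t within S)"
      using y[of i] t n' unfolding solves_def by blast
    then have "(y i n' has_real_derivative (\<Sum>k<n. y i k t * \<gamma> (Suc k) t)) (at t within S)"
      using companion_sum[of n' "\<lambda>k. y i k t" t] n' by simp
    then have "((\<lambda>\<tau>. Delta n \<alpha> \<beta> A b n' \<tau> $ i) has_real_derivative (\<Sum>k<n. y i k t * \<gamma> (Suc k) t)) (at t within S)"
      by (rule has_field_derivative_transform_within[where d = 1])
        (use Delta_eq[of n'] n' i t(1) in simp_all)
    then show "((\<lambda>\<tau>. Delta n \<alpha> \<beta> A b n' \<tau> $ i) has_vector_derivative (\<Sum>k<n. y i k t * \<gamma> (Suc k) t)) (at t within S)"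
      by (simp add: has_real_derivative_iff_has_vector_derivative)
  qed
  have "Delta n \<alpha> \<beta> A b n' t \<in> carrier_vec n" using Delta_eq[of n' t] n' t(1) by simp
  then have "Delta n \<alpha> \<beta> A b (Suc n') t = Matrix.vec n (\<lambda>i. \<Sum>k<n. y i k t * \<gamma> (Suc k) t)"
    using D by (intro eq_vecI) auto
  then show ?thesis using n' by simp
qed

private lemma Kmat_eq:
  assumes "t \<in> S"
  shows "Kmat n \<alpha> \<beta> A b t = Matrix.mat n n (\<lambda>(i, k). y i k t)"
  unfolding Kmat_def using Delta_eq[OF _ assms]
  by (intro eq_matI) (auto simp: mat_of_cols_def)

text \<open>
  At a pole the relation between the solutions, multiplied by a power of \<open>x - t\<close>, would force
  all principal parts to vanish if the Wronskian matrix were invertible there.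
\<close>

private lemma Kmat_singular_at_pole:
  assumes t: "t \<in> S" "t \<in> P"
  shows "Determinant.det (Matrix.mat n n (\<lambda>(i, k). y i k t)) = 0"
proof (rule ccontr)
  assume det: "Determinant.det (Matrix.mat n n (\<lambda>(i, k). y i k t)) \<noteq> 0"
  have "\<exists>m u. \<forall>s\<in>{1..n}. expands_at S (\<lambda>x. (x - t) ^ m * \<gamma> s x) t (u s) \<and>
      (real_pole_at S (\<gamma> s) t \<longrightarrow> (\<exists>k<m. fps_nth (u s) k \<noteq> 0))"
    by (rule meromorphic_common_order[OF _ finite_atLeastAtMost t(1) nontriv[OF t(1)]]) (rule meromorphic)
  then obtain m u where mu0: "\<forall>s\<in>{1..n}. expands_at S (\<lambda>x. (x - t) ^ m * \<gamma> s x) t (u s) \<and>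
      (real_pole_at S (\<gamma> s) t \<longrightarrow> (\<exists>k<m. fps_nth (u s) k \<noteq> 0))"
    by (elim exE)
  have mu: "expands_at S (\<lambda>x. (x - t) ^ m * \<gamma> s x) t (u s)"
    "real_pole_at S (\<gamma> s) t \<Longrightarrow> \<exists>k<m. fps_nth (u s) k \<noteq> 0" if "s \<in> {1..n}" for s
    using mu0 that by blast+
  obtain n' where n': "n = Suc n'" using n_pos by (cases n) auto
  have "\<exists>F. \<forall>j\<in>{..<n}. expands_at S (y i j) t (F j) \<and> y i j t = fps_nth (F j) 0" if "i < n" for i
    by (rule bchoice) (use real_analytic_atE[OF y_analytic[OF that _ t(1)] t(1) nontriv[OF t(1)]] in \<open>metis lessThan_iff\<close>)
  then have "\<forall>i\<in>{..<n}. \<exists>F. \<forall>j\<in>{..<n}. expands_at S (y i j) t (F j) \<and> y i j t = fps_nth (F j) 0" by simp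
  from bchoice[OF this] obtain F where
    F0: "\<forall>i\<in>{..<n}. \<forall>j\<in>{..<n}. expands_at S (y i j) t (F i j) \<and> y i j t = fps_nth (F i j) 0" ..
  have F: "expands_at S (y i j) t (F i j)" "y i j t = fps_nth (F i j) 0" if "i < n" "j < n" for i j
    using F0 that by auto
  have "fps_nth (u (Suc j)) k = 0" if "k < m" "j < n" for j k
  proof (rule regular_relation_coeffs[of n F m "\<lambda>j. u (Suc j)" k j])
    fix c :: "nat \<Rightarrow> real" and j assume c: "\<And>i. i < n \<Longrightarrow> (\<Sum>j<n. c j * fps_nth (F i j) 0) = 0" and "j < n"
    have "(\<Sum>j<n. y i j t * c j) = 0" if "i < n" for i
      using c[OF that] F(2)[OF that] by (simp add: mult.commute)
    then show "c j = 0" using det \<open>j < n\<close> unfolding det_eq_0_iff_kernel by blast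
  next
    fix i k assume i: "i < n" and k: "k < m"
    have "\<forall>\<^sub>F x in at t within S. x \<in> S \<inter> {\<alpha> - 1<..<\<beta> + 1} - P"
      by (rule eventually_in_interval) (use t finite_P in auto)
    then have "\<forall>\<^sub>F x in at t within S. (y i n' has_real_derivative (\<Sum>k<n. y i k x * \<gamma> (Suc k) x)) (at x within S)"
    proof eventually_elim
      case (elim x)
      then have "(y i n' has_real_derivative (\<Sum>k<n. y i k x * M k n' x)) (at x within S)"
        using y[of i] n' unfolding solves_def by blast
      then show ?case using companion_sum[of n' "\<lambda>k. y i k x" x] n' by simp
    qed
    from expands_at_deriv[OF F(1)[OF i, of n'] this nontriv]
    have "expands_at S (\<lambda>x. \<Sum>k<n. y i k x * \<gamma> (Suc k) x) t (fps_deriv (F i n'))" using n' by simp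
    from expands_at_mult[OF expands_at_power[of S t m] this]
    have 1: "expands_at S (\<lambda>x. (x - t) ^ m * (\<Sum>k<n. y i k x * \<gamma> (Suc k) x)) t (fps_X ^ m * fps_deriv (F i n'))" .
    have 2: "expands_at S (\<lambda>x. \<Sum>k<n. ((x - t) ^ m * \<gamma> (Suc k) x) * y i k x) t (\<Sum>k<n. u (Suc k) * F i k)"
      using mu(1) F(1)[OF i] by (intro expands_at_sum expands_at_mult) auto
    have 3: "(\<lambda>x. \<Sum>k<n. ((x - t) ^ m * \<gamma> (Suc k) x) * y i k x) = (\<lambda>x. (x - t) ^ m * (\<Sum>k<n. y i k x * \<gamma> (Suc k) x))"
      unfolding sum_distrib_left by (simp add: ac_simps)
    \<comment> \<open>The n-th derivative of the solution is analytic at t, so the relation has no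
      coefficients below m.\<close>
    have "(\<Sum>k<n. u (Suc k) * F i k) = fps_X ^ m * fps_deriv (F i n')"
      by (rule expands_at_unique[OF 2[unfolded 3] 1 nontriv[OF t(1)]])
    then show "fps_nth (\<Sum>j<n. u (Suc j) * F i j) k = 0"
      using k by (simp add: fps_X_power_mult_nth)
  qed (use that in auto)
  moreover obtain s where s: "s \<in> {1..n}" "real_pole_at S (\<gamma> s) t" using poles[OF t(2)] by blast
  ultimately show False using mu(2)[OF s] by (cases s) auto
qed

text \<open>A point with invertible K is not a pole, so the scalar equation holds there and reads
  \<Delta>^n = K \<gamma>.\<close>

lemma realization_invariants: "invariants n \<alpha> \<beta> A b \<gamma>"
  unfolding invariants_def
proof (intro conjI ballI impI)
  show "real_meromorphic_on {\<alpha>..\<beta>} (\<gamma> s)" if "s \<in> {1..n}" for s by (rule meromorphic[OF that])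
  fix t Kinv assume t: "t \<in> {\<alpha>..\<beta>}" and Kinv: "Kinv \<in> carrier_mat n n"
    and inv: "inverts_mat (Kmat n \<alpha> \<beta> A b t) Kinv \<and> inverts_mat Kinv (Kmat n \<alpha> \<beta> A b t)"
  let ?K = "Matrix.mat n n (\<lambda>(i, k). y i k t)" and ?g = "Matrix.vec n (\<lambda>i. \<gamma> (i + 1) t)"
  have K: "?K \<in> carrier_mat n n" by simp
  have one: "?K * Kinv = 1\<^sub>m n" "Kinv * ?K = 1\<^sub>m n"
    using inv Kinv unfolding Kmat_eq[OF t] inverts_mat_def by auto
  have "Determinant.det ?K * Determinant.det Kinv = 1"
    using det_mult[OF K Kinv] one by simp
  then have "t \<notin> P" using Kmat_singular_at_pole[OF t] by auto
  then have "Delta n \<alpha> \<beta> A b n t = ?K *\<^sub>v ?g"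
    unfolding Delta_last[OF t \<open>t \<notin> P\<close>]
    by (intro eq_vecI) (auto simp: scalar_prod_def atLeast0LessThan)
  then have "Kinv *\<^sub>v Delta n \<alpha> \<beta> A b n t = (Kinv * ?K) *\<^sub>v ?g"
    using Kinv by (simp add: assoc_mult_mat_vec[OF Kinv K])
  then show "?g = Kinv *\<^sub>v Delta n \<alpha> \<beta> A b n t" unfolding one by simp
qed

end

end

section \<open>Invariants of a controllable system\<close>

lemma mult_mat_vec_nth:
  assumes "B \<in> carrier_mat n n" "v \<in> carrier_vec n" "i < n"
  shows "(B *\<^sub>v v) $ i = (\<Sum>j<n. B $$ (i, j) * v $ j)"
  using assms by (simp add: scalar_prod_def atLeast0LessThan)

locale controlled_system =
  fixes n :: nat and \<alpha> \<beta> :: real and A :: "real \<Rightarrow> real mat" and b :: "real \<Rightarrow> real Matrix.vec"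
    and \<gamma> :: "nat \<Rightarrow> real \<Rightarrow> real"
  assumes n_pos: "n \<ge> 1" and less: "\<alpha> < \<beta>"
    and analytic: "analytic_system n \<alpha> \<beta> A b" and ctrl: "controllable n \<alpha> \<beta> A b"
    and inv: "invariants n \<alpha> \<beta> A b \<gamma>"
begin

abbreviation S :: "real set" where "S \<equiv> {\<alpha>..\<beta>}"
abbreviation D :: "nat \<Rightarrow> real \<Rightarrow> real Matrix.vec" where "D \<equiv> Delta n \<alpha> \<beta> A b"

lemma nontriv: "t \<in> S \<Longrightarrow> at t within S \<noteq> bot"
  using at_within_Icc_nontrivial[OF less] .

lemma analytic_expansion:
  "real_analytic_at S f t \<Longrightarrow> t \<in> S \<Longrightarrow> \<exists>F. expands_at S f t F \<and> f t = fps_nth F 0"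
  by (rule real_analytic_at_expansion[OF _ _ nontriv])

lemmas analytic_add = real_analytic_at_add[OF _ _ _ nontriv]
  and analytic_mult = real_analytic_at_mult[OF _ _ _ nontriv]
  and analytic_minus = real_analytic_at_minus[OF _ _ nontriv]
  and analytic_sum = real_analytic_at_sum[OF _ _ nontriv]

lemma analytic_has_derivative:
  assumes "real_analytic_at S f t" "t \<in> S"
  shows "(f has_real_derivative vector_derivative f (at t within S)) (at t within S)"
proof -
  obtain F where F: "expands_at S f t F" "f t = fps_nth F 0" using analytic_expansion[OF assms] by blast
  have d: "(f has_real_derivative fps_nth (fps_deriv F) 0) (at t within S)"
    by (rule expands_at_has_derivative_center[OF F assms(2)])
  then have "vector_derivative f (at t within S) = fps_nth (fps_deriv F) 0"
    by (intro vector_derivative_within[OF nontriv[OF assms(2)]])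
      (simp add: has_real_derivative_iff_has_vector_derivative)
  then show ?thesis using d by simp
qed

lemma analytic_derivative:
  assumes "\<And>x. x \<in> S \<Longrightarrow> real_analytic_at S f x" "t \<in> S"
  shows "real_analytic_at S (\<lambda>x. vector_derivative f (at x within S)) t"
proof -
  obtain F where F: "expands_at S f t F" "f t = fps_nth F 0"
    using analytic_expansion[OF assms(1) assms(2)] assms(2) by blast
  have "\<forall>\<^sub>F x in at t within S. x \<in> S" by (auto simp: eventually_at_filter)
  then have "\<forall>\<^sub>F x in at t within S.
      (f has_real_derivative vector_derivative f (at x within S)) (at x within S)"
    by (rule eventually_mono) (use analytic_has_derivative assms(1) in blast)
  from expands_at_deriv[OF F(1) this nontriv]
  have ex: "expands_at S (\<lambda>x. vector_derivative f (at x within S)) t (fps_deriv F)" .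
  have "vector_derivative f (at t within S) = fps_nth (fps_deriv F) 0"
    using expands_at_has_derivative_center[OF F assms(2)]
    by (intro vector_derivative_within[OF nontriv[OF assms(2)]])
      (simp add: has_real_derivative_iff_has_vector_derivative)
  then show ?thesis using real_analytic_atI[OF ex] by simp
qed

section \<open>The adjoint equation and the vectors \<open>Delta\<close>\<close>

lemma A_carrier: "t \<in> S \<Longrightarrow> A t \<in> carrier_mat n n"
  and b_carrier: "t \<in> S \<Longrightarrow> b t \<in> carrier_vec n"
  and A_analytic: "t \<in> S \<Longrightarrow> i < n \<Longrightarrow> j < n \<Longrightarrow> real_analytic_at S (\<lambda>t. A t $$ (i, j)) t"
  and b_analytic: "t \<in> S \<Longrightarrow> i < n \<Longrightarrow> real_analytic_at S (\<lambda>t. b t $ i) t"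
  using analytic by (auto simp: analytic_system_def real_analytic_on_def)

text \<open>Solutions of w' = - w A, the rows of \<Psi>. All coefficients are analytic, so there are
  no singular points.\<close>

sublocale dual: linear_system n "\<lambda>k j x. - A x $$ (k, j)" \<alpha> \<beta> "{}"
  using less A_analytic by unfold_locales (auto intro: analytic_minus)

lemma Delta_carrier: "t \<in> S \<Longrightarrow> D k t \<in> carrier_vec n"
proof (induction k)
  case (Suc k)
  then show ?case using A_carrier[OF Suc.prems] by simp
qed (simp add: b_carrier)

lemma Delta_Suc_nth:
  assumes "t \<in> S" "i < n"
  shows "D (Suc k) t $ i = - (\<Sum>j<n. A t $$ (i, j) * D k t $ j) +
    vector_derivative (\<lambda>\<tau>. D k \<tau> $ i) (at t within S)"
  using mult_mat_vec_nth[OF A_carrier[OF assms(1)] Delta_carrier[OF assms(1)] assms(2)] assms A_carrier[OF assms(1)]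
  by simp

lemma Delta_analytic: "t \<in> S \<Longrightarrow> i < n \<Longrightarrow> real_analytic_at S (\<lambda>\<tau>. D k \<tau> $ i) t"
proof (induction k arbitrary: t i)
  case 0
  then show ?case by (simp add: b_analytic)
next
  case (Suc k)
  have "real_analytic_at S (\<lambda>t. - (\<Sum>j<n. A t $$ (i, j) * D k t $ j) +
      vector_derivative (\<lambda>\<tau>. D k \<tau> $ i) (at t within S)) t"
    using Suc by (intro analytic_add analytic_minus analytic_sum analytic_mult A_analytic analytic_derivative) auto
  then show ?case
    by (rule real_analytic_at_cong) (rule Delta_Suc_nth[OF _ Suc.prems(2)])
qed

text \<open>For an adjoint solution w this is the k-th derivative of w b, a component of the k-th
  derivative of g.\<close>

definition pairing :: "(nat \<Rightarrow> real \<Rightarrow> real) \<Rightarrow> nat \<Rightarrow> real \<Rightarrow> real" where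
  "pairing w k x = (\<Sum>j<n. w j x * D k x $ j)"

lemma pairing_analytic:
  assumes "dual.solves S w" "t \<in> S"
  shows "real_analytic_at S (pairing w k) t"
  unfolding pairing_def[abs_def] using assms Delta_analytic
  by (intro analytic_sum analytic_mult) (auto simp: dual.solves_def)

text \<open>The product rule gives - w A \<Delta>^k + w (\<Delta>^k)', which is w
  \<Delta>^(k+1).\<close>

lemma pairing_derivative:
  assumes w: "dual.solves S w" and t: "t \<in> S"
  shows "(pairing w k has_real_derivative pairing w (Suc k) t) (at t within S)"
proof -
  let ?d = "\<lambda>j. vector_derivative (\<lambda>\<tau>. D k \<tau> $ j) (at t within S)"
  let ?w' = "\<lambda>j. \<Sum>l<n. w l t * - A t $$ (l, j)"
  have "(pairing w k has_real_derivative (\<Sum>j<n. ?w' j * D k t $ j + ?d j * w j t)) (at t within S)"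
    unfolding pairing_def[abs_def]
    using w t analytic_has_derivative[OF Delta_analytic[OF t]]
    by (intro DERIV_sum DERIV_mult) (auto simp: dual.solves_def)
  moreover have "(\<Sum>j<n. ?w' j * D k t $ j + ?d j * w j t) = pairing w (Suc k) t"
  proof -
    have "(\<Sum>j<n. ?w' j * D k t $ j) = (\<Sum>j<n. \<Sum>l<n. w l t * (- A t $$ (l, j) * D k t $ j))"
      by (simp add: sum_distrib_right mult.assoc)
    also have "\<dots> = (\<Sum>l<n. w l t * - (\<Sum>j<n. A t $$ (l, j) * D k t $ j))"
      by (subst sum.swap) (simp add: sum_distrib_left sum_negf)
    finally have 1: "(\<Sum>j<n. ?w' j * D k t $ j) = (\<Sum>j<n. w j t * - (\<Sum>l<n. A t $$ (j, l) * D k t $ l))" .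
    have "pairing w (Suc k) t = (\<Sum>j<n. w j t * (- (\<Sum>l<n. A t $$ (j, l) * D k t $ l) + ?d j))"
      unfolding pairing_def using Delta_Suc_nth[OF t] by (intro sum.cong) auto
    then have 2: "pairing w (Suc k) t =
        (\<Sum>j<n. w j t * - (\<Sum>l<n. A t $$ (j, l) * D k t $ l)) + (\<Sum>j<n. w j t * ?d j)"
      by (simp only: distrib_left sum.distrib)
    have 3: "(\<Sum>j<n. ?d j * w j t) = (\<Sum>j<n. w j t * ?d j)" by (simp only: mult.commute)
    show ?thesis unfolding sum.distrib 1 2 3 by (rule refl)
  qed
  ultimately show ?thesis by simp
qed

lemma S_interval: "S = S \<inter> {\<alpha> - 1<..<\<beta> + 1}"
  by auto

text \<open>
  The product of such a \<open>w\<close> with the state is constant along every trajectory, so \<open>w \<beta>\<close>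
  annihilates everything reachable from \<open>0\<close>.
\<close>

lemma adjoint_annihilator_zero:
  assumes w: "dual.solves S w" and w0: "\<And>x. x \<in> S \<Longrightarrow> pairing w 0 x = 0" and "x \<in> S" "j < n"
  shows "w j x = 0"
proof -
  have \<beta>: "\<beta> \<in> S" "\<alpha> \<in> S" using less by auto
  have "w j \<beta> = 0" if j: "j < n" for j
  proof -
    obtain u X where X: "trajectory n \<alpha> \<beta> A b u X" "X \<alpha> = 0\<^sub>v n" "X \<beta> = unit_vec n j"
      using ctrl unfolding controllable_def by (metis unit_vec_carrier zero_carrier_vec)
    define z where "z t = (\<Sum>j<n. w j t * X t $ j)" for t
    have "(z has_real_derivative 0) (at t within S)" if t: "t \<in> S" for t
    proof -
      have Xt: "X t \<in> carrier_vec n" using X(1) t by (simp add: trajectory_def)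
      have X': "((\<lambda>\<tau>. X \<tau> $ i) has_real_derivative (\<Sum>l<n. A t $$ (i, l) * X t $ l) + u t * b t $ i) (at t within S)"
        if i: "i < n" for i
      proof -
        have "((\<lambda>\<tau>. X \<tau> $ i) has_real_derivative (A t *\<^sub>v X t + u t \<cdot>\<^sub>v b t) $ i) (at t within S)"
          using X(1) t i by (simp add: trajectory_def)
        then show ?thesis
          using mult_mat_vec_nth[OF A_carrier[OF t] Xt i] A_carrier[OF t] b_carrier[OF t] i by simp
      qed
      let ?w' = "\<lambda>j. \<Sum>l<n. w l t * - A t $$ (l, j)"
      let ?X' = "\<lambda>i. (\<Sum>l<n. A t $$ (i, l) * X t $ l) + u t * b t $ i"
      have "(z has_real_derivative (\<Sum>j<n. ?w' j * X t $ j + ?X' j * w j t)) (at t within S)"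
        unfolding z_def[abs_def] using w t X'
        by (intro DERIV_sum DERIV_mult) (auto simp: dual.solves_def)
      moreover have "(\<Sum>j<n. ?w' j * X t $ j + ?X' j * w j t) = 0"
      proof -
        have "(\<Sum>j<n. ?w' j * X t $ j) = (\<Sum>j<n. \<Sum>l<n. w l t * (- A t $$ (l, j) * X t $ j))"
          by (simp add: sum_distrib_right mult.assoc)
        also have "\<dots> = - (\<Sum>l<n. w l t * (\<Sum>j<n. A t $$ (l, j) * X t $ j))"
          by (subst sum.swap) (simp add: sum_distrib_left sum_negf)
        finally have 1: "(\<Sum>j<n. ?w' j * X t $ j) = - (\<Sum>l<n. w l t * (\<Sum>j<n. A t $$ (l, j) * X t $ j))" .
        have "(\<Sum>j<n. ?X' j * w j t) = (\<Sum>l<n. w l t * (\<Sum>j<n. A t $$ (l, j) * X t $ j)) + u t * pairing w 0 t"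
        proof -
          have "(\<Sum>j<n. ?X' j * w j t) =
              (\<Sum>j<n. w j t * (\<Sum>l<n. A t $$ (j, l) * X t $ l) + u t * (w j t * b t $ j))"
            by (intro sum.cong refl) (simp add: algebra_simps)
          also have "\<dots> = (\<Sum>l<n. w l t * (\<Sum>j<n. A t $$ (l, j) * X t $ j)) + u t * pairing w 0 t"
            unfolding sum.distrib pairing_def sum_distrib_left[of "u t"] by simp
          finally show ?thesis .
        qed
        then show ?thesis unfolding sum.distrib 1 using w0[OF t] by simp
      qed
      ultimately show ?thesis by simp
    qed
    then obtain c where "\<And>t. t \<in> S \<Longrightarrow> z t = c"
      using has_field_derivative_zero_constant[of S z] convex_real_interval(5) by blast
    then have "z \<beta> = z \<alpha>" using \<beta> by simp
    moreover have "z \<alpha> = 0" by (simp add: z_def X(2))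
    moreover have "z \<beta> = (\<Sum>i<n. if i = j then w j \<beta> else 0)"
      unfolding z_def X(3) by (intro sum.cong) (auto simp: j)
    ultimately show ?thesis using j by simp
  qed
  \<comment> \<open>Uniqueness for the adjoint equation carries the zero value at \<beta> to the
    whole interval.\<close>
  then show ?thesis
    using dual.solves_unique[of "\<alpha> - 1" "\<beta> + 1" w \<beta> x j] w \<beta>(1) assms(3,4) by (simp flip: S_interval)
qed

lemma adjoint_basis:
  "\<exists>\<psi>. (\<forall>i. dual.solves S (\<psi> i)) \<and>
    (\<forall>c. (\<forall>x\<in>S. (\<Sum>i<n. c i * pairing (\<psi> i) 0 x) = 0) \<longrightarrow> (\<forall>j<n. c j = 0))"
proof -
  have "dual.full S" by (rule dual.full_global) (simp add: dual.regular_local_full)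
  then obtain Q where Q: "finite Q" "\<forall>p\<in>S - Q. \<forall>v. \<exists>y. dual.solves S y \<and> (\<forall>j<n. y j p = v j)"
    unfolding dual.full_def by blast
  have "infinite S" using less by (simp add: infinite_Icc)
  then obtain p where p: "p \<in> S" "p \<notin> Q" using Q(1) by (meson finite_subset subsetI)
  have "\<forall>i. \<exists>y. dual.solves S y \<and> (\<forall>j<n. y j p = (if i = j then 1 else 0))"
  proof
    show "\<exists>y. dual.solves S y \<and> (\<forall>j<n. y j p = (if i = j then 1 else 0))" for i
      using Q(2)[rule_format, of p "\<lambda>j. if i = j then 1 else 0"] p by simp
  qed
  from choice[OF this] obtain \<psi> where
    \<psi>: "\<forall>i. dual.solves S (\<psi> i) \<and> (\<forall>j<n. \<psi> i j p = (if i = j then 1 else 0))" ..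
  show ?thesis
  proof (intro exI[of _ \<psi>] conjI allI impI)
    show "dual.solves S (\<psi> i)" for i using \<psi> by blast
    fix c :: "nat \<Rightarrow> real" and j
    assume c: "\<forall>x\<in>S. (\<Sum>i<n. c i * pairing (\<psi> i) 0 x) = 0" and j: "j < n"
    let ?w = "\<lambda>j x. \<Sum>i<n. c i * \<psi> i j x"
    have w: "dual.solves S ?w" by (rule dual.solves_sum) (use \<psi> in auto)
    have "pairing ?w 0 x = (\<Sum>i<n. c i * pairing (\<psi> i) 0 x)" for x
      unfolding pairing_def sum_distrib_left sum_distrib_right
      by (subst sum.swap) (simp add: mult.assoc)
    with c have w0: "pairing ?w 0 x = 0" if "x \<in> S" for x using that by simp
    have "?w j p = 0" by (rule adjoint_annihilator_zero[OF w w0 p(1) j])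
    moreover have "?w j p = (\<Sum>i<n. if i = j then c j else 0)"
      using \<psi> j by (intro sum.cong) auto
    ultimately show "c j = 0" using j by simp
  qed
qed

text \<open>The matrix of pairings is the product of the matrix of adjoint solutions with K, so K is
  invertible at t. There the definition of the invariants gives \<Delta>^n = K \<gamma>, which is
  multiplied by w from the left.\<close>

lemma invariant_relation:
  assumes t: "t \<in> S" and det: "Determinant.det (Matrix.mat n n (\<lambda>(i, k). pairing (\<psi> i) k t)) \<noteq> 0"
  shows "pairing w n t = (\<Sum>k<n. pairing w k t * \<gamma> (Suc k) t)"
proof -
  let ?K = "Kmat n \<alpha> \<beta> A b t" and ?g = "Matrix.vec n (\<lambda>i. \<gamma> (i + 1) t)"
  have K: "?K \<in> carrier_mat n n" by (simp add: Kmat_def mat_of_cols_def)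
  have Kij: "?K $$ (i, k) = D k t $ i" if "i < n" "k < n" for i k
    using that by (simp add: Kmat_def mat_of_cols_def)
  let ?Psi = "Matrix.mat n n (\<lambda>(i, j). \<psi> i j t)"
  have "Matrix.mat n n (\<lambda>(i, k). pairing (\<psi> i) k t) = ?Psi * ?K"
    using K Kij by (intro eq_matI) (auto simp: scalar_prod_def pairing_def atLeast0LessThan)
  then have "Determinant.det ?K \<noteq> 0"
    using det det_mult[of ?Psi n ?K] K by auto
  then obtain Kinv where Kinv: "Kinv \<in> carrier_mat n n" "Kinv * ?K = 1\<^sub>m n" "?K * Kinv = 1\<^sub>m n"
    using det_non_zero_imp_unit[OF K] by (auto simp: Units_def ring_mat_def)
  then have "?g = Kinv *\<^sub>v D n t"
    using inv t K unfolding invariants_def inverts_mat_def by auto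
  then have "?K *\<^sub>v ?g = (?K * Kinv) *\<^sub>v D n t"
    using assoc_mult_mat_vec[OF K Kinv(1) Delta_carrier[OF t]] by simp
  then have "?K *\<^sub>v ?g = D n t" using Kinv(3) Delta_carrier[OF t] by simp
  then have "D n t $ i = (\<Sum>k<n. D k t $ i * \<gamma> (Suc k) t)" if "i < n" for i
    using mult_mat_vec_nth[OF K _ that, of ?g] Kij[OF that] by simp
  then have "pairing w n t = (\<Sum>j<n. w j t * (\<Sum>k<n. D k t $ j * \<gamma> (Suc k) t))"
    unfolding pairing_def by (intro sum.cong) auto
  also have "\<dots> = (\<Sum>k<n. pairing w k t * \<gamma> (Suc k) t)"
    unfolding pairing_def sum_distrib_left sum_distrib_right by (subst sum.swap) (simp add: mult.assoc)
  finally show ?thesis .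
qed

text \<open>Independence of the pairings passes from functions to their expansions at t by the
  identity theorem. The Wronskian of the expansions is then nonzero, hence
  \<open>invariant_relation\<close> is available on a punctured neighbourhood, and multiplication by
  (x - t)^m makes it a relation of power series.\<close>

lemma formal_relation:
  assumes t: "t \<in> S" and u: "\<And>s. s \<in> {1..n} \<Longrightarrow> expands_at S (\<lambda>x. (x - t) ^ m * \<gamma> s x) t (u s)"
  shows "\<exists>G. (\<forall>c. (\<Sum>i<n. fps_const (c i) * G i) = 0 \<longrightarrow> (\<forall>i<n. c i = 0)) \<and>
    (\<forall>i<n. fps_X ^ m * (fps_deriv ^^ n) (G i) = (\<Sum>k<n. u (Suc k) * (fps_deriv ^^ k) (G i)))"
proof -
  obtain \<psi> where \<psi>_all: "\<forall>i. dual.solves S (\<psi> i)"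
    and pair: "\<forall>c. (\<forall>x\<in>S. (\<Sum>i<n. c i * pairing (\<psi> i) 0 x) = 0) \<longrightarrow> (\<forall>j<n. c j = 0)"
    using adjoint_basis by (elim exE conjE)
  have \<psi>: "dual.solves S (\<psi> i)" for i using \<psi>_all by blast
  have "\<forall>i. \<exists>F. expands_at S (pairing (\<psi> i) 0) t F \<and> pairing (\<psi> i) 0 t = fps_nth F 0"
    using analytic_expansion[OF pairing_analytic[OF \<psi> t] t] by simp
  from choice[OF this] obtain G where G0: "\<forall>i. expands_at S (pairing (\<psi> i) 0) t (G i) \<and> pairing (\<psi> i) 0 t = fps_nth (G i) 0" ..
  have inS: "\<forall>\<^sub>F x in at t within S. x \<in> S" by (auto simp: eventually_at_filter)
  have G: "expands_at S (pairing (\<psi> i) k) t ((fps_deriv ^^ k) (G i))" for i k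
  proof (induction k)
    case (Suc k)
    have "\<forall>\<^sub>F x in at t within S. (pairing (\<psi> i) k has_real_derivative pairing (\<psi> i) (Suc k) x) (at x within S)"
      using inS by (rule eventually_mono) (rule pairing_derivative[OF \<psi>])
    from expands_at_deriv[OF Suc this nontriv] show ?case by simp
  qed (use G0 in simp)
  have indep: "c j = 0" if c: "(\<Sum>i<n. fps_const (c i) * G i) = 0" and j: "j < n" for c j
  proof (rule pair[rule_format, OF _ j])
    fix x assume x: "x \<in> S"
    have "expands_at S (\<lambda>x. \<Sum>i<n. c i * pairing (\<psi> i) 0 x) t (\<Sum>i<n. fps_const (c i) * G i)"
      using G0 by (intro expands_at_sum expands_at_mult expands_at_const) auto
    then have "\<forall>\<^sub>F x in at t within S. (\<Sum>i<n. c i * pairing (\<psi> i) 0 x) = 0"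
      unfolding c by (simp add: expands_at_def)
    moreover have "real_analytic_at S (\<lambda>x. \<Sum>i<n. c i * pairing (\<psi> i) 0 x) x" if "x \<in> S" for x
      using that by (intro analytic_sum analytic_mult real_analytic_at_const pairing_analytic \<psi>)
    ultimately show "(\<Sum>i<n. c i * pairing (\<psi> i) 0 x) = 0"
      by (intro analytic_identity[of S S _ t x] nontriv t x) auto
  qed
  have "Determinant.det (Matrix.mat n n (\<lambda>(i, k). (fps_deriv ^^ k) (G i))) \<noteq> 0"
    by (rule wronskian_nonzero) (intro allI impI indep)
  from expands_at_nonzero[OF expands_at_det[OF G] this]
  have ev: "\<forall>\<^sub>F x in at t within S. Determinant.det (Matrix.mat n n (\<lambda>(i, k). pairing (\<psi> i) k x)) \<noteq> 0" .
  have rel: "fps_X ^ m * (fps_deriv ^^ n) (G i) = (\<Sum>k<n. u (Suc k) * (fps_deriv ^^ k) (G i))" for i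
  proof (rule expands_at_unique[OF _ _ nontriv[OF t]])
    show "expands_at S (\<lambda>x. (x - t) ^ m * pairing (\<psi> i) n x) t (fps_X ^ m * (fps_deriv ^^ n) (G i))"
      by (intro expands_at_mult expands_at_power G)
    have "expands_at S (\<lambda>x. \<Sum>k<n. ((x - t) ^ m * \<gamma> (Suc k) x) * pairing (\<psi> i) k x) t
        (\<Sum>k<n. u (Suc k) * (fps_deriv ^^ k) (G i))"
      using u by (intro expands_at_sum expands_at_mult G) auto
    moreover have "\<forall>\<^sub>F x in at t within S. (\<Sum>k<n. ((x - t) ^ m * \<gamma> (Suc k) x) * pairing (\<psi> i) k x)
        = (x - t) ^ m * pairing (\<psi> i) n x"
      using ev inS
    proof eventually_elim
      case (elim x)
      then show ?case
        unfolding invariant_relation[OF elim(2) elim(1), of "\<psi> i"] sum_distrib_left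
        by (intro sum.cong) auto
    qed
    ultimately show "expands_at S (\<lambda>x. (x - t) ^ m * pairing (\<psi> i) n x) t
        (\<Sum>k<n. u (Suc k) * (fps_deriv ^^ k) (G i))"
      by (rule expands_at_cong)
  qed
  show ?thesis
    by (intro exI[of _ G]) (use indep rel in simp)
qed

end

context controlled_system
begin

text \<open>Combinations of the independent solutions with n different orders serve three times:
  they bound the poles, their orders are the roots, and their coefficients are the vectors demanded
  by the rank criterion.\<close>

lemma necessary_conditions:
  assumes t: "t \<in> S"
  shows "\<exists>(c :: nat \<Rightarrow> int \<Rightarrow> real) (\<kappa> :: nat \<Rightarrow> nat).
    (\<forall>s\<in>{1..n}. laurent_expansion S (\<gamma> s) t (n - s + 1) (c s)) \<and>
    (strict_mono_on {1..n} \<kappa> \<and> (\<forall>i\<in>{1..n}. Vcoeff n c (\<kappa> i) (\<kappa> i) = 0)) \<and>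
    (n \<ge> 2 \<longrightarrow> int (real_mat_rank (Vmatrix n c (\<kappa> 1) (\<kappa> n))) = int (\<kappa> n) - int (\<kappa> 1) - int n + 1)"
proof -
  have mero: "real_meromorphic_on S (\<gamma> s)" if "s \<in> {1..n}" for s
    using inv that unfolding invariants_def by blast
  have "\<exists>m u. \<forall>s\<in>{1..n}. expands_at S (\<lambda>x. (x - t) ^ m * \<gamma> s x) t (u s) \<and>
      (real_pole_at S (\<gamma> s) t \<longrightarrow> (\<exists>k<m. fps_nth (u s) k \<noteq> 0))"
    by (rule meromorphic_common_order[OF _ finite_atLeastAtMost t nontriv[OF t]]) (rule mero)
  then obtain m u where mu: "\<forall>s\<in>{1..n}. expands_at S (\<lambda>x. (x - t) ^ m * \<gamma> s x) t (u s) \<and>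
      (real_pole_at S (\<gamma> s) t \<longrightarrow> (\<exists>k<m. fps_nth (u s) k \<noteq> 0))"
    by (elim exE)
  then have u: "expands_at S (\<lambda>x. (x - t) ^ m * \<gamma> s x) t (u s)" if "s \<in> {1..n}" for s
    using that by blast
  have "\<exists>G. (\<forall>c. (\<Sum>i<n. fps_const (c i) * G i) = 0 \<longrightarrow> (\<forall>i<n. c i = 0)) \<and>
      (\<forall>i<n. fps_X ^ m * (fps_deriv ^^ n) (G i) = (\<Sum>k<n. u (Suc k) * (fps_deriv ^^ k) (G i)))"
    by (rule formal_relation[OF t]) (rule u)
  then obtain G where indep: "\<forall>c. (\<Sum>i<n. fps_const (c i) * G i) = 0 \<longrightarrow> (\<forall>i<n. c i = 0)"
    and relG: "\<forall>i<n. fps_X ^ m * (fps_deriv ^^ n) (G i) = (\<Sum>k<n. u (Suc k) * (fps_deriv ^^ k) (G i))"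
    by (elim exE conjE)
  obtain \<kappa>0 C where mono0: "strict_mono_on {..<n} \<kappa>0"
    and orders: "\<forall>i<n. fps_nth (\<Sum>l<n. fps_const (C i l) * G l) (\<kappa>0 i) \<noteq> 0 \<and>
      (\<forall>j<\<kappa>0 i. fps_nth (\<Sum>l<n. fps_const (C i l) * G l) j = 0)"
    using independent_distinct_orders[where n = n and G = G, OF indep] by (elim exE conjE)
  define Y where "Y i = (\<Sum>l<n. fps_const (C i l) * G l)" for i
  have low: "fps_nth (Y i) l = 0" if "i < n" "l < \<kappa>0 i" for i l
    using orders that by (simp add: Y_def)
  have lead: "fps_nth (Y i) (\<kappa>0 i) \<noteq> 0" if "i < n" for i
    using orders that by (simp add: Y_def)
  define u' where "u' k = fps_X ^ (n - k) * u (Suc k)" for k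
  have relY: "fps_X ^ m * (fps_X ^ n * (fps_deriv ^^ n) (Y i)) =
      (\<Sum>k<n. u' k * (fps_X ^ k * (fps_deriv ^^ k) (Y i)))" for i
  proof -
    have "fps_X ^ m * (fps_deriv ^^ n) (Y i) = (\<Sum>l<n. fps_const (C i l) * (fps_X ^ m * (fps_deriv ^^ n) (G l)))"
      unfolding Y_def higher_deriv_linear_combination sum_distrib_left by (simp add: ac_simps)
    also have "\<dots> = (\<Sum>l<n. fps_const (C i l) * (\<Sum>k<n. u (Suc k) * (fps_deriv ^^ k) (G l)))"
      using relG by simp
    also have "\<dots> = (\<Sum>k<n. u (Suc k) * (fps_deriv ^^ k) (Y i))"
      unfolding Y_def higher_deriv_linear_combination sum_distrib_left
      by (subst sum.swap) (simp add: ac_simps)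
    finally have "fps_X ^ n * (fps_X ^ m * (fps_deriv ^^ n) (Y i)) =
        fps_X ^ n * (\<Sum>k<n. u (Suc k) * (fps_deriv ^^ k) (Y i))" by simp
    also have "\<dots> = (\<Sum>k<n. u' k * (fps_X ^ k * (fps_deriv ^^ k) (Y i)))"
      unfolding sum_distrib_left
    proof (intro sum.cong refl)
      fix k assume "k \<in> {..<n}"
      then have "(fps_X :: real fps) ^ n = fps_X ^ (n - k) * fps_X ^ k" by (simp flip: power_add)
      then show "fps_X ^ n * (u (Suc k) * (fps_deriv ^^ k) (Y i)) = u' k * (fps_X ^ k * (fps_deriv ^^ k) (Y i))"
        by (simp only: u'_def ac_simps)
    qed
    finally show ?thesis by (simp only: ac_simps)
  qed
  \<comment> \<open>By \<open>relY\<close> the sum for Y i has no coefficients below m + \<kappa>0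
    i. Divisibility of u' k by X^m means that (x - t)^(n-k) \<gamma> (Suc k) is analytic, which is
    the bound on the pole order.\<close>
  have "fps_nth (u' k) j = 0" if "j < m" "k < n" for k j
  proof (rule euler_relation_coeffs[of \<kappa>0 n Y m u' j k])
    show "inj_on \<kappa>0 {..<n}" by (rule strict_mono_on_imp_inj_on[OF mono0])
    fix i l assume "i < n" "l < m + \<kappa>0 i"
    then show "fps_nth (\<Sum>j<n. u' j * (fps_X ^ j * (fps_deriv ^^ j) (Y i))) l = 0"
      unfolding relY[symmetric] fps_X_power_mult_nth[of m] fps_X_power_higher_deriv_nth
      using low[of i "l - m"] by auto
  qed (use low lead that in auto)
  then have shift: "u' k = fps_X ^ m * fps_shift m (u' k)" if "k < n" for k
    using that by (intro fps_ext) (simp add: fps_X_power_mult_nth)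
  \<comment> \<open>\<open>nat\<close> sends exponents below the range to index 0; neither the
    Laurent expansions nor V read c there.\<close>
  define c where "c s j = fps_nth (fps_shift m (u' (s - 1))) (nat (j + int (n - s + 1)))" for s :: nat and j :: int
  have c: "laurent_fps n c (Suc k) = fps_shift m (u' k)" for k
    unfolding laurent_fps_def c_def by (intro fps_ext) simp
  have relV: "fps_X ^ n * (fps_deriv ^^ n) (Y i) =
      (\<Sum>q<n. laurent_fps n c (Suc q) * (fps_X ^ q * (fps_deriv ^^ q) (Y i)))" for i
  proof -
    have "fps_X ^ m * (fps_X ^ n * (fps_deriv ^^ n) (Y i)) =
      fps_X ^ m * (\<Sum>q<n. laurent_fps n c (Suc q) * (fps_X ^ q * (fps_deriv ^^ q) (Y i)))"
      unfolding relY sum_distrib_left c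
    proof (intro sum.cong refl)
      fix q assume "q \<in> {..<n}"
      then show "u' q * (fps_X ^ q * (fps_deriv ^^ q) (Y i)) =
          fps_X ^ m * (fps_shift m (u' q) * (fps_X ^ q * (fps_deriv ^^ q) (Y i)))"
        using shift[of q] by (simp only: lessThan_iff mult.assoc[symmetric])
    qed
    then show ?thesis by simp
  qed
  have V: "(\<Sum>j\<le>k. Vcoeff n c k j * fps_nth (Y i) j) = 0" for i k
    using fuchs_relation_nth[of n "Y i" c k] unfolding relV[symmetric] by simp
  define \<kappa> where "\<kappa> i = \<kappa>0 (i - 1)" for i
  have mono: "strict_mono_on {1..n} \<kappa>"
    unfolding \<kappa>_def
  proof (rule strict_mono_onI)
    fix r s assume "r \<in> {1..n}" "s \<in> {1..n}" "r < s"
    then show "\<kappa>0 (r - 1) < \<kappa>0 (s - 1)" by (intro strict_mono_onD[OF mono0]) auto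
  qed
  have lowY: "fps_nth (Y (i - 1)) j = 0" if "i \<in> {1..n}" "j < \<kappa> i" for i j
    using low[of "i - 1" j] that by (auto simp: \<kappa>_def)
  have leadY: "fps_nth (Y (i - 1)) (\<kappa> i) \<noteq> 0" if "i \<in> {1..n}" for i
  proof -
    have "i - 1 < n" using that by auto
    then show ?thesis unfolding \<kappa>_def by (rule lead)
  qed
  have root: "\<forall>i\<in>{1..n}. Vcoeff n c (\<kappa> i) (\<kappa> i) = 0"
  proof
    fix i assume i: "i \<in> {1..n}"
    have "(\<Sum>j\<le>\<kappa> i. Vcoeff n c (\<kappa> i) j * fps_nth (Y (i - 1)) j) =
        (\<Sum>j<\<kappa> i. Vcoeff n c (\<kappa> i) j * fps_nth (Y (i - 1)) j) + Vcoeff n c (\<kappa> i) (\<kappa> i) * fps_nth (Y (i - 1)) (\<kappa> i)"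
      by (simp flip: lessThan_Suc_atMost)
    also have "(\<Sum>j<\<kappa> i. Vcoeff n c (\<kappa> i) j * fps_nth (Y (i - 1)) j) = 0"
      using lowY[OF i] by simp
    finally show "Vcoeff n c (\<kappa> i) (\<kappa> i) = 0" using V leadY[OF i] by simp
  qed
  have laurent: "laurent_expansion S (\<gamma> s) t (n - s + 1) (c s)" if s: "s \<in> {1..n}" for s
  proof -
    obtain k where k: "s = Suc k" "k < n" using s by (cases s) auto
    have e: "expands_at S (\<lambda>x. (x - t) ^ (n - k) * ((x - t) ^ m * \<gamma> s x)) t (u' k)"
      unfolding u'_def using u[OF s] k(1) by (intro expands_at_mult expands_at_power) simp
    then have rad: "fps_conv_radius (fps_shift m (u' k)) > 0" by (simp add: expands_at_def)
    have eq: "(\<lambda>x. (x - t) ^ (n - k) * ((x - t) ^ m * \<gamma> s x)) = (\<lambda>x. (x - t) ^ m * ((x - t) ^ (n - k) * \<gamma> s x))"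
      by (simp add: ac_simps)
    have "expands_at S (\<lambda>x. (x - t) ^ m * ((x - t) ^ (n - k) * \<gamma> s x)) t (fps_X ^ m * fps_shift m (u' k))"
      using e unfolding eq shift[OF k(2), symmetric] .
    then have "expands_at S (\<lambda>x. (x - t) ^ (n - k) * \<gamma> s x) t (fps_shift m (u' k))"
      by (rule expands_at_cancel_power[OF _ rad])
    then show ?thesis
      unfolding laurent_expansion_iff[OF nontriv[OF t]] using c[of k] k
      by (simp add: laurent_fps_def Suc_diff_Suc)
  qed
  have rank: "int (real_mat_rank (Vmatrix n c (\<kappa> 1) (\<kappa> n))) = int (\<kappa> n) - int (\<kappa> 1) - int n + 1" if "n \<ge> 2"
    unfolding Vmatrix_rank_iff[OF that mono root]
  proof
    fix i assume "i \<in> {1..<n}"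
    then have "i \<in> {1..n}" by simp
    then show "\<exists>Y :: nat \<Rightarrow> real. Y (\<kappa> i) \<noteq> 0 \<and> (\<forall>j<\<kappa> i. Y j = 0) \<and>
        (\<forall>k\<le>\<kappa> n. (\<Sum>j\<le>k. Vcoeff n c k j * Y j) = 0)"
      using lowY leadY V by (intro exI[of _ "fps_nth (Y (i - 1))"]) simp
  qed
  show ?thesis
    using laurent mono root rank by (intro exI[of _ c] exI[of _ \<kappa>]) simp
qed

end

theorem theorem3:
  fixes n :: nat and \<alpha> \<beta> :: real and \<gamma> :: "nat \<Rightarrow> real \<Rightarrow> real"
  assumes "n \<ge> 1" and "\<alpha> < \<beta>"
    and "\<And>s. s \<in> {1..n} \<Longrightarrow> real_meromorphic_on {\<alpha>..\<beta>} (\<gamma> s)"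
  shows
    "(\<exists>A b. analytic_system n \<alpha> \<beta> A b \<and> controllable n \<alpha> \<beta> A b \<and> invariants n \<alpha> \<beta> A b \<gamma>)
     \<longleftrightarrow>
     (\<forall>t\<in>{\<alpha>..\<beta>}. (\<exists>s\<in>{1..n}. real_pole_at {\<alpha>..\<beta>} (\<gamma> s) t) \<longrightarrow>
        (\<exists>(c :: nat \<Rightarrow> int \<Rightarrow> real) (\<kappa> :: nat \<Rightarrow> nat).
           (\<forall>s\<in>{1..n}. laurent_expansion {\<alpha>..\<beta>} (\<gamma> s) t (n - s + 1) (c s)) \<and>
           (strict_mono_on {1..n} \<kappa> \<and> (\<forall>i\<in>{1..n}. Vcoeff n c (\<kappa> i) (\<kappa> i) = 0)) \<and>
           (n \<ge> 2 \<longrightarrow>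
              int (real_mat_rank (Vmatrix n c (\<kappa> 1) (\<kappa> n)))
                = int (\<kappa> n) - int (\<kappa> 1) - int n + 1)))"
  (is "?system \<longleftrightarrow> (\<forall>t\<in>_. ?pole t \<longrightarrow> ?conditions t)")
proof
  assume ?system
  then obtain A b where Ab: "analytic_system n \<alpha> \<beta> A b" "controllable n \<alpha> \<beta> A b" "invariants n \<alpha> \<beta> A b \<gamma>"
    by (elim exE conjE)
  interpret controlled_system n \<alpha> \<beta> A b \<gamma>
    using assms(1,2) Ab by unfold_locales
  show "\<forall>t\<in>{\<alpha>..\<beta>}. ?pole t \<longrightarrow> ?conditions t"
    by (intro ballI impI necessary_conditions)
next
  assume cond: "\<forall>t\<in>{\<alpha>..\<beta>}. ?pole t \<longrightarrow> ?conditions t"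
  have "\<forall>s\<in>{1..n}. \<exists>P\<subseteq>{\<alpha>..\<beta>}. finite P \<and> (\<forall>t\<in>P. real_pole_at {\<alpha>..\<beta>} (\<gamma> s) t) \<and>
      (\<forall>t\<in>{\<alpha>..\<beta>} - P. real_analytic_at {\<alpha>..\<beta>} (\<gamma> s) t)"
    using assms(3) unfolding real_meromorphic_on_def by blast
  from bchoice[OF this] obtain P where P: "\<forall>s\<in>{1..n}. P s \<subseteq> {\<alpha>..\<beta>} \<and> finite (P s) \<and>
      (\<forall>t\<in>P s. real_pole_at {\<alpha>..\<beta>} (\<gamma> s) t) \<and>
      (\<forall>t\<in>{\<alpha>..\<beta>} - P s. real_analytic_at {\<alpha>..\<beta>} (\<gamma> s) t)" ..
  \<comment> \<open>Each point of the union is a pole of some \<gamma>, so the conditions are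
    available there; at all other points every \<gamma> is analytic.\<close>
  interpret companion n \<gamma> \<alpha> \<beta> "\<Union>s\<in>{1..n}. P s"
    using assms P by unfold_locales auto
  have "full {\<alpha>..\<beta>}"
  proof (rule full_global)
    fix t assume t: "t \<in> {\<alpha>..\<beta>}"
    show "\<exists>r>0. full ({\<alpha>..\<beta>} \<inter> {t - r<..<t + r})"
    proof (cases "t \<in> (\<Union>s\<in>{1..n}. P s)")
      case True
      then have "?conditions t" using cond t poles by blast
      then show ?thesis by (elim exE conjE) (rule singular_local_full[OF t True])
    next
      case False
      then show ?thesis by (rule regular_local_full[OF t])
    qed
  qed
  from independent_solutions[OF this] obtain y where y: "\<forall>i. solves {\<alpha>..\<beta>} (y i)"
    "\<forall>c. (\<forall>x\<in>{\<alpha>..\<beta>}. (\<Sum>i<n. c i * y i 0 x) = 0) \<longrightarrow> (\<forall>j<n. c j = 0)"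
    by (elim exE conjE)
  note real = y(1) refl y(2)
  show ?system
    by (intro exI[of _ "\<lambda>_. 0\<^sub>m n n"] exI[of _ "\<lambda>t. Matrix.vec n (\<lambda>i. y i 0 t)"] conjI realization_analytic[OF real]
        realization_controllable[OF real] realization_invariants[OF real])
qed

end
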